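(* Let $p(\cdot):G\to[1,\infty)$ be a measurable function with $1<p_-\le p_+<\infty$. Then the maximal operator $M$ is bounded on $L^{p(\cdot)}(G)$ if and only if $M$ is bounded on $L^{p'(\cdot)}(G)$.
   Context: Group. Let $\{p_i\}_{i\ge0}$ be a sequence of integers with $p_i\ge2$ (no boundedness is assumed), $G=\prod_{i=0}^\infty\mathbb{Z}_{p_i}$ the direct product of cyclic groups of order $p_i$, and $\mu$ the Haar measure on $G$ normalized by $\mu(G)=1$. Elements of $G$ are sequences $x=\{x_i\}$ with $0\le x_i<p_i$; addition is coordinatewise modulo $p_i$. Generalized intervals. $\mathcal{F}$ is the collection of all sets of the form $x+\{y\in G: y_i=0 \text{ for } i<k,\ 0\le y_k<j\}$ with $x\in G$, $k\ge0$, $1\le j\le p_k$. Maximal function. $Mf(x)=\sup_{x\in I,\,I\in\mathcal{F}}\frac{1}{\mu(I)}\int_I|f|\,d\mu$. Variable Lebesgue space. For measurable $p(\cdot):G\to[1,\infty)$, $L^{p(\cdot)}(G)$ is the set of measurable $f$ such that $\int_G(|f(x)|/\lambda)^{p(x)}d\mu<\infty$ for some $\lambda>0$, with norm $\|f\|_{p(\cdot)}=\inf\{\lambda>0:\int_G(|f(x)|/\lambda)^{p(x)}d\mu\le1\}$. Write $p_-=\operatorname{ess\,inf}_{x\in G}p(x)$, $p_+=\operatorname{ess\,sup}_{x\in G}p(x)$, and let $p'(\cdot)$ be the conjugate exponent, $1/p(x)+1/p'(x)=1$. $M$ is bounded on $L^{q(\cdot)}(G)$ if there is a constant $C$ with $\|Mf\|_{q(\cdot)}\le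 C\|f\|_{q(\cdot)}$ for all $f\in L^{q(\cdot)}(G)$. *)

theory Defs
  imports
    "HOL-Probability.Probability"
    "HOL-Algebra.Coset"
    "HOL-Algebra.Elementary_Groups"
    "HOL-Algebra.Product_Groups"
begin

definition cyclic_product :: "(nat \<Rightarrow> nat) \<Rightarrow> (nat \<Rightarrow> int) monoid" where
  "cyclic_product m = product_group UNIV (\<lambda>i. integer_mod_group (m i))"

text \<open>
  The product of the uniform probability measures on the factors. The lemmas at the end of
  this theory show that it is the normalized Haar measure: a probability measure on the Borel
  sets of the product topology which is invariant under translations.
\<close>
definition haar :: "(nat \<Rightarrow> nat) \<Rightarrow> (nat \<Rightarrow> int) measure" where
  "haar m = PiM UNIV (\<lambda>i. uniform_count_measure (carrier (integer_mod_group (m i))))"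

definition gen_intervals :: "(nat \<Rightarrow> nat) \<Rightarrow> (nat \<Rightarrow> int) set set" where
  "gen_intervals m =
     {x <#\<^bsub>cyclic_product m\<^esub>
        {y \<in> carrier (cyclic_product m). (\<forall>i<k. y i = 0) \<and> 0 \<le> y k \<and> y k < int j} | x k j.
      x \<in> carrier (cyclic_product m) \<and> 1 \<le> j \<and> j \<le> m k}"

text \<open>Valued in \<^typ>\<open>ennreal\<close>, since the supremum may be infinite.\<close>
definition maximal_fun :: "(nat \<Rightarrow> nat) \<Rightarrow> ((nat \<Rightarrow> int) \<Rightarrow> real) \<Rightarrow> (nat \<Rightarrow> int) \<Rightarrow> ennreal" where
  "maximal_fun m f x =
     (SUP I\<in>{I \<in> gen_intervals m. x \<in> I}.
        (\<integral>\<^sup>+y\<in>I. ennreal \<bar>f y\<bar> \<partial>haar m) / emeasure (haar m) I)"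

text \<open>The power \<open>t\<^sup>a\<close> for \<open>a > 0\<close>.\<close>
definition ennreal_power :: "ennreal \<Rightarrow> real \<Rightarrow> ennreal" where
  "ennreal_power t a = (if t = \<infinity> then \<infinity> else ennreal (enn2real t powr a))"

definition modular :: "'a measure \<Rightarrow> ('a \<Rightarrow> real) \<Rightarrow> ('a \<Rightarrow> ennreal) \<Rightarrow> ennreal" where
  "modular M p u = (\<integral>\<^sup>+x. ennreal_power (u x) (p x) \<partial>M)"

text \<open>
  The modular and the norm take the absolute value of a function as their argument, so that they
  also apply to the maximal function. The norm is infinite if no \<open>l\<close> is admissible.
\<close>
definition luxemburg_norm :: "'a measure \<Rightarrow> ('a \<Rightarrow> real) \<Rightarrow> ('a \<Rightarrow> ennreal) \<Rightarrow> ennreal" where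
  "luxemburg_norm M p u =
     Inf {ennreal l | l::real. 0 < l \<and> modular M p (\<lambda>x. u x / ennreal l) \<le> 1}"

definition variable_Lebesgue :: "'a measure \<Rightarrow> ('a \<Rightarrow> real) \<Rightarrow> ('a \<Rightarrow> real) set" where
  "variable_Lebesgue M p =
     {f \<in> borel_measurable M. \<exists>l::real. 0 < l \<and> modular M p (\<lambda>x. ennreal \<bar>f x\<bar> / ennreal l) < \<infinity>}"

definition maximal_bounded :: "(nat \<Rightarrow> nat) \<Rightarrow> ((nat \<Rightarrow> int) \<Rightarrow> real) \<Rightarrow> bool" where
  "maximal_bounded m p \<longleftrightarrow>
     (\<exists>C::real. 0 \<le> C \<and> (\<forall>f \<in> variable_Lebesgue (haar m) p.
        luxemburg_norm (haar m) p (maximal_fun m f)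
          \<le> ennreal C * luxemburg_norm (haar m) p (\<lambda>x. ennreal \<bar>f x\<bar>)))"

definition exponent_fun :: "'a measure \<Rightarrow> ('a \<Rightarrow> real) \<Rightarrow> bool" where
  "exponent_fun M p \<longleftrightarrow> p \<in> borel_measurable M \<and> (\<forall>x\<in>space M. 1 \<le> p x)"

text \<open>
  An almost everywhere condition: where \<open>p x = 1\<close>, which is a null set if the essential infimum
  of \<open>p\<close> exceeds 1, no finite conjugate exponent exists.
\<close>
definition conjugate_exponents :: "'a measure \<Rightarrow> ('a \<Rightarrow> real) \<Rightarrow> ('a \<Rightarrow> real) \<Rightarrow> bool" where
  "conjugate_exponents M p q \<longleftrightarrow> (AE x in M. 1 / p x + 1 / q x = 1)"

text \<open>The counterpart of \<^const>\<open>esssup\<close>, which the library lacks.\<close>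
definition essinf :: "'a measure \<Rightarrow> ('a \<Rightarrow> ereal) \<Rightarrow> ereal" where
  "essinf M f = Sup {c. AE x in M. c \<le> f x}"

lemma prob_space_factor:
  assumes "n \<ge> 2"
  shows "prob_space (uniform_count_measure (carrier (integer_mod_group n)))"
  using assms by (intro prob_space_uniform_count_measure) (auto simp: carrier_integer_mod_group)

lemma prob_space_haar:
  assumes "\<And>i. m i \<ge> 2"
  shows "prob_space (haar m)"
  unfolding haar_def using assms by (intro prob_space_PiM prob_space_factor)

lemma space_haar: "space (haar m) = carrier (cyclic_product m)"
  by (simp add: haar_def cyclic_product_def space_PiM space_uniform_count_measure)

lemma haar_translation_invariant:
  assumes m: "\<And>i. m i \<ge> 2" and x: "x \<in> carrier (cyclic_product m)"
  shows "distr (haar m) (haar m) (\<lambda>y. x \<otimes>\<^bsub>cyclic_product m\<^esub> y) = haar m"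
proof -
  define C where "C i = carrier (integer_mod_group (m i))" for i
  define T where "T i = (\<lambda>y. x i \<otimes>\<^bsub>integer_mod_group (m i)\<^esub> y)" for i
  have xC: "x i \<in> C i" for i
    using x by (auto simp: C_def cyclic_product_def PiE_iff)
  have fin: "finite (C i)" for i
    using m[of i] by (auto simp: C_def carrier_integer_mod_group)
  have bij: "bij_betw (T i) (C i) (C i)" for i
  proof -
    interpret group "integer_mod_group (m i)" by simp
    have inj: "inj_on (T i) (C i)"
      using xC[of i] by (auto simp: T_def C_def inj_on_def simp del: mult_integer_mod_group)
    moreover have "T i ` C i \<subseteq> C i"
      using xC[of i] by (auto simp: T_def C_def simp del: mult_integer_mod_group)
    ultimately show ?thesis
      using fin by (simp add: bij_betw_def endo_inj_surj)
  qed
  have mult: "(\<lambda>y. x \<otimes>\<^bsub>cyclic_product m\<^esub> y) = (\<lambda>y i. T i (y i))"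
    by (auto simp: cyclic_product_def product_group_def T_def fun_eq_iff)
  interpret product_prob_space "\<lambda>i. uniform_count_measure (C i)" UNIV
    by (auto simp: product_prob_space_def product_prob_space_axioms_def product_sigma_finite_def
        C_def intro!: prob_space_factor m prob_space_imp_sigma_finite)
  have haar: "haar m = PiM UNIV (\<lambda>i. uniform_count_measure (C i))"
    by (simp add: haar_def C_def)
  have TC: "T i y \<in> C i" if "y \<in> C i" for i y
    using bij[of i] that by (auto simp: bij_betw_def)
  have meas_T: "T i \<in> measurable (uniform_count_measure (C i)) (uniform_count_measure (C i))" for i
    using TC by (auto simp: measurable_def space_uniform_count_measure sets_uniform_count_measure)
  have meas: "(\<lambda>y i. T i (y i)) \<in> measurable (haar m) (haar m)"
    unfolding haar
  proof (rule measurable_PiM_single')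
    show "(\<lambda>y. T i (y i)) \<in> measurable (PiM UNIV (\<lambda>i. uniform_count_measure (C i))) (uniform_count_measure (C i))" for i
    proof -
      have "(\<lambda>y. y i) \<in> measurable (PiM UNIV (\<lambda>i. uniform_count_measure (C i))) (uniform_count_measure (C i))"
        by (rule measurable_component_singleton) simp
      from measurable_compose[OF this meas_T[of i]] show ?thesis .
    qed
  qed (auto simp: TC space_PiM space_uniform_count_measure PiE_iff)
  show ?thesis
    unfolding mult haar
  proof (rule PiM_eq)
    fix J :: "nat set" and F
    assume J: "finite J" "J \<subseteq> UNIV" and F: "\<And>j. j \<in> J \<Longrightarrow> F j \<in> sets (uniform_count_measure (C j))"
    define F' where "F' j = {y \<in> C j. T j y \<in> F j}" for j
    have card: "card (F' j) = card (F j)" if "j \<in> J" for j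
    proof -
      have "T j ` F' j = F j"
      proof
        show "F j \<subseteq> T j ` F' j"
        proof
          fix z assume z: "z \<in> F j"
          then have "z \<in> T j ` C j"
            using F[OF that] bij[of j] by (auto simp: bij_betw_def sets_uniform_count_measure)
          then show "z \<in> T j ` F' j" using z by (auto simp: F'_def)
        qed
      qed (auto simp: F'_def)
      moreover have "inj_on (T j) (F' j)"
        using bij[of j] by (auto simp: F'_def bij_betw_def intro: inj_on_subset)
      ultimately show ?thesis by (metis card_image)
    qed
    let ?P = "PiM UNIV (\<lambda>i. uniform_count_measure (C i))"
    have "emeasure (distr ?P ?P (\<lambda>y i. T i (y i))) (prod_emb UNIV (\<lambda>i. uniform_count_measure (C i)) J (Pi\<^sub>E J F))
        = emeasure ?P ((\<lambda>y i. T i (y i)) -` prod_emb UNIV (\<lambda>i. uniform_count_measure (C i)) J (Pi\<^sub>E J F) \<inter> space ?P)"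
      using meas F J by (intro emeasure_distr) (auto simp: haar intro!: sets_PiM_I)
    also have "(\<lambda>y i. T i (y i)) -` prod_emb UNIV (\<lambda>i. uniform_count_measure (C i)) J (Pi\<^sub>E J F) \<inter> space ?P
        = prod_emb UNIV (\<lambda>i. uniform_count_measure (C i)) J (Pi\<^sub>E J F')"
      using TC by (auto simp: prod_emb_def space_PiM space_uniform_count_measure F'_def PiE_iff)
    also have "emeasure ?P \<dots> = (\<Prod>j\<in>J. emeasure (uniform_count_measure (C j)) (F' j))"
      using J by (intro emeasure_PiM_emb) (auto simp: sets_uniform_count_measure F'_def)
    also have "\<dots> = (\<Prod>j\<in>J. emeasure (uniform_count_measure (C j)) (F j))"
    proof (rule prod.cong[OF refl])
      fix j assume j: "j \<in> J"
      have "F' j \<subseteq> C j" "F j \<subseteq> C j"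
        using F[OF j] by (auto simp: F'_def sets_uniform_count_measure)
      then show "emeasure (uniform_count_measure (C j)) (F' j) = emeasure (uniform_count_measure (C j)) (F j)"
        using fin[of j] card[OF j] by (simp add: emeasure_uniform_count_measure)
    qed
    finally show "emeasure (distr ?P ?P (\<lambda>y i. T i (y i))) (prod_emb UNIV (\<lambda>i. uniform_count_measure (C i)) J (Pi\<^sub>E J F))
        = (\<Prod>j\<in>J. emeasure (uniform_count_measure (C j)) (F j))" .
  qed simp
qed

instance int :: second_countable_topology
proof
  show "\<exists>B::int set set. countable B \<and> open = generate_topology B"
    by (intro exI[of _ "range lessThan \<union> range greaterThan"]) (auto simp: open_int_def)
qed

lemma sets_haar:
  "sets (haar m) = sets (restrict_space borel (carrier (cyclic_product m)))"
proof
  have "{x \<in> carrier (cyclic_product m). x i \<in> A} \<in> sets (restrict_space borel (carrier (cyclic_product m)))"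
    for i and A :: "int set"
  proof -
    have "{x :: nat \<Rightarrow> int. x i \<in> A} \<in> sets borel"
    proof -
      have "(\<lambda>x :: nat \<Rightarrow> int. x i) -` A \<inter> space borel \<in> sets borel"
        by (rule measurable_sets[OF measurable_product_coordinates])
           (simp add: sets_borel_eq_count_space)
      then show ?thesis by (simp add: vimage_def)
    qed
    then show ?thesis
      by (auto simp: sets_restrict_space)
  qed
  then show "sets (haar m) \<subseteq> sets (restrict_space borel (carrier (cyclic_product m)))"
    unfolding haar_def
    by (intro sets_PiM_in_sets)
       (auto simp: space_restrict_space space_uniform_count_measure cyclic_product_def)
  have "(\<lambda>x. x) \<in> measurable (haar m) (PiM UNIV (\<lambda>i. borel :: int measure))"
  proof (rule measurable_PiM_single')
    fix i :: nat
    have "(\<lambda>x. x) \<in> measurable (uniform_count_measure (carrier (integer_mod_group (m i)))) (borel :: int measure)"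
      by (auto simp: measurable_def space_uniform_count_measure sets_uniform_count_measure)
    then show "(\<lambda>x. x i) \<in> measurable (haar m) (borel :: int measure)"
      unfolding haar_def
      by (auto intro: measurable_compose[OF measurable_component_singleton])
  qed auto
  note id = this
  have "B \<inter> space (haar m) \<in> sets (haar m)" if B: "B \<in> sets borel" for B
  proof -
    have "B \<in> sets (PiM UNIV (\<lambda>i. borel :: int measure))"
      unfolding sets_PiM_equal_borel by (rule B)
    from measurable_sets[OF id this] show ?thesis by simp
  qed
  then show "sets (restrict_space borel (carrier (cyclic_product m))) \<subseteq> sets (haar m)"
    by (auto simp: sets_restrict_space space_haar Int_commute)
qed

end

theory Submission
  imports Defs
begin

text \<open>
  The exponent \<open>p\<close> is replaced by a condition \<open>A\<close> which is symmetric in \<open>p\<close> and its conjugate \<open>q\<close>: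
  uniformly in the interval \<open>Q\<close>, the product \<open>\<parallel>1\<^sub>Q\<parallel>\<^sub>p \<parallel>1\<^sub>Q\<parallel>\<^sub>q\<close> of the norms is at most
  a multiple of \<open>\<mu>(Q)\<close>. Boundedness of \<open>M\<close> implies \<open>A\<close> by testing on one function per
  interval. Conversely, interpolating \<open>A\<close> with the trivial case \<open>t = 1\<close> shows that the weights
  \<open>t\<^bsup>p(x)\<^esup>\<close> with \<open>t \<ge> 1\<close> and \<open>\<integral>\<^sub>Q t\<^bsup>p(x)\<^esup> \<le> D\<close> are uniformly \<open>A\<^sub>\<infinity>\<close> on \<open>Q\<close>, so that they satisfy
  a reverse Hoelder inequality. Applied to \<open>q\<close>, it improves \<open>A\<close> for \<open>p\<close> to the exponent
  \<open>p - \<epsilon>\<close>, and since \<open>l\<^bsup>\<epsilon>\<^esup>\<close> is a constant factor on the level set \<open>{M f > l}\<close>, the weak type estimate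
  for \<open>p - \<epsilon>\<close> gives the strong one for \<open>p\<close> as in Marcinkiewicz interpolation. The only
  geometric facts used are that of three intervals with a common point one is covered by the
  other two, and that an interval can be enlarged within a bigger one while at most doubling
  its measure.
\<close>

subsection \<open>Power inequalities\<close>

text \<open>Two obstacles shape the proof. The modular is not homogeneous, so an estimate on one
  interval cannot be rescaled, and norms over different intervals do not add up. The improved
  condition is therefore stated without norms: an interval on which the average of \<open>f\<close>
  is large compared with \<open>t\<close> satisfies
  \<open>\<integral> t^(p - e) \<le> \<integral> f^(p - e)\<close>, and such inequalities can be
  summed over a cover of bounded overlap. This is why a condition on single intervals suffices,
  rather than one on families of intervals. Only heights \<open>t \<ge> 1\<close> have to be
  treated, since the lower ones contribute a constant on a space of measure 1. The other obstacle is
  that \<open>m\<close> may be unbounded: a cylinder can be arbitrarily small compared with the next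
  larger one, so passing to the parent cylinder loses an uncontrolled factor. The intervals between
  the two fill this gap, and lengthening an arc by one residue takes the place of passing to the
  parent.\<close>

lemma sum_pow2_below_le:
  fixes y b :: real
  assumes "0 < b" "0 < y"
  shows "(\<Sum>k<n. if 2^k < y then (2^k) powr b else 0) \<le> (2 powr b / (2 powr b - 1)) * y powr b"
proof -
  define c where "c = 2 powr b"
  have c1: "1 < c" unfolding c_def using assms by simp
  have pw: "(2^k) powr b = c ^ k" for k
    unfolding c_def by (simp add: powr_realpow [symmetric] powr_powr mult.commute)
  define S where "S n = (\<Sum>k<n. if 2^k < y then c^k else 0)" for n
  have 1: "S n \<le> c^n / (c - 1)" for n
  proof -
    have "S n \<le> (\<Sum>k<n. c^k)" unfolding S_def using c1 by (intro sum_mono) auto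
    also have "\<dots> = (c^n - 1) / (c - 1)" using c1 by (simp add: geometric_sum)
    also have "\<dots> \<le> c^n / (c - 1)" using c1 by (intro divide_right_mono) auto
    finally show ?thesis .
  qed
  have "S n \<le> c / (c - 1) * y powr b"
  proof (induction n)
    case (Suc n)
    show ?case
    proof (cases "2^n < y")
      case True
      have "S (Suc n) \<le> c / (c - 1) * c^n" using 1[of "Suc n"] by simp
      also have "\<dots> \<le> c / (c - 1) * y powr b" unfolding pw[symmetric]
        using True assms c1 by (intro mult_left_mono powr_mono2) auto
      finally show ?thesis .
    qed (use Suc in \<open>simp add: S_def\<close>)
  qed (use c1 in \<open>simp add: S_def\<close>)
  then show ?thesis unfolding S_def pw c_def[symmetric] .
qed

lemma powr_le_one_plus:
  fixes y :: real
  assumes "0 \<le> y" "0 \<le> \<theta>" "\<theta> \<le> r"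
  shows "y powr \<theta> \<le> 1 + y powr r"
proof (cases "y \<le> 1")
  case True
  then have "y powr \<theta> \<le> 1" using assms by (intro powr_le1) auto
  then show ?thesis by (smt (verit) powr_ge_zero)
next
  case False
  then have "y powr \<theta> \<le> y powr r" using assms by (intro powr_mono) auto
  then show ?thesis by simp
qed

text \<open>Young's inequality with the constants \<open>1 / p\<close> and \<open>1 / q\<close>
  weakened to 1. The curve \<open>b = a powr (p - 1)\<close>, equivalently
  \<open>a = b powr (q - 1)\<close>, separates the region where \<open>a powr p\<close> alone
  dominates from the one where \<open>b powr q\<close> does.\<close>

lemma mult_le_powr_add_powr:
  fixes a b :: real
  assumes "0 \<le> a" "0 \<le> b" "1 < p" "1 < q" "1 / p + 1 / q = 1"
  shows "a * b \<le> a powr p + b powr q"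
proof -
  have pq: "(p - 1) * (q - 1) = 1" using assms by (simp add: field_simps)
  consider "a = 0 \<or> b = 0" | "a > 0" "b > 0" "b \<le> a powr (p - 1)" | "a > 0" "b > 0" "a powr (p - 1) < b"
    using assms by force
  then show ?thesis
  proof cases
    case 1
    then show ?thesis by auto
  next
    case 2
    then have "a * b \<le> a * a powr (p - 1)" by (intro mult_left_mono) auto
    also have "\<dots> = a powr p" using 2 by (simp add: powr_mult_base)
    finally show ?thesis by (smt (verit) powr_ge_zero)
  next
    case 3
    have "a = (a powr (p - 1)) powr (q - 1)" using 3 pq by (simp add: powr_powr)
    also have "\<dots> \<le> b powr (q - 1)" using 3 assms by (intro powr_mono2) auto
    finally have "a * b \<le> b powr (q - 1) * b" using 3 by simp
    also have "\<dots> = b powr q" using 3 powr_mult_base[of b "q - 1"] by (simp add: mult.commute)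
    finally show ?thesis by (smt (verit) powr_ge_zero)
  qed
qed

text \<open>Young's inequality with a free parameter. The height \<open>y powr (1 / (r - 1))\<close>
  is the solution of \<open>h = h powr r / y\<close>: up to it the second term suffices, above it
  the first.\<close>

lemma le_powr_div_plus_powr:
  fixes h y r :: real
  assumes "0 \<le> h" "0 < y" "1 < r"
  shows "h \<le> h powr r / y + y powr (1 / (r - 1))"
proof (cases "h \<le> y powr (1 / (r - 1))")
  case True
  then show ?thesis using assms by (smt (verit) divide_nonneg_pos powr_ge_zero)
next
  case False
  then have h: "0 < h" using assms by (smt (verit) powr_ge_zero)
  have "y = (y powr (1 / (r - 1))) powr (r - 1)" using assms by (simp add: powr_powr)
  also have "\<dots> \<le> h powr (r - 1)" using False assms by (intro powr_mono2) auto
  finally have "y * h \<le> h powr (r - 1) * h" using h by (intro mult_right_mono) auto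
  also have "\<dots> = h powr r" using h powr_mult_base[of h "r - 1"] by (simp add: mult.commute)
  finally have "h \<le> h powr r / y" using assms by (simp add: field_simps)
  then show ?thesis by (smt (verit) powr_ge_zero)
qed

text \<open>A discrete layer cake formula: \<open>w powr d\<close> is reached by adding the
  increments of the power over the dyadic heights below \<open>w\<close>. The relative increment
  \<open>2 powr d - 1\<close> tends to 0 with \<open>d\<close>, and this smallness permits the
  absorption in \<open>reverse_hoelder\<close>.\<close>

lemma powr_le_telescope:
  fixes b d w :: real
  assumes "0 < b" "0 \<le> d" "0 \<le> w" "w \<le> b * 2^n"
  shows "w powr d \<le> b powr d + (\<Sum>k<n. if b * 2^k < w then (2 powr d - 1) * (b * 2^k) powr d else 0)"
  using assms(4)
proof (induction n)
  case 0
  then show ?case using assms by (simp add: powr_mono2)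
next
  case (Suc n)
  have d1: "1 \<le> 2 powr d" using assms by (simp add: ge_one_powr_ge_zero)
  show ?case
  proof (cases "w \<le> b * 2^n")
    case True
    then show ?thesis using Suc d1 by simp
  next
    case False
    have "b * 2^k < w" if "k < Suc n" for k
    proof -
      have "b * 2^k \<le> b * 2^n" using that assms by (intro mult_left_mono power_increasing) auto
      then show ?thesis using False by simp
    qed
    then have "(\<Sum>k<Suc n. if b * 2^k < w then (2 powr d - 1) * (b * 2^k) powr d else 0)
        = (\<Sum>k<Suc n. (b * 2^Suc k) powr d - (b * 2^k) powr d)"
      using assms by (intro sum.cong) (auto simp: powr_mult algebra_simps)
    also have "\<dots> = (b * 2^Suc n) powr d - b powr d"
      by (subst sum_lessThan_telescope) simp
    finally show ?thesis using Suc.prems assms by (simp add: powr_mono2)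
  qed
qed

lemma two_powr_le:
  fixes d :: real
  assumes "0 \<le> d" "d \<le> 1"
  shows "2 powr d \<le> 1 + 2 * d"
proof -
  have l: "0 \<le> ln (2::real)" "ln (2::real) \<le> 1" using ln_le_minus_one[of 2] by auto
  have x: "0 \<le> d * ln 2" "d * ln 2 \<le> d" using assms l by (auto simp: mult_left_le)
  then have "exp (d * ln 2) \<le> 1 + d * ln 2 + (d * ln 2)\<^sup>2" using assms by (intro exp_bound) auto
  also have "(d * ln 2)\<^sup>2 \<le> d * 1" unfolding power2_eq_square using x assms by (intro mult_mono) auto
  finally show ?thesis using x by (simp add: powr_def)
qed

subsection \<open>Covering by intervals\<close>

text \<open>\<open>F_extend\<close> stands in for a doubling condition and is local:
  \<open>J\<close> stays inside \<open>Q\<close>, so that stopping arguments can be run within one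
  interval. \<open>F_finite_above\<close> provides maximal stopping intervals, and
  \<open>F_outer\<close> is the regularity behind the differentiation of integrals.\<close>

locale interval_basis = prob_space M for M :: "'a measure" +
  fixes F :: "'a set set"
  assumes F_sets: "I \<in> F \<Longrightarrow> I \<in> sets M"
    and F_pos: "I \<in> F \<Longrightarrow> 0 < measure M I"
    and F_countable: "countable F"
    and F_triple: "\<lbrakk>I1 \<in> F; I2 \<in> F; I3 \<in> F; x \<in> I1; x \<in> I2; x \<in> I3\<rbrakk>
          \<Longrightarrow> I1 \<subseteq> I2 \<union> I3 \<or> I2 \<subseteq> I1 \<union> I3 \<or> I3 \<subseteq> I1 \<union> I2"
    and F_extend: "\<lbrakk>I \<in> F; Q \<in> F; I \<subset> Q\<rbrakk>
          \<Longrightarrow> \<exists>J\<in>F. I \<subset> J \<and> J \<subseteq> Q \<and> measure M J \<le> 2 * measure M I"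
    and F_finite_above: "I \<in> F \<Longrightarrow> finite {J\<in>F. I \<subseteq> J}"
    and F_outer: "\<lbrakk>A \<in> sets M; Q \<in> F; A \<subseteq> Q; 0 < e\<rbrakk>
          \<Longrightarrow> \<exists>C\<subseteq>F. A \<subseteq> \<Union>C \<and> (\<forall>I\<in>C. I \<subseteq> Q) \<and> measure M (\<Union>C) \<le> measure M A + e"
begin

text \<open>In a subcover of least cardinality no member is covered by two others, whereas by
  \<open>F_triple\<close> three members through a common point would produce such a member.\<close>

lemma finite_subcover_overlap:
  assumes "finite C" "C \<subseteq> F"
  shows "\<exists>D\<subseteq>C. \<Union>D = \<Union>C \<and> (\<forall>x. card {I\<in>D. x \<in> I} \<le> 2)"
proof -
  define P where "P D \<longleftrightarrow> D \<subseteq> C \<and> \<Union>D = \<Union>C" for D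
  have "P C" by (simp add: P_def)
  then obtain D where D: "P D" and min: "\<And>E. P E \<Longrightarrow> card D \<le> card E"
    using arg_min_nat_lemma[of P C card] by (metis (full_types) arg_min_nat_lemma)
  have DC: "D \<subseteq> C" "\<Union>D = \<Union>C" using D by (auto simp: P_def)
  have fD: "finite D" using DC assms finite_subset by blast
  have no: "\<not> J1 \<subseteq> J2 \<union> J3" if "J1 \<in> D" "J2 \<in> D" "J3 \<in> D" "J1 \<noteq> J2" "J1 \<noteq> J3" for J1 J2 J3
  proof
    assume "J1 \<subseteq> J2 \<union> J3"
    then have "\<Union>(D - {J1}) = \<Union>D" using that by blast
    then have "P (D - {J1})" using DC by (auto simp: P_def)
    from min[OF this] show False using that fD by (meson card_Diff1_less linorder_not_less)
  qed
  have "card {I\<in>D. x \<in> I} \<le> 2" for x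
  proof (rule ccontr)
    assume "\<not> ?thesis"
    then have "3 \<le> card {I\<in>D. x \<in> I}" by simp
    then obtain T where T: "T \<subseteq> {I\<in>D. x \<in> I}" "card T = 3"
      by (meson obtain_subset_with_card_n)
    then obtain J1 J2 J3 where J: "T = {J1, J2, J3}" "J1 \<noteq> J2" "J1 \<noteq> J3" "J2 \<noteq> J3"
      by (metis card_3_iff)
    have "J1 \<in> D" "J2 \<in> D" "J3 \<in> D" "x \<in> J1" "x \<in> J2" "x \<in> J3" using T J by auto
    moreover have "D \<subseteq> F" using DC assms by auto
    ultimately have "J1 \<subseteq> J2 \<union> J3 \<or> J2 \<subseteq> J1 \<union> J3 \<or> J3 \<subseteq> J1 \<union> J2"
      by (intro F_triple[of J1 J2 J3 x]) auto
    then show False using no \<open>J1 \<in> D\<close> \<open>J2 \<in> D\<close> \<open>J3 \<in> D\<close> J by metis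
  qed
  then show ?thesis using DC by blast
qed

lemma F_Union_sets: "C \<subseteq> F \<Longrightarrow> \<Union>C \<in> sets M"
  using F_countable F_sets by (intro sets.countable_Union) (auto intro: countable_subset)

lemma integrable_imp_set_integrable:
  fixes f :: "'a \<Rightarrow> real"
  assumes "integrable M f" "A \<in> sets M"
  shows "set_integrable M A f"
  unfolding set_integrable_def using assms by (intro integrable_mult_indicator)

text \<open>On an economical subcover the sum of the indicators lies between the indicator of the
  union and twice that indicator. Thus inequalities on single intervals, which may overlap, add up
  to one on the union.\<close>

lemma set_integral_finite_Union_le:
  fixes g h :: "'a \<Rightarrow> real"
  assumes C: "finite C" "C \<subseteq> F" and g: "integrable M g" and h: "integrable M h"
    and g0: "\<And>x. 0 \<le> g x" and h0: "\<And>x. 0 \<le> h x"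
    and le: "\<And>I. I \<in> C \<Longrightarrow> (LINT x:I|M. g x) \<le> (LINT x:I|M. h x)"
  shows "(LINT x:\<Union>C|M. g x) \<le> 2 * (LINT x:\<Union>C|M. h x)"
proof -
  obtain D where D: "D \<subseteq> C" "\<Union>D = \<Union>C" and ov: "\<And>x. card {I\<in>D. x \<in> I} \<le> 2"
    using finite_subcover_overlap[OF C] by blast
  have fD: "finite D" using D C finite_subset by blast
  have DF: "I \<in> sets M" if "I \<in> D" for I using that D C F_sets by blast
  have Us: "\<Union>C \<in> sets M" using C F_Union_sets by blast
  have sum_ind: "(\<Sum>I\<in>D. indicator I x :: real) = card {I\<in>D. x \<in> I}" for x
  proof -
    have "(\<Sum>I\<in>D. indicator I x :: real) = (\<Sum>I\<in>D. if x \<in> I then 1 else 0)"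
      by (intro sum.cong) (auto simp: indicator_def)
    also have "\<dots> = card {I\<in>D. x \<in> I}" using fD by (simp add: sum.If_cases Int_def)
    finally show ?thesis .
  qed
  have up: "(\<Sum>I\<in>D. indicator I x :: real) \<le> 2 * indicator (\<Union>C) x" for x
  proof (cases "x \<in> \<Union>C")
    case True
    then show ?thesis using ov[of x] by (simp add: sum_ind)
  next
    case False
    then have "{I\<in>D. x \<in> I} = {}" using D by auto
    then show ?thesis by (simp add: sum_ind)
  qed
  have low: "indicator (\<Union>C) x \<le> (\<Sum>I\<in>D. indicator I x :: real)" for x
  proof (cases "x \<in> \<Union>C")
    case True
    then obtain J where "J \<in> D" "x \<in> J" using D by blast
    then have "{I\<in>D. x \<in> I} \<noteq> {}" by auto
    then have "1 \<le> card {I\<in>D. x \<in> I}" using fD by (simp add: Suc_leI card_gt_0_iff)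
    then show ?thesis using True by (simp add: sum_ind)
  qed (simp add: sum_nonneg)
  have ig: "integrable M (\<lambda>x. indicator A x * f x)"
    if "A \<in> sets M" "integrable M f" for A and f :: "'a \<Rightarrow> real"
    using integrable_imp_set_integrable[OF that(2,1)] by (simp add: set_integrable_def)
  have sumint: "(\<Sum>I\<in>D. LINT x:I|M. f x) = (\<integral>x. (\<Sum>I\<in>D. indicator I x) * f x \<partial>M)"
    if "integrable M f" for f :: "'a \<Rightarrow> real"
    unfolding set_lebesgue_integral_def sum_distrib_right real_scaleR_def
    using ig DF that by (subst Bochner_Integration.integral_sum) auto
  have isum: "integrable M (\<lambda>x. (\<Sum>I\<in>D. indicator I x) * f x)"
    if "integrable M f" for f :: "'a \<Rightarrow> real"
    unfolding sum_distrib_right using ig DF that by (intro Bochner_Integration.integrable_sum) auto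
  have "(LINT x:\<Union>C|M. g x) \<le> (\<integral>x. (\<Sum>I\<in>D. indicator I x) * g x \<partial>M)"
    unfolding set_lebesgue_integral_def real_scaleR_def
    using low g0 by (intro integral_mono ig isum Us g mult_right_mono) auto
  also have "\<dots> = (\<Sum>I\<in>D. LINT x:I|M. g x)" using sumint[OF g] by simp
  also have "\<dots> \<le> (\<Sum>I\<in>D. LINT x:I|M. h x)" using D le by (intro sum_mono) auto
  also have "\<dots> = (\<integral>x. (\<Sum>I\<in>D. indicator I x) * h x \<partial>M)" using sumint[OF h] by simp
  also have "\<dots> \<le> (\<integral>x. (2 * indicator (\<Union>C) x) * h x \<partial>M)"
    using up h0 by (intro integral_mono isum h mult_right_mono) (auto simp: mult.assoc intro!: ig Us h)
  also have "\<dots> = 2 * (LINT x:\<Union>C|M. h x)"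
    by (simp add: set_lebesgue_integral_def mult.assoc)
  finally show ?thesis .
qed

lemma set_integral_Union_le:
  fixes g h :: "'a \<Rightarrow> real"
  assumes C: "C \<subseteq> F" and g: "integrable M g" and h: "integrable M h"
    and g0: "\<And>x. 0 \<le> g x" and h0: "\<And>x. 0 \<le> h x"
    and le: "\<And>I. I \<in> C \<Longrightarrow> (LINT x:I|M. g x) \<le> (LINT x:I|M. h x)"
  shows "(LINT x:\<Union>C|M. g x) \<le> 2 * (LINT x:\<Union>C|M. h x)"
proof (cases "C = {}")
  case False
  have cC: "countable C" using C F_countable countable_subset by blast
  define Cn where "Cn n = from_nat_into C ` {..n}" for n :: nat
  have CnC: "Cn n \<subseteq> C" for n unfolding Cn_def using False by (auto intro: from_nat_into)
  have UC: "(\<Union>n. \<Union>(Cn n)) = \<Union>C"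
  proof -
    have "(\<Union>n. Cn n) = range (from_nat_into C)" by (auto simp: Cn_def)
    then have "(\<Union>n. Cn n) = C" using range_from_nat_into[OF False cC] by simp
    then show ?thesis by blast
  qed
  have lim: "(\<lambda>n. LINT x:\<Union>(Cn n)|M. f x) \<longlonglongrightarrow> (LINT x:\<Union>C|M. f x)"
    if "integrable M f" for f :: "'a \<Rightarrow> real"
    unfolding UC[symmetric]
  proof (rule set_integral_cont_up)
    show "\<Union>(Cn n) \<in> sets M" for n using CnC C F_Union_sets by blast
    show "incseq (\<lambda>n. \<Union>(Cn n))"
      unfolding incseq_def Cn_def by (intro allI impI Union_mono image_mono) auto
    show "set_integrable M (\<Union>n. \<Union>(Cn n)) f"
      unfolding UC using that C F_Union_sets by (intro integrable_imp_set_integrable)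
  qed
  show ?thesis
  proof (rule LIMSEQ_le[OF lim[OF g] tendsto_mult_left[OF lim[OF h]]], intro exI allI impI)
    fix n
    show "(LINT x:\<Union>(Cn n)|M. g x) \<le> 2 * (LINT x:\<Union>(Cn n)|M. h x)"
      using CnC C by (intro set_integral_finite_Union_le g h g0 h0 le) (auto simp: Cn_def)
  qed
qed (simp add: set_lebesgue_integral_def)

end

context prob_space
begin

lemma integrable_bounded:
  fixes f :: "'a \<Rightarrow> real"
  assumes "f \<in> borel_measurable M" "\<And>x. 0 \<le> f x" "\<And>x. f x \<le> B"
  shows "integrable M f"
  using assms by (intro integrable_const_bound[where B = B]) auto

lemma set_integral_indicator:
  assumes "A \<in> sets M" "E \<in> sets M"
  shows "(LINT x:A|M. indicator E x :: real) = measure M (A \<inter> E)"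
proof -
  have "(LINT x:A|M. indicator E x :: real) = (LINT x|M. indicator (A \<inter> E) x)"
    unfolding set_lebesgue_integral_def by (intro Bochner_Integration.integral_cong) (auto simp: indicator_def)
  then show ?thesis using assms by simp
qed

lemma set_integral_const_real:
  assumes "A \<in> sets M"
  shows "(LINT x:A|M. (c::real)) = c * measure M A"
  using assms sets.sets_into_space[OF assms]
  by (simp add: set_lebesgue_integral_def mult.commute Int_absorb2)

lemma set_integral_mono_sets:
  fixes f :: "'a \<Rightarrow> real"
  assumes "integrable M f" "\<And>x. 0 \<le> f x" "A \<in> sets M" "B \<in> sets M" "A \<subseteq> B"
  shows "(LINT x:A|M. f x) \<le> (LINT x:B|M. f x)"
  unfolding set_lebesgue_integral_def using assms
  by (intro integral_mono integrable_mult_indicator) (auto simp: indicator_def)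

lemma set_integral_nonneg_real:
  fixes f :: "'a \<Rightarrow> real"
  assumes "\<And>x. 0 \<le> f x"
  shows "0 \<le> (LINT x:A|M. f x)"
  unfolding set_lebesgue_integral_def using assms by (intro Bochner_Integration.integral_nonneg) (auto simp: indicator_def)

end

section \<open>Differentiation, stopping intervals and the reverse Hoelder inequality\<close>

context interval_basis
begin

text \<open>The factor 2 lost against the Lebesgue differentiation theorem comes from the overlap and is harmless.\<close>

lemma AE_exists_interval_average_gt:
  fixes w :: "'a \<Rightarrow> real"
  assumes w: "integrable M w" "\<And>x. 0 \<le> w x" and Q: "Q \<in> F" and l: "0 \<le> l"
  shows "AE x in M. x \<in> Q \<longrightarrow> 2 * l < w x \<longrightarrow> (\<exists>I\<in>F. x \<in> I \<and> I \<subseteq> Q \<and> l * measure M I < (LINT y:I|M. w y))"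
proof -
  have wm[measurable]: "w \<in> borel_measurable M" using w by auto
  define U where "U = \<Union>{I\<in>F. I \<subseteq> Q \<and> l * measure M I < (LINT y:I|M. w y)}"
  have U[measurable]: "U \<in> sets M" unfolding U_def by (intro F_Union_sets) auto
  have Qs[measurable]: "Q \<in> sets M" using Q F_sets by blast
  \<comment> \<open>The exceptional points; they are to form a null set.\<close>
  define B where "B = {x\<in>space M. 2 * l < w x} \<inter> Q - U"
  have B[measurable]: "B \<in> sets M" unfolding B_def by measurable
  have iB: "integrable M (\<lambda>x. indicator B x * (w x - 2 * l))"
    using w integrable_imp_set_integrable[of "\<lambda>x. w x - 2 * l" B]
    by (simp add: set_integrable_def)
  have le: "(LINT x:B|M. w x - 2 * l) \<le> 2 * l * e" if e: "0 < e" for e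
  proof -
    obtain C where C: "C \<subseteq> F" "B \<subseteq> \<Union>C" "\<And>I. I \<in> C \<Longrightarrow> I \<subseteq> Q" "measure M (\<Union>C) \<le> measure M B + e"
      using F_outer[OF B Q _ e] unfolding B_def by blast
    \<comment> \<open>An interval that meets \<open>B\<close> is not contained in \<open>U\<close>,
      so its average is at most \<open>l\<close>. The other intervals of the cover are
      discarded.\<close>
    define C' where "C' = {I\<in>C. I \<inter> B \<noteq> {}}"
    have C': "C' \<subseteq> F" "B \<subseteq> \<Union>C'" "\<Union>C' \<subseteq> \<Union>C" using C(1,2) unfolding C'_def by blast+
    have m: "\<Union>C \<in> sets M" "\<Union>C' \<in> sets M" using C C' F_Union_sets by auto
    have 1: "(LINT x:I|M. w x) \<le> (LINT x:I|M. l)" if "I \<in> C'" for I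
    proof -
      have I: "I \<in> F" "I \<subseteq> Q" "I \<inter> B \<noteq> {}" using that C C'_def by auto
      then have "\<not> I \<subseteq> U" unfolding B_def by auto
      then have "\<not> l * measure M I < (LINT y:I|M. w y)" unfolding U_def using I by auto
      then show ?thesis using I F_sets by (simp add: set_integral_const_real)
    qed
    have "(LINT x:B|M. w x) \<le> (LINT x:\<Union>C'|M. w x)"
      using w C' m by (intro set_integral_mono_sets) auto
    also have "\<dots> \<le> 2 * (LINT x:\<Union>C'|M. l)"
      using w l 1 C' by (intro set_integral_Union_le) auto
    also have "\<dots> = 2 * l * measure M (\<Union>C')" using m by (simp add: set_integral_const_real)
    also have "\<dots> \<le> 2 * l * measure M (\<Union>C)"
      using l C' m by (intro mult_left_mono finite_measure_mono) auto
    also have "\<dots> \<le> 2 * l * (measure M B + e)" using l C by (intro mult_left_mono) auto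
    finally have "(LINT x:B|M. w x) - 2 * l * measure M B \<le> 2 * l * e" by (simp add: algebra_simps)
    moreover have "(LINT x:B|M. w x - 2 * l) = (LINT x:B|M. w x) - (LINT x:B|M. 2 * l)"
      using w by (intro set_integral_diff integrable_imp_set_integrable) auto
    ultimately show ?thesis by (simp add: set_integral_const_real mult_ac)
  qed
  \<comment> \<open>The integrand is positive on \<open>B\<close>, so this inequality forces
    \<open>B\<close> to be null.\<close>
  have "(LINT x:B|M. w x - 2 * l) \<le> 0"
  proof (cases "l = 0")
    case True then show ?thesis using le[of 1] by simp
  next
    case False
    show ?thesis
    proof (rule field_le_epsilon)
      fix e :: real assume "0 < e"
      then show "(LINT x:B|M. w x - 2 * l) \<le> 0 + e" using le[of "e / (2 * l)"] False l by simp
    qed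
  qed
  moreover have nn: "0 \<le> indicator B x * (w x - 2 * l)" for x
    by (auto simp: B_def indicator_def)
  ultimately have "(LINT x|M. indicator B x * (w x - 2 * l)) = 0"
    using Bochner_Integration.integral_nonneg[of M "\<lambda>x. indicator B x * (w x - 2 * l)"]
    unfolding set_lebesgue_integral_def by (simp add: order_antisym)
  then have "AE x in M. indicator B x * (w x - 2 * l) = 0"
    using integral_nonneg_eq_0_iff_AE[OF iB] nn by auto
  moreover have "AE x in M. x \<in> space M" by simp
  ultimately show ?thesis
  proof eventually_elim
    case (elim x)
    then show ?case by (auto simp: B_def indicator_def U_def split: if_splits)
  qed
qed

text \<open>The Calderon-Zygmund intervals at height \<open>l\<close>, namely the maximal ones with
  average above \<open>l\<close>. Such an interval is not \<open>Q\<close>, so it lies properly in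
  an interval of at most twice its measure inside \<open>Q\<close>, whose average is at most
  \<open>l\<close> by maximality; this gives the upper bound \<open>2 * l\<close>. The intervals may
  overlap.\<close>

lemma stopping_intervals:
  fixes w :: "'a \<Rightarrow> real"
  assumes w: "integrable M w" "\<And>x. 0 \<le> w x" and Q: "Q \<in> F" and l: "0 \<le> l"
    and le: "(LINT y:Q|M. w y) \<le> l * measure M Q"
  shows "\<exists>C\<subseteq>F. \<Union>C = \<Union>{I\<in>F. I \<subseteq> Q \<and> l * measure M I < (LINT y:I|M. w y)} \<and>
     (\<forall>I\<in>C. I \<subseteq> Q \<and> l * measure M I < (LINT y:I|M. w y) \<and> (LINT y:I|M. w y) \<le> 2 * l * measure M I)"
proof -
  define S where "S = {I\<in>F. I \<subseteq> Q \<and> l * measure M I < (LINT y:I|M. w y)}"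
  define C where "C = {I\<in>S. \<forall>J\<in>S. I \<subseteq> J \<longrightarrow> J = I}"
  have "\<exists>J\<in>C. I \<subseteq> J" if I: "I \<in> S" for I
  proof -
    have "finite {J\<in>S. I \<subseteq> J}"
      by (rule finite_subset[OF _ F_finite_above[of I]]) (use I in \<open>auto simp: S_def\<close>)
    from finite_has_maximal2[OF this, of I] I obtain J
      where "J \<in> S" "I \<subseteq> J" "\<And>K. K \<in> S \<Longrightarrow> I \<subseteq> K \<Longrightarrow> J \<subseteq> K \<Longrightarrow> J = K"
      by auto
    then have "J \<in> C" unfolding C_def by blast
    then show ?thesis using \<open>I \<subseteq> J\<close> by blast
  qed
  then have U: "\<Union>C = \<Union>S" unfolding C_def by blast
  have up: "(LINT y:I|M. w y) \<le> 2 * l * measure M I" if "I \<in> C" for I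
  proof -
    have I: "I \<in> F" "I \<subseteq> Q" "I \<in> S" using that by (auto simp: C_def S_def)
    have "I \<noteq> Q" using I le by (auto simp: S_def)
    then obtain J where J: "J \<in> F" "I \<subset> J" "J \<subseteq> Q" "measure M J \<le> 2 * measure M I"
      using F_extend[OF I(1) Q] I by auto
    have "J \<notin> S" using that J by (auto simp: C_def)
    then have "(LINT y:J|M. w y) \<le> l * measure M J" using J by (simp add: S_def)
    also have "\<dots> \<le> l * (2 * measure M I)" using J l by (intro mult_left_mono)
    finally have "(LINT y:J|M. w y) \<le> 2 * l * measure M I" by simp
    moreover have "(LINT y:I|M. w y) \<le> (LINT y:J|M. w y)"
      using w I J F_sets by (intro set_integral_mono_sets) auto
    ultimately show ?thesis by simp
  qed
  show ?thesis
    using U up by (intro exI[of _ C]) (auto simp: C_def S_def)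
qed

text \<open>On a stopping interval \<open>I\<close> the average lies between \<open>l\<close> and
  \<open>2 * l\<close>, and by \<open>half\<close> the function exceeds \<open>\<gamma> * l\<close>
  on at least half of \<open>I\<close>. So the integral over \<open>I\<close> is at most
  \<open>4 * l\<close> times the measure of that part. Up to a null set the points with
  \<open>w x > 2 * l\<close> lie in stopping intervals, and their overlap doubles the constant to
  8.\<close>

lemma level_set_integral_le:
  fixes w :: "'a \<Rightarrow> real"
  assumes w: "integrable M w" "\<And>x. 0 \<le> w x" and Q: "Q \<in> F" and l: "0 \<le> l"
    and le: "(LINT y:Q|M. w y) \<le> l * measure M Q" and g: "0 < \<gamma>"
    and half: "\<And>I. I \<in> F \<Longrightarrow> I \<subseteq> Q \<Longrightarrow>
      measure M I \<le> 2 * measure M (I \<inter> {x\<in>space M. \<gamma> * (LINT y:I|M. w y) < w x * measure M I})"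
  shows "(LINT x:(Q \<inter> {x\<in>space M. 2 * l < w x})|M. w x) \<le> 8 * l * measure M (Q \<inter> {x\<in>space M. \<gamma> * l < w x})"
proof -
  have wm[measurable]: "w \<in> borel_measurable M" using w by auto
  have Qs[measurable]: "Q \<in> sets M" using Q F_sets by blast
  define U where "U = \<Union>{I\<in>F. I \<subseteq> Q \<and> l * measure M I < (LINT y:I|M. w y)}"
  obtain C where C: "C \<subseteq> F" "\<Union>C = U"
     and I: "\<And>I. I \<in> C \<Longrightarrow> I \<subseteq> Q \<and> l * measure M I < (LINT y:I|M. w y) \<and> (LINT y:I|M. w y) \<le> 2 * l * measure M I"
    using stopping_intervals[OF w Q l le] U_def by blast
  have U[measurable]: "U \<in> sets M" unfolding U_def by (intro F_Union_sets) auto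
  define E where "E = {x\<in>space M. \<gamma> * l < w x}"
  have E[measurable]: "E \<in> sets M" unfolding E_def by measurable
  have CI: "(LINT x:I|M. w x) \<le> (LINT x:I|M. 4 * l * indicator E x)" if "I \<in> C" for I
  proof -
    have F: "I \<in> F" using that C by auto
    note IP = I[OF that]
    have "I \<inter> {x\<in>space M. \<gamma> * (LINT y:I|M. w y) < w x * measure M I} \<subseteq> I \<inter> E"
    proof -
      have "\<gamma> * l < w x" if "\<gamma> * (LINT y:I|M. w y) < w x * measure M I" for x
      proof -
        have "\<gamma> * l * measure M I \<le> \<gamma> * (LINT y:I|M. w y)" using IP g by simp
        then have "\<gamma> * l * measure M I < w x * measure M I" using that by simp
        then show ?thesis using F_pos[OF F] by simp
      qed
      then show ?thesis by (auto simp: E_def)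
    qed
    then have "measure M (I \<inter> {x\<in>space M. \<gamma> * (LINT y:I|M. w y) < w x * measure M I}) \<le> measure M (I \<inter> E)"
      using F_sets[OF F] by (intro finite_measure_mono) auto
    then have "measure M I \<le> 2 * measure M (I \<inter> E)"
      using half[OF F] IP by linarith
    then have "2 * l * measure M I \<le> 2 * l * (2 * measure M (I \<inter> E))" using l by (intro mult_left_mono) auto
    then show ?thesis using IP F_sets[OF F] by (simp add: set_integral_indicator)
  qed
  have "(LINT x:(Q \<inter> {x\<in>space M. 2 * l < w x})|M. w x) \<le> (LINT x:\<Union>C|M. w x)"
    unfolding set_lebesgue_integral_def C
  proof (rule integral_mono_AE)
    show "AE x in M. indicator (Q \<inter> {x\<in>space M. 2 * l < w x}) x *\<^sub>R w x \<le> indicator U x *\<^sub>R w x"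
      using AE_exists_interval_average_gt[OF w Q l]
    proof eventually_elim
      case (elim x)
      then show ?case using w(2)[of x] unfolding U_def by (auto simp: indicator_def)
    qed
  qed (intro integrable_mult_indicator w; measurable)+
  also have "\<dots> \<le> 2 * (LINT x:\<Union>C|M. 4 * l * indicator E x)"
  proof (rule set_integral_Union_le[OF C(1) w(1) _ w(2)])
    have "integrable M (indicator E :: 'a \<Rightarrow> real)"
      by (intro integrable_bounded[of _ 1]) (auto simp: indicator_def)
    then show "integrable M (\<lambda>x. 4 * l * indicator E x)" by simp
  qed (use l CI in auto)
  also have "\<dots> = 8 * l * measure M (U \<inter> E)"
    using C by (simp add: set_integral_indicator)
  also have "\<dots> \<le> 8 * l * measure M (Q \<inter> E)"
    using l by (intro mult_left_mono finite_measure_mono) (auto simp: U_def)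
  finally show ?thesis by (simp add: E_def)
qed

text \<open>The last sum below is absorbed into the left-hand side, which is finite because \<open>w\<close> is bounded.\<close>

lemma reverse_hoelder:
  fixes w :: "'a \<Rightarrow> real"
  assumes w[measurable]: "w \<in> borel_measurable M" and w0: "\<And>x. 0 < w x" and wB: "\<And>x. w x \<le> B"
    and Q: "Q \<in> F" and g: "0 < \<gamma>" "\<gamma> \<le> 1" and d: "d = \<gamma>\<^sup>2 / 128"
    and half: "\<And>I. I \<in> F \<Longrightarrow> I \<subseteq> Q \<Longrightarrow>
      measure M I \<le> 2 * measure M (I \<inter> {x\<in>space M. \<gamma> * (LINT y:I|M. w y) < w x * measure M I})"
  shows "(LINT x:Q|M. w x powr (1 + d)) \<le> 4 * ((LINT x:Q|M. w x) / measure M Q) powr d * (LINT x:Q|M. w x)"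
proof -
  define W where "W = (LINT x:Q|M. w x)"
  define a where "a = W / measure M Q"
  have Qs[measurable]: "Q \<in> sets M" using Q F_sets by blast
  have mQ: "0 < measure M Q" using F_pos Q by simp
  have B0: "0 < B" using w0 wB by (meson less_le_trans)
  have iw: "integrable M w" using w0 wB w by (intro integrable_bounded[of w B]) (auto intro: less_imp_le)
  have W0: "0 < W"
  proof -
    have "0 \<le> W" unfolding W_def using w0 by (intro set_integral_nonneg_real) (auto intro: less_imp_le)
    moreover have "W \<noteq> 0"
    proof
      assume "W = 0"
      have "integrable M (\<lambda>x. indicator Q x * w x)"
        using integrable_imp_set_integrable[OF iw Qs] by (simp add: set_integrable_def)
      then have "AE x in M. indicator Q x * w x = 0"
        using \<open>W = 0\<close> w0 integral_nonneg_eq_0_iff_AE[of M "\<lambda>x. indicator Q x * w x"]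
        by (auto simp: W_def set_lebesgue_integral_def less_imp_le)
      then have "AE x in M. x \<notin> Q"
        by eventually_elim (metis indicator_simps(1) less_irrefl mult_1 w0)
      then have "measure M Q = 0" by (subst measure_eq_0_null_sets) (auto simp: AE_iff_null_sets[OF Qs])
      then show False using mQ by simp
    qed
    ultimately show ?thesis by simp
  qed
  have a0: "0 < a" using W0 mQ by (simp add: a_def)
  have g2: "0 < \<gamma>\<^sup>2" "\<gamma>\<^sup>2 \<le> 1" using g by (auto simp: power_le_one)
  have d0: "0 < d" "d \<le> 1" using g2 unfolding d by auto
  define k where "k = 2 powr d - 1"
  \<comment> \<open>The choice of \<open>d\<close> is made for this bound. The sum to be absorbed
    comes out as \<open>32 * k / \<gamma>\<^sup>2\<close> times the left-hand side, where 32
    collects the 8 of \<open>level_set_integral_le\<close>, the bound 2 for \<open>2 powr d\<close>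
    and the bound 2 for a geometric sum; hence the factor is at most 1/2.\<close>
  have k: "0 \<le> k" "k \<le> \<gamma>\<^sup>2 / 64"
    using two_powr_le[of d] d0 unfolding k_def d by (auto simp: ge_one_powr_ge_zero)
  \<comment> \<open>As \<open>w\<close> is bounded, finitely many dyadic heights suffice.\<close>
  obtain n where n: "B / (2 * a) < 2 ^ n" using real_arch_pow[of 2 "B / (2*a)"] by auto
  have wn: "w x \<le> 2 * a * 2 ^ n" for x
    using n wB[of x] a0 by (simp add: field_simps)
  define l where "l j = a * 2 ^ j" for j :: nat
  have l0: "0 < l j" "a \<le> l j" for j using a0 by (auto simp: l_def)
  define S where "S j = {x\<in>space M. 2 * l j < w x}" for j
  define T where "T j = {x\<in>space M. \<gamma> * l j < w x}" for j
  have S[measurable]: "S j \<in> sets M" and T[measurable]: "T j \<in> sets M" for j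
    unfolding S_def T_def by measurable
  define c where "c j = k * (2 * l j) powr d" for j
  have c0: "0 \<le> c j" for j using k by (simp add: c_def)
  have iQ: "set_integrable M Q f" if "f \<in> borel_measurable M" "\<And>x. 0 \<le> f x" "\<And>x. f x \<le> C" for f :: "'a \<Rightarrow> real" and C
    using that by (intro integrable_imp_set_integrable integrable_bounded[of f C]) auto
  have iwd: "set_integrable M Q (\<lambda>x. w x powr (1 + d))"
    using d0 w0 wB by (intro iQ[of _ "B powr (1+d)"]) (auto intro!: powr_mono2 intro: less_imp_le)
  \<comment> \<open>The telescoping bound for \<open>w powr d\<close>, started at height
    \<open>2 * a\<close> and multiplied by \<open>w\<close>.\<close>
  have pw: "w x powr (1 + d) \<le> (2 * a) powr d * w x + (\<Sum>j<n. c j * (indicator (S j) x * w x))" if "x \<in> space M" for x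
  proof -
    have "w x powr d \<le> (2 * a) powr d + (\<Sum>j<n. if 2 * a * 2^j < w x then (2 powr d - 1) * (2 * a * 2^j) powr d else 0)"
      using a0 d0 w0[of x] wn by (intro powr_le_telescope) auto
    also have "\<dots> = (2 * a) powr d + (\<Sum>j<n. c j * indicator (S j) x)"
      using that by (intro arg_cong2[where f="(+)"] sum.cong) (auto simp: c_def S_def l_def k_def indicator_def mult.assoc)
    finally have "w x powr d * w x \<le> ((2 * a) powr d + (\<Sum>j<n. c j * indicator (S j) x)) * w x"
      using w0[of x] by (intro mult_right_mono) auto
    also have "\<dots> = (2 * a) powr d * w x + (\<Sum>j<n. c j * (indicator (S j) x * w x))"
      unfolding distrib_right sum_distrib_right by (simp only: mult.assoc)
    also have "w x powr d * w x = w x powr (1 + d)"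
      using w0[of x] by (simp add: powr_add)
    finally show ?thesis .
  qed
  have iSw: "set_integrable M Q (\<lambda>x. indicator (S j) x * w x)" for j
    using w0 wB B0 by (intro iQ[of _ B]) (auto simp: indicator_def intro: less_imp_le)
  have iSum: "set_integrable M Q (\<lambda>x. (\<Sum>j<n. c j * (indicator (S j) x * w x)))"
    using iSw[THEN set_integrable_mult_right] unfolding set_integrable_def scaleR_right.sum
    by (intro Bochner_Integration.integrable_sum) auto
  have iT: "set_integrable M Q (\<lambda>x. indicator (T j) x :: real)" for j
    by (intro iQ[of _ 1]) (auto simp: indicator_def)
  have "(LINT x:Q|M. w x powr (1 + d)) \<le> (LINT x:Q|M. (2 * a) powr d * w x + (\<Sum>j<n. c j * (indicator (S j) x * w x)))"
    using sets.sets_into_space[OF Qs]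
    by (intro set_integral_mono iwd pw set_integral_add(1) set_integrable_mult_right iSum
          integrable_imp_set_integrable[OF iw Qs]) auto
  also have "\<dots> = (2 * a) powr d * W + (\<Sum>j<n. c j * (LINT x:Q|M. indicator (S j) x * w x))"
  proof -
    have "(LINT x:Q|M. (\<Sum>j<n. c j * (indicator (S j) x * w x))) = (\<Sum>j<n. (LINT x:Q|M. c j * (indicator (S j) x * w x)))"
      unfolding set_lebesgue_integral_def scaleR_right.sum
      using iSw[THEN set_integrable_mult_right] unfolding set_integrable_def
      by (intro Bochner_Integration.integral_sum) auto
    then show ?thesis
      using iw iSum by (subst set_integral_add) (auto simp: W_def intro!: integrable_imp_set_integrable)
  qed
  also have "\<dots> \<le> (2 * a) powr d * W + (\<Sum>j<n. c j * (8 * l j * measure M (Q \<inter> T j)))"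
  proof -
    have "(LINT x:Q|M. indicator (S j) x * w x) \<le> 8 * l j * measure M (Q \<inter> T j)" for j
    proof -
      have "(LINT x:Q|M. indicator (S j) x * w x) = (LINT x:(Q \<inter> S j)|M. w x)"
        unfolding set_lebesgue_integral_def by (intro Bochner_Integration.integral_cong) (auto simp: indicator_def)
      also have "\<dots> \<le> 8 * l j * measure M (Q \<inter> T j)"
        unfolding S_def T_def
      proof (rule level_set_integral_le[OF iw _ Q])
        show "(LINT y:Q|M. w y) \<le> l j * measure M Q"
          using l0(2)[of j] mQ by (simp add: a_def W_def field_simps)
      qed (use w0 l0 g half in \<open>auto intro: less_imp_le\<close>)
      finally show ?thesis .
    qed
    then show ?thesis using c0 by (intro add_left_mono sum_mono mult_left_mono) auto
  qed
  also have "(\<Sum>j<n. c j * (8 * l j * measure M (Q \<inter> T j))) = (LINT x:Q|M. (\<Sum>j<n. c j * 8 * l j * indicator (T j) x))"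
  proof -
    have "(LINT x:Q|M. (\<Sum>j<n. c j * 8 * l j * indicator (T j) x)) = (\<Sum>j<n. (LINT x:Q|M. c j * 8 * l j * indicator (T j) x))"
      unfolding set_lebesgue_integral_def scaleR_right.sum
      using iT[THEN set_integrable_mult_right] unfolding set_integrable_def
      by (intro Bochner_Integration.integral_sum) auto
    then show ?thesis by (simp add: set_integral_indicator mult.assoc)
  qed
  also have "\<dots> \<le> (LINT x:Q|M. w x powr (1 + d) / 2)"
  proof (rule set_integral_mono)
    show "set_integrable M Q (\<lambda>x. (\<Sum>j<n. c j * 8 * l j * indicator (T j) x))"
      using iT[THEN set_integrable_mult_right] unfolding set_integrable_def scaleR_right.sum
      by (intro Bochner_Integration.integrable_sum) auto
    show "set_integrable M Q (\<lambda>x. w x powr (1 + d) / 2)" using iwd by simp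
    fix x assume "x \<in> Q"
    then have xs: "x \<in> space M" using sets.sets_into_space[OF Qs] by auto
    \<comment> \<open>In terms of \<open>y\<close>, membership in \<open>T j\<close> reads
      \<open>2^j < y\<close>, so the sum over \<open>j\<close> is geometric and comparable to
      \<open>y powr (1 + d)\<close>.\<close>
    define y where "y = w x / (\<gamma> * a)"
    have y0: "0 < y" using w0 g a0 by (simp add: y_def)
    have t: "c j * 8 * l j * indicator (T j) x \<le> 16 * k * a powr (1 + d) * (if 2^j < y then (2^j) powr (1+d) else 0)" for j
    proof -
      have "x \<in> T j \<longleftrightarrow> 2^j < y"
        using xs g a0 by (auto simp: T_def y_def l_def field_simps)
      moreover have "c j * 8 * l j \<le> 16 * k * a powr (1 + d) * (2^j) powr (1+d)"
      proof -
        have "c j * 8 * l j = 8 * k * 2 powr d * (l j powr d * l j)" by (simp add: c_def powr_mult)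
        also have "l j powr d * l j = l j powr (1 + d)" using l0(1)[of j] by (simp add: powr_add)
        also have "\<dots> = a powr (1 + d) * (2^j) powr (1+d)" using a0 by (simp add: l_def powr_mult)
        also have "8 * k * 2 powr d * \<dots> \<le> 8 * k * 2 * \<dots>"
        proof -
          have "2 powr d \<le> 2 powr 1" using d0 by (intro powr_mono) auto
          then show ?thesis using k by (intro mult_right_mono mult_left_mono) auto
        qed
        finally show ?thesis by (simp add: mult.assoc)
      qed
      ultimately show ?thesis by (auto simp: indicator_def)
    qed
    have "(\<Sum>j<n. c j * 8 * l j * indicator (T j) x)
       \<le> 16 * k * a powr (1 + d) * (\<Sum>j<n. if 2^j < y then (2^j) powr (1+d) else 0)"
      unfolding sum_distrib_left by (intro sum_mono t)
    also have "\<dots> \<le> 16 * k * a powr (1 + d) * (2 * y powr (1 + d))"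
    proof -
      have "(\<Sum>j<n. if 2^j < y then (2^j) powr (1+d) else 0) \<le> (2 powr (1+d) / (2 powr (1+d) - 1)) * y powr (1+d)"
        using d0 y0 by (intro sum_pow2_below_le) auto
      also have "\<dots> \<le> 2 * y powr (1+d)"
      proof (rule mult_right_mono)
        have "2 powr 1 \<le> 2 powr (1+d)" using d0 by (intro powr_mono) auto
        then have "2 \<le> 2 powr (1+d)" by simp
        then show "2 powr (1+d) / (2 powr (1+d) - 1) \<le> 2" by (simp add: field_simps)
      qed simp
      finally show ?thesis using k by (intro mult_left_mono) auto
    qed
    also have "\<dots> = 32 * k * (w x powr (1 + d) / \<gamma> powr (1 + d))"
    proof -
      have "a powr (1+d) * y powr (1+d) = (a * y) powr (1+d)" using a0 y0 by (simp add: powr_mult)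
      also have "a * y = w x / \<gamma>" using a0 by (simp add: y_def)
      also have "\<dots> powr (1+d) = w x powr (1 + d) / \<gamma> powr (1 + d)"
        using w0[of x] g by (simp add: powr_divide)
      finally show ?thesis by simp
    qed
    also have "\<dots> \<le> 32 * k * (w x powr (1 + d) / \<gamma>\<^sup>2)"
    proof -
      have "\<gamma> powr 2 \<le> \<gamma> powr (1 + d)" using g d0 by (intro powr_mono') auto
      then have "\<gamma>\<^sup>2 \<le> \<gamma> powr (1 + d)" using g by simp
      then show ?thesis using k g by (intro mult_left_mono divide_left_mono) auto
    qed
    also have "\<dots> \<le> 32 * (\<gamma>\<^sup>2 / 64) * (w x powr (1 + d) / \<gamma>\<^sup>2)"
      using k by (intro mult_right_mono mult_left_mono) auto
    also have "\<dots> = w x powr (1 + d) / 2" using g by simp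
    finally show "(\<Sum>j<n. c j * 8 * l j * indicator (T j) x) \<le> w x powr (1 + d) / 2" .
  qed
  also have "\<dots> = (LINT x:Q|M. w x powr (1 + d)) / 2" by simp
  finally have "(LINT x:Q|M. w x powr (1 + d)) \<le> 2 * (2 * a) powr d * W" by simp
  also have "(2 * a) powr d \<le> 2 * a powr d"
  proof -
    have "2 powr d \<le> 2 powr 1" using d0 by (intro powr_mono) auto
    then show ?thesis using a0 by (simp add: powr_mult)
  qed
  finally show ?thesis using W0 by (simp add: a_def W_def)
qed

end

subsection \<open>The Muckenhoupt condition\<close>

context prob_space
begin

text \<open>The bounds are required at every point, which is arranged by changing the given
  exponents on a null set. They are shared by \<open>p\<close> and \<open>q\<close> to make the
  relation symmetric.\<close>

definition conjugate_within :: "real \<Rightarrow> real \<Rightarrow> ('a \<Rightarrow> real) \<Rightarrow> ('a \<Rightarrow> real) \<Rightarrow> bool" where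
  "conjugate_within c B p q \<longleftrightarrow> 1 < c \<and> p \<in> borel_measurable M \<and> q \<in> borel_measurable M \<and>
     (\<forall>x. p x \<in> {c..B} \<and> q x \<in> {c..B} \<and> 1 / p x + 1 / q x = 1)"

lemma conjugate_within_sym: "conjugate_within c B p q \<Longrightarrow> conjugate_within c B q p"
  by (auto simp: conjugate_within_def add.commute)

lemma conjugate_withinD:
  assumes "conjugate_within c B p q"
  shows "1 < c" "p \<in> borel_measurable M" "c \<le> p x" "p x \<le> B" "1 / p x + 1 / q x = 1" "1 < p x"
    and "p x * (q x - 1) = q x" "q x - 1 = 1 / (p x - 1)"
proof -
  show *: "1 < c" "p \<in> borel_measurable M" "c \<le> p x" "p x \<le> B" "1 / p x + 1 / q x = 1" "1 < p x"
    using assms by (auto simp: conjugate_within_def intro: less_le_trans)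
  have "1 < q x" using assms by (auto simp: conjugate_within_def intro: less_le_trans)
  then show "p x * (q x - 1) = q x" using * by (simp add: field_simps)
  then show "q x - 1 = 1 / (p x - 1)" using * by (simp add: field_simps)
qed

lemma integrable_powr_exponent:
  assumes "conjugate_within c B p q" "0 \<le> t"
  shows "integrable M (\<lambda>x. t powr p x)"
proof (rule integrable_bounded)
  show "(\<lambda>x. t powr p x) \<in> borel_measurable M"
    using conjugate_withinD(2)[OF assms(1)] by measurable
  show "t powr p x \<le> 1 + t powr B" for x
    using conjugate_withinD(4,6)[OF assms(1), of x] assms(2) by (intro powr_le_one_plus) auto
qed simp

end

context interval_basis
begin

text \<open>The number \<open>s\<close> plays the role of the reciprocal of the norm of the indicator of \<open>Q\<close>.\<close>

definition muckenhoupt :: "real \<Rightarrow> ('a \<Rightarrow> real) \<Rightarrow> ('a \<Rightarrow> real) \<Rightarrow> bool" where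
  "muckenhoupt K p q \<longleftrightarrow> (\<forall>Q\<in>F. \<exists>s>0. (LINT x:Q|M. s powr p x) \<le> K \<and>
     (LINT x:Q|M. (1 / (s * measure M Q)) powr q x) \<le> K)"

text \<open>The two integrals are exchanged by replacing \<open>s\<close> with
  \<open>1 / (s * measure M Q)\<close>, which is an involution.\<close>

lemma muckenhoupt_sym:
  assumes "muckenhoupt K p q"
  shows "muckenhoupt K q p"
  unfolding muckenhoupt_def
proof
  fix Q assume Q: "Q \<in> F"
  then obtain s where s: "s > 0" "(LINT x:Q|M. s powr p x) \<le> K"
    "(LINT x:Q|M. (1 / (s * measure M Q)) powr q x) \<le> K"
    using assms by (auto simp: muckenhoupt_def)
  have m: "0 < measure M Q" using F_pos Q by auto
  show "\<exists>s>0. (LINT x:Q|M. s powr q x) \<le> K \<and> (LINT x:Q|M. (1 / (s * measure M Q)) powr p x) \<le> K"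
    by (rule exI[of _ "1 / (s * measure M Q)"]) (use s m in auto)
qed

lemma muckenhoupt_mono: "muckenhoupt K p q \<Longrightarrow> K \<le> K' \<Longrightarrow> muckenhoupt K' p q"
  unfolding muckenhoupt_def by (meson order_trans)

text \<open>Because of this bound the dual parameter \<open>W / (t * measure M Q)\<close>, with
  \<open>W\<close> the integral on the right, is again at least 1, so that results for parameters
  \<open>t \<ge> 1\<close> also apply to the dual weight.\<close>

lemma measure_le_set_integral_powr:
  assumes cw: "conjugate_within c B p q" and Q: "Q \<in> F" and t: "1 \<le> t"
  shows "t * measure M Q \<le> (LINT x:Q|M. t powr p x)"
proof -
  have "(LINT x:Q|M. t) \<le> (LINT x:Q|M. t powr p x)"
  proof (intro set_integral_mono integrable_imp_set_integrable integrable_powr_exponent[OF cw])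
    show "t \<le> t powr p x" for x
      using powr_mono[of 1 "p x" t] conjugate_withinD(6)[OF cw, of x] t by simp
  qed (use Q F_sets t in auto)
  then show ?thesis using Q F_sets by (simp add: set_integral_const_real)
qed

text \<open>
  For \<open>t = s\<^sup>\<theta>\<close> with \<open>0 \<le> \<theta> \<le> 1\<close> this interpolates between \<open>t = 1\<close> and \<open>t = s\<close>; the crude bound
  \<open>y\<^sup>\<theta> \<le> 1 + y\<close> replaces Jensen.
\<close>

lemma muckenhoupt_scaled:
  assumes cw: "conjugate_within c B p q" and A: "muckenhoupt K p q" and K: "1 \<le> K" and D: "1 \<le> D"
  shows "\<exists>C\<ge>1. \<forall>Q\<in>F. \<forall>t\<ge>1. (LINT x:Q|M. t powr p x) \<le> D \<longrightarrow>
     (LINT x:Q|M. ((LINT y:Q|M. t powr p y) / (t * measure M Q)) powr q x) \<le> C * (LINT y:Q|M. t powr p y)"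
proof -
  define C where "C = 2 powr B * (1 + K powr B * K) + D powr B * K"
  note p = conjugate_withinD[OF cw] and q = conjugate_withinD[OF conjugate_within_sym[OF cw]]
  note wc = conjugate_within_sym[OF cw]
  have B1: "1 < B" using p(1,3,4) by (meson less_le_trans order_trans)
  have C2: "1 \<le> 2 powr B * (1 + K powr B * K)"
  proof -
    have "1 * 1 \<le> 2 powr B * (1 + K powr B * K)" using B1 K by (intro mult_mono) (auto simp: ge_one_powr_ge_zero)
    then show ?thesis by simp
  qed
  have C1: "1 \<le> C" unfolding C_def using C2 K by (simp add: add_increasing2)
  have "(LINT x:Q|M. (W / (t * measure M Q)) powr q x) \<le> C * W"
    if Q: "Q \<in> F" and t: "1 \<le> t" and W: "W = (LINT x:Q|M. t powr p x)" "W \<le> D" for Q t W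
  proof -
    define m where "m = measure M Q"
    have Qs[measurable]: "Q \<in> sets M" using Q F_sets by simp
    have m: "0 < m" "m \<le> 1" using F_pos Q by (auto simp: m_def)
    have W0: "0 < W"
      using measure_le_set_integral_powr[OF cw Q t] t m unfolding W m_def[symmetric]
      by (smt (verit) mult_pos_pos)
    obtain s where s: "0 < s" "(LINT x:Q|M. s powr p x) \<le> K"
       "(LINT x:Q|M. (1 / (s * m)) powr q x) \<le> K"
      using A Q unfolding muckenhoupt_def m_def by blast
    have ip: "set_integrable M Q (\<lambda>x. u powr p x)" and iq: "set_integrable M Q (\<lambda>x. u powr q x)"
      if "0 \<le> u" for u
      using that integrable_powr_exponent[OF cw] integrable_powr_exponent[OF wc]
      by (auto intro!: integrable_imp_set_integrable)
    have ic: "set_integrable M Q (\<lambda>x. u :: real)" for u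
      by (auto intro!: integrable_imp_set_integrable)
    show ?thesis
    proof (cases "t \<le> s")
      case True
      \<comment> \<open>If \<open>s = 1\<close>, then \<open>1 \<le> t \<le> s\<close> leaves only
        \<open>t = 1\<close>, for which the exponent 0 is as good as any.\<close>
      define \<theta> where "\<theta> = (if s = 1 then 0 else ln t / ln s)"
      have s1: "1 \<le> s" using True t by simp
      have th: "0 \<le> \<theta>" "\<theta> \<le> 1" using True t s1 by (auto simp: \<theta>_def divide_simps)
      have ts: "t = s powr \<theta>" using True t s1 by (auto simp: \<theta>_def powr_def)
      \<comment> \<open>\<open>b\<close> bounds the average of \<open>s powr p x\<close> over
        \<open>Q\<close>. After division by \<open>b\<close> that average is at most 1, and the
        crude bound for the power \<open>\<theta>\<close> costs only a factor 2.\<close>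
      define b where "b = K / m"
      have b: "0 < b" using K m by (simp add: b_def)
      define a where "a = W / m"
      have a0: "0 < a" using W0 m by (simp add: a_def)
      have "W \<le> (LINT x:Q|M. b powr \<theta> * (1 + (m / K) * s powr p x))"
        unfolding W
      proof (intro set_integral_mono ip set_integrable_mult_right set_integral_add ic)
        fix x
        have "t powr p x = (b * ((m / K) * s powr p x)) powr \<theta>"
          using m K by (simp add: ts b_def powr_powr mult.commute)
        also have "\<dots> = b powr \<theta> * ((m / K) * s powr p x) powr \<theta>"
          using b m K by (intro powr_mult)
        also have "\<dots> \<le> b powr \<theta> * (1 + ((m / K) * s powr p x) powr 1)"
          using m K th by (intro mult_left_mono powr_le_one_plus) auto
        also have "((m / K) * s powr p x) powr 1 = (m / K) * s powr p x"
          using m K by simp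
        finally show "t powr p x \<le> b powr \<theta> * (1 + (m / K) * s powr p x)" .
      qed (use s t in auto)
      also have "\<dots> = b powr \<theta> * (m + (m / K) * (LINT x:Q|M. s powr p x))"
        using s ic ip[THEN set_integrable_mult_right, of s]
        by (simp add: set_integral_add(2) set_integral_const_real m_def)
      also have "\<dots> \<le> b powr \<theta> * (m + (m / K) * K)"
        using s m K by (intro mult_left_mono add_left_mono) auto
      also have "\<dots> = 2 * b powr \<theta> * m" using K by simp
      finally have a_le: "a \<le> 2 * b powr \<theta>" using m by (simp add: a_def field_simps)
      have "(LINT x:Q|M. (W / (t * m)) powr q x)
          \<le> (LINT x:Q|M. a * (2 powr B * (1 + (K powr B * m) * (1 / (s * m)) powr q x)))"
      proof (intro set_integral_mono iq set_integrable_mult_right set_integral_add ic)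
        fix x
        have "W / (t * m) = a / t" using m by (simp add: a_def)
        then have "(W / (t * m)) powr q x = (a / t) powr q x" by simp
        also have "\<dots> = a powr (1 + (q x - 1)) / t powr q x" using a0 t by (subst powr_divide) auto
        \<comment> \<open>One factor \<open>a\<close> is split off before
          \<open>a \<le> 2 * b powr \<theta>\<close> is inserted; it keeps the final bound linear in
          \<open>W\<close>.\<close>
        also have "\<dots> = a * (a powr (q x - 1) / t powr q x)"
          unfolding powr_add using a0 by simp
        also have "\<dots> \<le> a * ((2 * b powr \<theta>) powr (q x - 1) / t powr q x)"
          using a0 a_le q(6)[of x] by (intro mult_left_mono divide_right_mono powr_mono2) auto
        also have "(2 * b powr \<theta>) powr (q x - 1) / t powr q x = 2 powr (q x - 1) * (b powr (q x - 1) / s powr q x) powr \<theta>"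
          using b s by (simp add: powr_mult powr_divide ts powr_powr mult.commute)
        also have "a * \<dots> \<le> a * (2 powr B * (1 + (b powr (q x - 1) / s powr q x) powr 1))"
          using a0 th q(4)[of x] b s
          by (intro mult_left_mono mult_mono powr_le_one_plus powr_mono) auto
        \<comment> \<open>Up to powers of \<open>K\<close> this is the integrand of the dual part of
          \<open>muckenhoupt\<close>. The powers of \<open>m\<close> combine to a single factor,
          which together with \<open>a\<close> yields \<open>a * m = W\<close>.\<close>
        also have "(b powr (q x - 1) / s powr q x) powr 1 = K powr (q x - 1) * (m * (1 / (s * m)) powr q x)"
        proof -
          have "m powr (q x - 1) = m powr q x / m" using m by (simp add: powr_diff)
          then show ?thesis using b s m K by (simp add: b_def powr_divide powr_mult field_simps)
        qed
        also have "a * (2 powr B * (1 + \<dots>)) \<le> a * (2 powr B * (1 + K powr B * (m * (1 / (s * m)) powr q x)))"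
          using a0 K q(4)[of x] m by (intro mult_left_mono add_left_mono mult_right_mono powr_mono) auto
        finally show "(W / (t * m)) powr q x \<le> a * (2 powr B * (1 + (K powr B * m) * (1 / (s * m)) powr q x))"
          by (simp add: mult.assoc)
      qed (use W0 t m s in auto)
      also have "\<dots> = a * (2 powr B * (m + (K powr B * m) * (LINT x:Q|M. (1 / (s * m)) powr q x)))"
        using s m ic iq[THEN set_integrable_mult_right, of "1 / (s * m)"]
        by (simp add: set_integral_add(2) set_integral_const_real m_def)
      also have "\<dots> \<le> a * (2 powr B * (m + (K powr B * m) * K))"
        using s a0 m by (intro mult_left_mono add_left_mono) auto
      also have "\<dots> = 2 powr B * (1 + K powr B * K) * W" using m by (simp add: a_def field_simps)
      also have "\<dots> \<le> C * W" using W0 K by (intro mult_right_mono) (auto simp: C_def)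
      finally show ?thesis by (simp add: m_def)
    next
      case False
      \<comment> \<open>For \<open>t > s\<close> the dual inequality at \<open>s\<close> is used
        without interpolation. The surplus factor \<open>W powr (q x - 1)\<close> is controlled by
        \<open>W \<le> D\<close>.\<close>
      have "(LINT x:Q|M. (W / (t * m)) powr q x) \<le> (LINT x:Q|M. (W * D powr B) * (1 / (s * m)) powr q x)"
      proof (intro set_integral_mono iq set_integrable_mult_right)
        fix x
        have "(W / (t * m)) powr q x \<le> (W * (1 / (s * m))) powr q x"
          using False W0 m s q(6)[of x] by (intro powr_mono2) (auto simp: field_simps)
        also have "\<dots> = W powr (1 + (q x - 1)) * (1 / (s * m)) powr q x"
          using W0 s m by (subst powr_mult) auto
        also have "W powr (1 + (q x - 1)) = W * W powr (q x - 1)"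
          unfolding powr_add using W0 by simp
        also have "\<dots> \<le> W * D powr B"
        proof (intro mult_left_mono)
          have "W powr (q x - 1) \<le> D powr (q x - 1)"
            using W0 W q(6)[of x] by (intro powr_mono2) auto
          also have "\<dots> \<le> D powr B" using D q(4)[of x] by (intro powr_mono) auto
          finally show "W powr (q x - 1) \<le> D powr B" .
        qed (use W0 in auto)
        finally show "(W / (t * m)) powr q x \<le> (W * D powr B) * (1 / (s * m)) powr q x"
          by (simp add: mult_right_mono)
      qed (use W0 t m s in auto)
      also have "\<dots> = (W * D powr B) * (LINT x:Q|M. (1 / (s * m)) powr q x)" by simp
      also have "\<dots> \<le> (W * D powr B) * K" using s W0 by (intro mult_left_mono) auto
      also have "\<dots> = (D powr B * K) * W" by simp
      also have "\<dots> \<le> C * W" using W0 C2 by (intro mult_right_mono) (auto simp: C_def)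
      finally show ?thesis by (simp add: m_def)
    qed
  qed
  then show ?thesis using C1 by blast
qed

text \<open>With \<open>a\<close> the average of \<open>w = t powr p x\<close> on a subinterval
  \<open>I\<close>, the dual integrand \<open>(a / t) powr q x\<close> equals
  \<open>a * (a / w) powr (q x - 1)\<close> and is therefore at least \<open>2 * C * a\<close>
  wherever \<open>w \<le> \<gamma> * a\<close>. By \<open>muckenhoupt_scaled\<close> its integral
  over \<open>I\<close> is at most \<open>C * a * measure M I\<close>, so such points fill at most
  half of \<open>I\<close>, and \<open>reverse_hoelder\<close> applies. The bound \<open>D\<close>
  passes from \<open>Q\<close> to \<open>I\<close>, hence one \<open>C\<close> serves all
  subintervals.\<close>

lemma muckenhoupt_reverse_hoelder:
  assumes cw: "conjugate_within c B p q" and A: "muckenhoupt K p q" and K: "1 \<le> K" and D: "1 \<le> D"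
  shows "\<exists>d>0. d \<le> 1 \<and> (\<forall>Q\<in>F. \<forall>t\<ge>1. (LINT x:Q|M. t powr p x) \<le> D \<longrightarrow>
     (LINT x:Q|M. (t powr p x) powr (1 + d)) \<le>
       4 * ((LINT x:Q|M. t powr p x) / measure M Q) powr d * (LINT x:Q|M. t powr p x))"
proof -
  note p = conjugate_withinD[OF cw] and q = conjugate_withinD[OF conjugate_within_sym[OF cw]]
  note wc = conjugate_within_sym[OF cw]
  obtain C where C1: "1 \<le> C" and C: "\<And>Q t. Q \<in> F \<Longrightarrow> 1 \<le> t \<Longrightarrow> (LINT x:Q|M. t powr p x) \<le> D \<Longrightarrow>
     (LINT x:Q|M. ((LINT y:Q|M. t powr p y) / (t * measure M Q)) powr q x) \<le> C * (LINT y:Q|M. t powr p y)"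
    using muckenhoupt_scaled[OF cw A K D] by blast
  \<comment> \<open>Chosen to give \<open>(1 / \<gamma>) powr (q x - 1) \<ge> 2 * C\<close> for all
    exponents, with equality at the lower bound \<open>c\<close>.\<close>
  define \<gamma> where "\<gamma> = (1 / (2 * C)) powr (1 / (c - 1))"
  have g: "0 < \<gamma>" "\<gamma> \<le> 1" using C1 p(1) by (auto simp: \<gamma>_def intro!: powr_le1)
  have gC: "(1 / \<gamma>) powr (c - 1) = 2 * C"
    using C1 p(1) by (simp add: \<gamma>_def powr_divide powr_powr)
  define d where "d = \<gamma>\<^sup>2 / 128"
  have d: "0 < d" "d \<le> 1" using g by (auto simp: d_def power_le_one intro: order_trans[of _ 1])
  have "(LINT x:Q|M. (t powr p x) powr (1 + d)) \<le>
       4 * ((LINT x:Q|M. t powr p x) / measure M Q) powr d * (LINT x:Q|M. t powr p x)"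
    if Q: "Q \<in> F" and t: "1 \<le> t" and D: "(LINT x:Q|M. t powr p x) \<le> D" for Q t
  proof (rule reverse_hoelder[OF _ _ _ Q g d_def])
    have ip: "integrable M (\<lambda>x. t powr p x)" using t by (intro integrable_powr_exponent[OF cw]) auto
    then show "(\<lambda>x. t powr p x) \<in> borel_measurable M" by simp
    show "0 < t powr p x" for x using t by simp
    show "t powr p x \<le> t powr B" for x using t p by (intro powr_mono) auto
    fix I assume I: "I \<in> F" "I \<subseteq> Q"
    have Is[measurable]: "I \<in> sets M" using I F_sets by simp
    define m where "m = measure M I"
    define W where "W = (LINT x:I|M. t powr p x)"
    have m: "0 < m" using F_pos I by (simp add: m_def)
    have W0: "0 < W"
      using measure_le_set_integral_powr[OF cw I(1) t] t m unfolding W_def m_def[symmetric]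
      by (smt (verit) mult_pos_pos)
    define a where "a = W / m"
    have a0: "0 < a" using W0 m by (simp add: a_def)
    have WD: "W \<le> D" unfolding W_def
      using D I Q F_sets ip t by (intro order_trans[OF set_integral_mono_sets D]) auto
    define G where "G = {x\<in>space M. \<gamma> * W < t powr p x * m}"
    have pm[measurable]: "p \<in> borel_measurable M" "q \<in> borel_measurable M" using p(2) q(2) by auto
    have G[measurable]: "G \<in> sets M" unfolding G_def by measurable
    have "(LINT x:I|M. a * (2 * C) * indicator (space M - G) x) \<le> (LINT x:I|M. (W / (t * m)) powr q x)"
    proof (rule set_integral_mono)
      show "set_integrable M I (\<lambda>x. a * (2 * C) * indicator (space M - G) x)"
        using a0 C1 by (intro integrable_imp_set_integrable integrable_bounded[of _ "a * (2 * C)"]) (auto simp: indicator_def)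
      show "set_integrable M I (\<lambda>x. (W / (t * m)) powr q x)"
        using W0 t m by (intro integrable_imp_set_integrable integrable_powr_exponent[OF wc]) auto
      fix x assume x: "x \<in> I"
      show "a * (2 * C) * indicator (space M - G) x \<le> (W / (t * m)) powr q x"
      proof (cases "x \<in> space M - G")
        case True
        then have "t powr p x \<le> \<gamma> * a" using m by (auto simp: G_def a_def field_simps not_less)
        then have ag: "1 / \<gamma> \<le> a / t powr p x" using g t by (simp add: field_simps)
        have "2 * C \<le> (1 / \<gamma>) powr (q x - 1)"
          unfolding gC[symmetric] using g q(3)[of x] by (intro powr_mono) auto
        also have "\<dots> \<le> (a / t powr p x) powr (q x - 1)"
          using ag g q(6)[of x] by (intro powr_mono2) auto
        finally have "a * (2 * C) \<le> a * (a / t powr p x) powr (q x - 1)" using a0 by (intro mult_left_mono) auto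
        also have "\<dots> = a powr (1 + (q x - 1)) / t powr (p x * (q x - 1))"
          unfolding powr_add using a0 t by (simp add: powr_divide powr_powr)
        also have "\<dots> = (a / t) powr q x" using a0 t by (simp add: p(7) powr_divide)
        also have "a / t = W / (t * m)" by (simp add: a_def)
        finally show ?thesis using True by simp
      qed simp
    qed
    also have "\<dots> \<le> C * W" unfolding W_def m_def
      using C[OF I(1) t] WD unfolding W_def by blast
    finally have "a * (2 * C) * measure M (I \<inter> (space M - G)) \<le> C * W"
      by (simp add: set_integral_indicator)
    then have "a * C * (2 * measure M (I \<inter> (space M - G))) \<le> a * C * m" using m by (simp add: a_def mult_ac)
    then have "2 * measure M (I \<inter> (space M - G)) \<le> m" using a0 C1 by simp
    moreover have "m = measure M (I \<inter> G) + measure M (I \<inter> (space M - G))"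
    proof -
      have "measure M ((I \<inter> G) \<union> (I \<inter> (space M - G))) = measure M (I \<inter> G) + measure M (I \<inter> (space M - G))"
        by (rule finite_measure_Union) auto
      moreover have "(I \<inter> G) \<union> (I \<inter> (space M - G)) = I" using sets.sets_into_space[OF Is] by auto
      ultimately show ?thesis by (simp add: m_def)
    qed
    ultimately show "measure M I \<le> 2 * measure M (I \<inter> {x\<in>space M. \<gamma> * (LINT y:I|M. t powr p y) < t powr p x * measure M I})"
      unfolding G_def W_def m_def by simp
  qed
  then show ?thesis using d by blast
qed

text \<open>
  With \<open>a\<close> the average of \<open>w = t\<^bsup>p(x)\<^esup>\<close>, the reverse Hoelder inequality is applied to the dual weight
  \<open>\<tau>\<^bsup>q(x)\<^esup>\<close>, \<open>\<tau> = a / t\<close>, which equals \<open>a (a / w)\<^bsup>1 / (p(x) - 1)\<^esup>\<close>.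
\<close>

lemma muckenhoupt_self_improvement:
  assumes cw: "conjugate_within c B p q" and A: "muckenhoupt K p q" and K: "1 \<le> K"
  shows "\<exists>e>0. \<exists>C\<ge>1. e < c - 1 \<and> (\<forall>Q\<in>F. \<forall>t\<ge>1. \<forall>f.
     (LINT x:Q|M. t powr p x) \<le> 1 \<longrightarrow> integrable M f \<longrightarrow> (\<forall>x. 0 \<le> f x) \<longrightarrow>
     integrable M (\<lambda>x. f x powr (p x - e)) \<longrightarrow> C * t * measure M Q < (LINT x:Q|M. f x) \<longrightarrow>
     (LINT x:Q|M. t powr (p x - e)) \<le> (LINT x:Q|M. f x powr (p x - e)))"
proof -
  note p = conjugate_withinD[OF cw] and q = conjugate_withinD[OF conjugate_within_sym[OF cw]]
  note wc = conjugate_within_sym[OF cw]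
  obtain C where C1: "1 \<le> C" and C: "\<And>Q t. Q \<in> F \<Longrightarrow> 1 \<le> t \<Longrightarrow> (LINT x:Q|M. t powr p x) \<le> 1 \<Longrightarrow>
     (LINT x:Q|M. ((LINT y:Q|M. t powr p y) / (t * measure M Q)) powr q x) \<le> C * (LINT y:Q|M. t powr p y)"
    using muckenhoupt_scaled[OF cw A K order_refl] by blast
  \<comment> \<open>The bound is \<open>C\<close> here because the dual weight below has integral
    \<open>V \<le> C * W \<le> C\<close>.\<close>
  obtain d where d: "0 < d" "d \<le> 1" and RH: "\<And>Q t. Q \<in> F \<Longrightarrow> 1 \<le> t \<Longrightarrow> (LINT x:Q|M. t powr q x) \<le> C \<Longrightarrow>
     (LINT x:Q|M. (t powr q x) powr (1 + d)) \<le>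
       4 * ((LINT x:Q|M. t powr q x) / measure M Q) powr d * (LINT x:Q|M. t powr q x)"
    using muckenhoupt_reverse_hoelder[OF wc muckenhoupt_sym[OF A] K C1] by blast
  \<comment> \<open>The largest \<open>e\<close> with
    \<open>p x - 1 \<le> (1 + d) * (p x - e - 1)\<close> whenever \<open>p x \<ge> c\<close>:
    lowering the exponent by \<open>e\<close> raises the power of the dual weight by a factor of at
    most \<open>1 + d\<close>, which the reverse Hoelder inequality tolerates.\<close>
  define e where "e = (c - 1) * d / (1 + d)"
  have e0: "0 < e" using d p(1) by (simp add: e_def)
  have e1: "e * (1 + d) = (c - 1) * d" using d by (simp add: e_def)
  have e2: "e < c - 1" using d p(1) by (simp add: e_def field_simps)
  \<comment> \<open>The 2 collects a unit from the term with \<open>f\<close> and the unit in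
    \<open>powr_le_one_plus\<close>; the rest comes from the reverse Hoelder inequality.\<close>
  define C' where "C' = 2 + 4 * C powr (1 + d)"
  have C'1: "1 \<le> C'" using C1 by (simp add: C'_def add_increasing2)
  have "(LINT x:Q|M. t powr (p x - e)) \<le> (LINT x:Q|M. f x powr (p x - e))"
    if Q: "Q \<in> F" and t: "1 \<le> t" and W1: "(LINT x:Q|M. t powr p x) \<le> 1" and f: "integrable M f"
      and f0: "\<And>x. 0 \<le> f x" and fp: "integrable M (\<lambda>x. f x powr (p x - e))"
      and big: "C' * t * measure M Q < (LINT x:Q|M. f x)" for Q t and f :: "'a \<Rightarrow> real"
  proof (rule ccontr)
    \<comment> \<open>If the conclusion fails, the integral of \<open>f x powr (p x - e)\<close> is
      below that of \<open>t powr (p x - e)\<close>, which times \<open>t powr e\<close> is exactly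
      \<open>W\<close>. Young's inequality then bounds the average of \<open>f\<close> by
      \<open>C' * t\<close>.\<close>
    assume "\<not> ?thesis"
    then have less: "(LINT x:Q|M. f x powr (p x - e)) < (LINT x:Q|M. t powr (p x - e))" by simp
    have Qs[measurable]: "Q \<in> sets M" using Q F_sets by simp
    define m where "m = measure M Q"
    define W where "W = (LINT x:Q|M. t powr p x)"
    have m: "0 < m" using F_pos Q by (simp add: m_def)
    have Wt: "t * m \<le> W" using measure_le_set_integral_powr[OF cw Q t] by (simp add: m_def W_def)
    have W0: "0 < W" using Wt t m by (smt (verit) mult_pos_pos)
    define a where "a = W / m"
    have a0: "0 < a" using W0 m by (simp add: a_def)
    define \<tau> where "\<tau> = W / (t * m)"
    have tau1: "1 \<le> \<tau>" using Wt t m by (simp add: \<tau>_def)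
    have tau: "\<tau> = a / t" by (simp add: \<tau>_def a_def)
    define V where "V = (LINT x:Q|M. \<tau> powr q x)"
    have V: "V \<le> C * W" unfolding V_def \<tau>_def W_def m_def by (rule C[OF Q t W1])
    have V0: "0 \<le> V" unfolding V_def by (intro set_integral_nonneg_real) simp
    have "C * W \<le> C * 1" using C1 W1 by (intro mult_left_mono) (auto simp: W_def)
    then have "V \<le> C" using V by simp
    then have "(LINT x:Q|M. (\<tau> powr q x) powr (1 + d)) \<le> 4 * (V / m) powr d * V"
      using RH[OF Q tau1] by (simp add: V_def m_def)
    also have "\<dots> \<le> 4 * (C * a) powr d * (C * a * m)"
    proof -
      have "V \<le> C * a * m" using V m by (simp add: a_def)
      moreover from this have "(V / m) powr d \<le> (C * a) powr d"
        using V0 m d by (intro powr_mono2) (auto simp: field_simps)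
      ultimately show ?thesis using V0 by (intro mult_mono) auto
    qed
    also have "\<dots> = 4 * (C * a) powr (1 + d) * m" using C1 a0 by (simp add: powr_add)
    also have "\<dots> = 4 * C powr (1 + d) * a powr (1 + d) * m" using C1 a0 by (simp add: powr_mult)
    finally have RH': "(LINT x:Q|M. (\<tau> powr q x) powr (1 + d)) \<le> 4 * C powr (1 + d) * a powr (1 + d) * m" .
    have i1: "set_integrable M Q (\<lambda>x. f x powr (p x - e))" using fp by (intro integrable_imp_set_integrable) auto
    have i2: "set_integrable M Q (\<lambda>x. 1 :: real)" by (intro integrable_imp_set_integrable) auto
    have i3: "set_integrable M Q (\<lambda>x. (\<tau> powr q x) powr (1 + d))"
    proof (intro integrable_imp_set_integrable integrable_bounded)
      show "(\<lambda>x. (\<tau> powr q x) powr (1 + d)) \<in> borel_measurable M" using q(2) by measurable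
      show "(\<tau> powr q x) powr (1 + d) \<le> (\<tau> powr B) powr (1 + d)" for x
        using tau1 q(4)[of x] d by (intro powr_mono2 powr_mono) auto
    qed auto
    have "(LINT x:Q|M. f x / t) \<le> (LINT x:Q|M. (t powr e / a) * f x powr (p x - e) + (1 + (1 / a powr (1 + d)) * (\<tau> powr q x) powr (1 + d)))"
    proof (rule set_integral_mono)
      show "set_integrable M Q (\<lambda>x. f x / t)" using f by (intro integrable_imp_set_integrable) auto
      show "set_integrable M Q (\<lambda>x. (t powr e / a) * f x powr (p x - e) + (1 + (1 / a powr (1 + d)) * (\<tau> powr q x) powr (1 + d)))"
        by (intro set_integral_add(1) set_integrable_mult_right i1 i2 i3)
      fix x assume "x \<in> Q"
      define r where "r = p x - e"
      \<comment> \<open>The average of the weight divided by the weight. With this parameter the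
        second term of Young's inequality becomes a power of the dual weight.\<close>
      define y where "y = a / t powr p x"
      have y0: "0 < y" using a0 t by (simp add: y_def)
      have r1: "1 < r" using p(3)[of x] e2 by (simp add: r_def)
      have "f x / t \<le> (f x / t) powr r / y + y powr (1 / (r - 1))"
        using f0 t y0 r1 by (intro le_powr_div_plus_powr) auto
      also have "(f x / t) powr r / y = (t powr e / a) * f x powr (p x - e)"
      proof -
        have "t powr r * t powr e = t powr p x" by (simp add: r_def flip: powr_add)
        then have "t powr p x / t powr r = t powr e" using t by (simp add: field_simps)
        moreover have "(f x / t) powr r / y = f x powr r * (t powr p x / t powr r) / a"
          using f0[of x] t by (simp add: y_def powr_divide)
        ultimately show ?thesis by (simp add: r_def)
      qed
      also have "y powr (1 / (r - 1)) \<le> 1 + y powr ((1 + d) / (p x - 1))"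
      proof (rule powr_le_one_plus)
        have "e * (1 + d) \<le> (p x - 1) * d" unfolding e1 using p(3)[of x] d by (intro mult_right_mono) auto
        then have "p x - 1 \<le> (1 + d) * (r - 1)" by (simp add: r_def algebra_simps)
        then show "1 / (r - 1) \<le> (1 + d) / (p x - 1)" using r1 p(6)[of x] by (simp add: field_simps)
      qed (use y0 r1 in auto)
      also have "y powr ((1 + d) / (p x - 1)) = (y powr (q x - 1)) powr (1 + d)"
        by (simp add: powr_powr p(8))
      also have "y powr (q x - 1) = \<tau> powr q x / a"
      proof -
        have "y powr (q x - 1) = a powr (q x - 1) / t powr (p x * (q x - 1))"
          using a0 t by (simp add: y_def powr_divide powr_powr)
        also have "\<dots> = a powr q x / a / t powr q x" using a0 by (simp add: p(7) powr_diff)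
        also have "\<dots> = \<tau> powr q x / a" using a0 t by (simp add: tau powr_divide)
        finally show ?thesis .
      qed
      also have "(\<tau> powr q x / a) powr (1 + d) = (1 / a powr (1 + d)) * (\<tau> powr q x) powr (1 + d)"
        using a0 by (simp add: powr_divide)
      finally show "f x / t \<le> (t powr e / a) * f x powr (p x - e) + (1 + (1 / a powr (1 + d)) * (\<tau> powr q x) powr (1 + d))"
        by simp
    qed
    also have "\<dots> = (t powr e / a) * (LINT x:Q|M. f x powr (p x - e)) + (m + (1 / a powr (1 + d)) * (LINT x:Q|M. (\<tau> powr q x) powr (1 + d)))"
      using i1[THEN set_integrable_mult_right, of "t powr e / a"] i2 i3[THEN set_integrable_mult_right, of "1 / a powr (1 + d)"]
        set_integral_add(1)[OF i2 i3[THEN set_integrable_mult_right, of "1 / a powr (1 + d)"]]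
      by (simp add: set_integral_add(2) set_integral_const_real m_def)
    also have "\<dots> \<le> (t powr e / a) * (LINT x:Q|M. t powr (p x - e)) + (m + (1 / a powr (1 + d)) * (4 * C powr (1 + d) * a powr (1 + d) * m))"
      using less RH' a0 by (intro add_mono mult_left_mono) auto
    also have "(t powr e / a) * (LINT x:Q|M. t powr (p x - e)) = m"
    proof -
      have "t powr e * (LINT x:Q|M. t powr (p x - e)) = (LINT x:Q|M. t powr e * t powr (p x - e))" by simp
      also have "\<dots> = W" unfolding W_def by (simp flip: powr_add)
      finally have "t powr e * (LINT x:Q|M. t powr (p x - e)) = W" .
      then show ?thesis using W0 m by (metis a_def divide_divide_eq_right nonzero_mult_div_cancel_left less_irrefl times_divide_eq_left)
    qed
    also have "m + (m + (1 / a powr (1 + d)) * (4 * C powr (1 + d) * a powr (1 + d) * m)) = C' * m"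
      using a0 by (simp add: C'_def field_simps)
    finally have "(LINT x:Q|M. f x) / t \<le> C' * m" by simp
    then have "(LINT x:Q|M. f x) \<le> C' * t * m" using t by (simp add: field_simps)
    then show False using big by (simp add: m_def)
  qed
  then show ?thesis using e0 e2 C'1 by blast
qed

end

subsection \<open>The maximal operator of an interval basis\<close>

lemma ennreal_power_ennreal [simp]: "0 \<le> r \<Longrightarrow> ennreal_power (ennreal r) a = ennreal (r powr a)"
  by (simp add: ennreal_power_def)

lemma ennreal_power_mono:
  assumes "u \<le> v" "0 \<le> a"
  shows "ennreal_power u a \<le> ennreal_power v a"
proof (cases v)
  case (real s)
  then obtain r where "u = ennreal r" "0 \<le> r" using assms by (cases u) (auto simp: top_unique)
  then show ?thesis using assms real by (auto intro: powr_mono2 simp: ennreal_le_iff)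
qed (simp add: ennreal_power_def)

lemma ennreal_power_divide_le:
  assumes "1 \<le> C" "1 \<le> a"
  shows "ennreal_power (u / ennreal C) a \<le> ennreal_power u a / ennreal C"
proof (cases u)
  case (real r)
  have "(r / C) powr a = r powr a / C powr a" using real assms by (simp add: powr_divide)
  also have "\<dots> \<le> r powr a / C"
    using assms powr_mono[of 1 a C] by (intro divide_left_mono) auto
  finally show ?thesis using real assms by (simp add: divide_ennreal)
next
  case top
  then show ?thesis using assms by (simp add: ennreal_power_def ennreal_top_divide)
qed

lemma modular_mono:
  assumes "\<And>x. x \<in> space M \<Longrightarrow> u x \<le> v x" "\<And>x. x \<in> space M \<Longrightarrow> 0 \<le> p x"
  shows "modular M p u \<le> modular M p v"
  unfolding modular_def using assms by (intro nn_integral_mono ennreal_power_mono) auto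

lemma luxemburg_norm_le:
  "0 < l \<Longrightarrow> modular M p (\<lambda>x. u x / ennreal l) \<le> 1 \<Longrightarrow> luxemburg_norm M p u \<le> ennreal l"
  unfolding luxemburg_norm_def by (intro Inf_lower) auto

context interval_basis
begin

definition maximal_op :: "('a \<Rightarrow> real) \<Rightarrow> 'a \<Rightarrow> ennreal" where
  "maximal_op f x = (SUP I\<in>{I \<in> F. x \<in> I}. (\<integral>\<^sup>+y\<in>I. ennreal \<bar>f y\<bar> \<partial>M) / emeasure M I)"

definition maximal_op_bounded :: "('a \<Rightarrow> real) \<Rightarrow> bool" where
  "maximal_op_bounded p \<longleftrightarrow>
     (\<exists>C::real. 0 \<le> C \<and> (\<forall>f \<in> variable_Lebesgue M p.
        luxemburg_norm M p (maximal_op f) \<le> ennreal C * luxemburg_norm M p (\<lambda>x. ennreal \<bar>f x\<bar>)))"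

lemma nn_set_integral_set_integral:
  fixes f :: "'a \<Rightarrow> real"
  assumes "set_integrable M A f" "\<And>x. 0 \<le> f x"
  shows "(\<integral>\<^sup>+x\<in>A. ennreal (f x) \<partial>M) = ennreal (LINT x:A|M. f x)"
proof -
  have "(\<integral>\<^sup>+x\<in>A. ennreal (f x) \<partial>M) = (\<integral>\<^sup>+x. ennreal (indicator A x *\<^sub>R f x) \<partial>M)"
    by (intro nn_integral_cong) (simp add: indicator_def)
  then show ?thesis
    using assms unfolding set_integrable_def set_lebesgue_integral_def
    by (subst (asm) nn_integral_eq_integral) auto
qed

lemma maximal_op_measurable [measurable]: "maximal_op f \<in> borel_measurable M"
proof -
  define a where "a I = (\<integral>\<^sup>+y\<in>I. ennreal \<bar>f y\<bar> \<partial>M) / emeasure M I" for I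
  have "maximal_op f x = (SUP I\<in>F. a I * indicator I x)" for x
    unfolding maximal_op_def a_def[symmetric]
  proof (rule antisym)
    show "(SUP I\<in>{I\<in>F. x \<in> I}. a I) \<le> (SUP I\<in>F. a I * indicator I x)"
      by (rule SUP_least) (auto intro!: SUP_upper2)
    show "(SUP I\<in>F. a I * indicator I x) \<le> (SUP I\<in>{I\<in>F. x \<in> I}. a I)"
    proof (rule SUP_least)
      fix I assume "I \<in> F"
      then show "a I * indicator I x \<le> (SUP I\<in>{I\<in>F. x \<in> I}. a I)"
        by (cases "x \<in> I") (auto intro: SUP_upper)
    qed
  qed
  then have "maximal_op f = (\<lambda>x. SUP I\<in>F. a I * indicator I x)" by blast
  also have "\<dots> \<in> borel_measurable M"
    using F_countable F_sets by (intro borel_measurable_SUP) auto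
  finally show ?thesis .
qed

lemma maximal_op_ge:
  assumes "I \<in> F" "x \<in> I" "set_integrable M I f" "\<And>y. 0 \<le> f y"
  shows "ennreal ((LINT y:I|M. f y) / measure M I) \<le> maximal_op f x"
proof -
  have "(\<integral>\<^sup>+y\<in>I. ennreal \<bar>f y\<bar> \<partial>M) = ennreal (LINT y:I|M. f y)"
    using assms(3,4) by (simp add: nn_set_integral_set_integral)
  then have "ennreal ((LINT y:I|M. f y) / measure M I) = (\<integral>\<^sup>+y\<in>I. ennreal \<bar>f y\<bar> \<partial>M) / emeasure M I"
    using assms F_pos set_integral_nonneg_real[of f I] by (simp add: emeasure_eq_measure divide_ennreal)
  then show ?thesis unfolding maximal_op_def using assms by (auto intro!: SUP_upper2)
qed

lemma maximal_op_gtD: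
  assumes "ennreal c < maximal_op f x" "integrable M f" "0 \<le> c"
  shows "\<exists>I\<in>F. x \<in> I \<and> c * measure M I < (LINT y:I|M. \<bar>f y\<bar>)"
proof -
  obtain I where I: "I \<in> F" "x \<in> I" and less: "ennreal c < (\<integral>\<^sup>+y\<in>I. ennreal \<bar>f y\<bar> \<partial>M) / emeasure M I"
    using assms(1) unfolding maximal_op_def less_SUP_iff by auto
  have "set_integrable M I (\<lambda>y. \<bar>f y\<bar>)"
    using assms(2) F_sets I by (intro integrable_imp_set_integrable) auto
  then have "(\<integral>\<^sup>+y\<in>I. ennreal \<bar>f y\<bar> \<partial>M) = ennreal (LINT y:I|M. \<bar>f y\<bar>)"
    by (simp add: nn_set_integral_set_integral)
  then have "ennreal c < ennreal ((LINT y:I|M. \<bar>f y\<bar>) / measure M I)"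
    using less F_pos[OF I(1)] set_integral_nonneg_real[of "\<lambda>y. \<bar>f y\<bar>" I] by (simp add: emeasure_eq_measure divide_ennreal)
  then have "c < (LINT y:I|M. \<bar>f y\<bar>) / measure M I" using assms(3) by (simp add: ennreal_less_iff)
  then show ?thesis using I F_pos[OF I(1)] by (auto simp: field_simps)
qed

lemma maximal_op_divide:
  assumes "0 < l" and f: "f \<in> borel_measurable M"
  shows "maximal_op f x / ennreal l \<le> maximal_op (\<lambda>y. f y / l) x"
proof (rule divide_le_posI_ennreal)
  show "0 < ennreal l" using assms by simp
  show "maximal_op f x \<le> ennreal l * maximal_op (\<lambda>y. f y / l) x"
    unfolding maximal_op_def
  proof (rule SUP_least)
    fix I assume I: "I \<in> {I\<in>F. x \<in> I}"
    then have [measurable]: "I \<in> sets M" using F_sets by auto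
    note f[measurable]
    have "(\<integral>\<^sup>+y\<in>I. ennreal \<bar>f y\<bar> \<partial>M) = (\<integral>\<^sup>+y. ennreal l * (ennreal \<bar>f y / l\<bar> * indicator I y) \<partial>M)"
      using assms by (intro nn_integral_cong) (simp add: abs_divide mult.assoc[symmetric] ennreal_mult'[symmetric])
    also have "\<dots> = ennreal l * (\<integral>\<^sup>+y\<in>I. ennreal \<bar>f y / l\<bar> \<partial>M)" by (rule nn_integral_cmult) measurable
    finally have "(\<integral>\<^sup>+y\<in>I. ennreal \<bar>f y\<bar> \<partial>M) / emeasure M I = ennreal l * ((\<integral>\<^sup>+y\<in>I. ennreal \<bar>f y / l\<bar> \<partial>M) / emeasure M I)"
      by (simp add: ennreal_times_divide)
    also have "\<dots> \<le> ennreal l * (SUP I\<in>{I \<in> F. x \<in> I}. (\<integral>\<^sup>+y\<in>I. ennreal \<bar>f y / l\<bar> \<partial>M) / emeasure M I)"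
      using I by (intro mult_left_mono SUP_upper) auto
    finally show "(\<integral>\<^sup>+y\<in>I. ennreal \<bar>f y\<bar> \<partial>M) / emeasure M I \<le> \<dots>" .
  qed
qed

text \<open>The weak type estimate at exponent \<open>p x - e\<close>, with \<open>f\<close>
  truncated to its part above \<open>C * l\<close>. On an interval where the average of
  \<open>f\<close> exceeds \<open>2 * C * l\<close> that part still has average above
  \<open>C * l\<close>, so \<open>muckenhoupt_self_improvement\<close> applies to it at height
  \<open>l\<close>. The required \<open>\<integral> l powr p x \<le> 1\<close> follows from the
  modular of \<open>f\<close> being at most 1: by Young's inequality the average of \<open>f\<close>
  is at most \<open>(1 + K) * s\<close>, which forces \<open>K * l < s\<close>.\<close>

lemma muckenhoupt_level_set_le:
  assumes cw: "conjugate_within c B p q" and A: "muckenhoupt K p q" and K: "1 \<le> K"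
  shows "\<exists>e>0. \<exists>C\<ge>1. e < c - 1 \<and> (\<forall>l\<ge>1. \<forall>f\<in>borel_measurable M. (\<forall>x. 0 \<le> f x) \<longrightarrow>
     integrable M (\<lambda>x. f x powr p x) \<longrightarrow> (LINT x|M. f x powr p x) \<le> 1 \<longrightarrow>
     (LINT x:\<Union>{I\<in>F. 2 * C * l * measure M I < (LINT y:I|M. f y)}|M. l powr p x) \<le>
     2 * l powr e * (LINT x|M. (if C * l < f x then f x else 0) powr (p x - e)))"
proof -
  note p = conjugate_withinD[OF cw] and q = conjugate_withinD[OF conjugate_within_sym[OF cw]]
  note wc = conjugate_within_sym[OF cw]
  note [measurable] = p(2) q(2)
  obtain e C0 where e: "0 < e" "e < c - 1" and C0: "1 \<le> C0"
    and imp: "\<And>Q t f. Q \<in> F \<Longrightarrow> 1 \<le> t \<Longrightarrow>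
     (LINT x:Q|M. t powr p x) \<le> 1 \<Longrightarrow> integrable M f \<Longrightarrow> (\<forall>x. 0 \<le> f x) \<Longrightarrow>
     integrable M (\<lambda>x. f x powr (p x - e)) \<Longrightarrow> C0 * t * measure M Q < (LINT x:Q|M. f x) \<Longrightarrow>
     (LINT x:Q|M. t powr (p x - e)) \<le> (LINT x:Q|M. f x powr (p x - e))"
    using muckenhoupt_self_improvement[OF cw A K] by blast
  \<comment> \<open>\<open>C0\<close> is the threshold of the self-improvement, and
    \<open>(1 + K) * K\<close> is what makes the comparison with \<open>s\<close> yield
    \<open>K * l < s\<close>.\<close>
  define C where "C = max C0 ((1 + K) * K)"
  have C: "1 \<le> C" "C0 \<le> C" "(1 + K) * K \<le> C" using C0 by (auto simp: C_def)
  have "(LINT x:\<Union>{I\<in>F. 2 * C * l * measure M I < (LINT y:I|M. f y)}|M. l powr p x) \<le>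
     2 * l powr e * (LINT x|M. (if C * l < f x then f x else 0) powr (p x - e))"
    if l: "1 \<le> l" and f[measurable]: "f \<in> borel_measurable M" and f0: "\<And>x. 0 \<le> f x"
      and fp: "integrable M (\<lambda>x. f x powr p x)" and f1: "(LINT x|M. f x powr p x) \<le> 1" for l f
  proof -
    define S where "S = {I\<in>F. 2 * C * l * measure M I < (LINT y:I|M. f y)}"
    define g where "g x = (if C * l < f x then f x else 0)" for x
    have g[measurable]: "g \<in> borel_measurable M" unfolding g_def by measurable
    have g0: "0 \<le> g x" "g x \<le> f x" "f x \<le> g x + C * l" for x using f0 C l by (auto simp: g_def)
    have le: "f x powr r \<le> 1 + f x powr p x" if "0 \<le> r" "r \<le> p x" for x r
      using that f0 by (intro powr_le_one_plus) auto
    have ib: "integrable M h" if "h \<in> borel_measurable M" "\<And>x. 0 \<le> h x" "\<And>x. h x \<le> 1 + f x powr p x" for h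
      using that fp by (intro Bochner_Integration.integrable_bound[of M "\<lambda>x. 1 + f x powr p x" h]) auto
    have fi: "integrable M f" using le[of 1] f0 p(6) by (intro ib) (auto simp: less_imp_le)
    have gi: "integrable M g"
      using g0 by (intro Bochner_Integration.integrable_bound[OF fi g]) (auto simp: g_def C l f0)
    have pe: "0 \<le> p x - e" "p x - e \<le> p x" for x using p(3)[of x] e by auto
    have gpi: "integrable M (\<lambda>x. g x powr (p x - e))"
    proof (rule ib)
      show "g x powr (p x - e) \<le> 1 + f x powr p x" for x
        using le[OF pe] powr_mono2[of "p x - e" "g x" "f x"] g0 pe order_trans by blast
    qed auto
    have lpi: "integrable M (\<lambda>x. l powr (p x - e))"
    proof (rule integrable_bounded)
      show "l powr (p x - e) \<le> l powr B" for x
        using l e p(4)[of x] by (intro powr_mono) auto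
    qed auto
    have key: "(LINT x:I|M. l powr (p x - e)) \<le> (LINT x:I|M. g x powr (p x - e))" if "I \<in> S" for I
    proof -
      have I: "I \<in> F" and big: "2 * C * l * measure M I < (LINT y:I|M. f y)" using that by (auto simp: S_def)
      have Is[measurable]: "I \<in> sets M" using I F_sets by simp
      define m where "m = measure M I"
      have m: "0 < m" using F_pos I by (simp add: m_def)
      obtain s where s: "0 < s" "(LINT x:I|M. s powr p x) \<le> K"
        "(LINT x:I|M. (1 / (s * m)) powr q x) \<le> K"
        using A I unfolding muckenhoupt_def m_def by blast
      have "(LINT x:I|M. f x * (1 / (s * m))) \<le> (LINT x:I|M. f x powr p x + (1 / (s * m)) powr q x)"
      proof (intro set_integral_mono set_integral_add(1))
        show "f x * (1 / (s * m)) \<le> f x powr p x + (1 / (s * m)) powr q x" for x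
          using f0 s m p(6) q(6) p(5) by (intro mult_le_powr_add_powr) auto
      qed (use fi fp s m in \<open>auto intro!: integrable_imp_set_integrable integrable_powr_exponent[OF wc]\<close>)
      also have "\<dots> = (LINT x:I|M. f x powr p x) + (LINT x:I|M. (1 / (s * m)) powr q x)"
        using s m by (intro set_integral_add(2) integrable_imp_set_integrable fp integrable_powr_exponent[OF wc]) auto
      also have "\<dots> \<le> 1 + K"
      proof -
        have "(LINT x:I|M. f x powr p x) \<le> (LINT x:space M|M. f x powr p x)"
          using fp sets.sets_into_space[OF Is] by (intro set_integral_mono_sets) auto
        also have "\<dots> \<le> 1" using f1 fp by (simp add: set_integral_space)
        finally show ?thesis using s by simp
      qed
      finally have "(LINT x:I|M. f x) * (1 / (s * m)) \<le> 1 + K" by (simp add: set_integral_mult_left)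
      then have fI: "(LINT x:I|M. f x) \<le> (1 + K) * s * m" using s m by (simp add: field_simps)
      have "(1 + K) * K * l * m \<le> C * l * m" using C l m by (intro mult_right_mono) auto
      also have "\<dots> \<le> 2 * C * l * m" using C l m by simp
      also have "\<dots> < (1 + K) * s * m" using big fI by (simp add: m_def)
      finally have "((1 + K) * (K * l)) * m < ((1 + K) * s) * m" by (simp only: mult.assoc)
      then have "(1 + K) * (K * l) < (1 + K) * s" using m by (simp only: mult_less_cancel_right_pos)
      then have "K * l < s" using K by simp
      then have ls: "l \<le> s / K" using K by (simp add: field_simps)
      \<comment> \<open>Dividing \<open>s\<close> by \<open>K \<ge> 1\<close> divides
        \<open>s powr p x\<close> by at least \<open>K\<close>, since the exponent exceeds
        1.\<close>
      have "(LINT x:I|M. l powr p x) \<le> (LINT x:I|M. (1 / K) * s powr p x)"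
      proof (intro set_integral_mono set_integrable_mult_right)
        fix x
        have "l powr p x \<le> (s / K) powr p x" using ls l p(6)[of x] by (intro powr_mono2) auto
        also have "\<dots> = s powr p x / K powr p x" using s K by (simp add: powr_divide)
        also have "\<dots> \<le> s powr p x / K"
          using K powr_mono[of 1 "p x" K] p(6)[of x] by (intro divide_left_mono) auto
        finally show "l powr p x \<le> (1 / K) * s powr p x" by simp
      qed (use l s in \<open>auto intro!: integrable_imp_set_integrable integrable_powr_exponent[OF cw]\<close>)
      also have "\<dots> = (1 / K) * (LINT x:I|M. s powr p x)" by (rule set_integral_mult_right)
      also have "\<dots> \<le> (1 / K) * K" using s K by (intro mult_left_mono) auto
      also have "\<dots> = 1" using K by simp
      finally have small: "(LINT x:I|M. l powr p x) \<le> 1" .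
      have "(LINT x:I|M. f x) \<le> (LINT x:I|M. g x + C * l)"
        using fi gi g0 by (intro set_integral_mono integrable_imp_set_integrable) auto
      also have "\<dots> = (LINT x:I|M. g x) + C * l * m"
        using gi by (subst set_integral_add(2)) (auto intro!: integrable_imp_set_integrable simp: set_integral_const_real m_def)
      finally have "C * l * m < (LINT x:I|M. g x)" using big by (simp add: m_def)
      moreover have "C0 * l * m \<le> C * l * m" using C l m by (intro mult_right_mono) auto
      ultimately show ?thesis
        using imp[OF I l small gi _ gpi] g0 by (simp add: m_def)
    qed
    have Us[measurable]: "\<Union>S \<in> sets M" by (intro F_Union_sets) (auto simp: S_def)
    have "(LINT x:\<Union>S|M. l powr p x) = l powr e * (LINT x:\<Union>S|M. l powr (p x - e))"
      unfolding set_integral_mult_right[symmetric] powr_add[symmetric] by simp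
    also have "\<dots> \<le> l powr e * (2 * (LINT x:\<Union>S|M. g x powr (p x - e)))"
      by (intro mult_left_mono set_integral_Union_le lpi gpi key) (auto simp: S_def)
    also have "\<dots> \<le> l powr e * (2 * (LINT x:space M|M. g x powr (p x - e)))"
      using gpi sets.sets_into_space[OF Us] by (intro mult_left_mono set_integral_mono_sets) auto
    also have "\<dots> = 2 * l powr e * (LINT x|M. g x powr (p x - e))" using gpi by (simp add: set_integral_space)
    finally show ?thesis unfolding S_def g_def .
  qed
  then show ?thesis using e C(1) by blast
qed

text \<open>Up to a constant, the power of the maximal function is at most 1 plus the sum over
  \<open>k\<close> of \<open>(2^k) powr p x\<close> on the level sets \<open>U k\<close>. Summing
  the level estimates under the integral leaves, at each point, the sum of
  \<open>(2^k) powr e\<close> over the \<open>k\<close> with \<open>2^k < g x\<close>; it is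
  comparable to \<open>g x powr e\<close> and restores the exponent \<open>p x\<close>. Convergence
  of this geometric sum is where \<open>e > 0\<close> is used.\<close>

lemma muckenhoupt_imp_modular_le:
  assumes cw: "conjugate_within c B p q" and A: "muckenhoupt K p q" and K: "1 \<le> K"
  shows "\<exists>C\<ge>1. \<forall>f\<in>borel_measurable M. modular M p (\<lambda>x. ennreal \<bar>f x\<bar>) \<le> 1 \<longrightarrow>
    modular M p (maximal_op f) \<le> ennreal C"
proof -
  note p = conjugate_withinD[OF cw]
  note [measurable] = p(2)
  have B1: "1 < B" using p(4,6) by (meson less_le_trans)
  obtain e C where e: "0 < e" "e < c - 1" and C: "1 \<le> C"
    and lev: "\<And>l f. 1 \<le> l \<Longrightarrow> f \<in> borel_measurable M \<Longrightarrow> (\<forall>x. 0 \<le> f x) \<Longrightarrow>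
     integrable M (\<lambda>x. f x powr p x) \<Longrightarrow> (LINT x|M. f x powr p x) \<le> 1 \<Longrightarrow>
     (LINT x:\<Union>{I\<in>F. 2 * C * l * measure M I < (LINT y:I|M. f y)}|M. l powr p x) \<le>
     2 * l powr e * (LINT x|M. (if C * l < f x then f x else 0) powr (p x - e))"
    using muckenhoupt_level_set_le[OF cw A K] by blast
  define b where "b = 2 powr e / (2 powr e - 1)"
  have b0: "0 \<le> b" using e by (simp add: b_def ge_one_powr_ge_zero)
  define D where "D = (4 * C) powr B * (1 + 2 * b)"
  have D1: "1 \<le> D"
  proof -
    have "1 * 1 \<le> D" unfolding D_def using C B1 b0 by (intro mult_mono) (auto intro!: ge_one_powr_ge_zero)
    then show ?thesis by simp
  qed
  have "modular M p (maximal_op f) \<le> ennreal D"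
    if f[measurable]: "f \<in> borel_measurable M" and f1: "modular M p (\<lambda>x. ennreal \<bar>f x\<bar>) \<le> 1" for f
  proof -
    define g where "g x = \<bar>f x\<bar>" for x
    have gm[measurable]: "g \<in> borel_measurable M" unfolding g_def by measurable
    have g0: "0 \<le> g x" for x by (simp add: g_def)
    have nn: "(\<integral>\<^sup>+x. ennreal (g x powr p x) \<partial>M) \<le> 1" using f1 by (simp add: modular_def g_def)
    have gp: "integrable M (\<lambda>x. g x powr p x)"
      using nn by (intro integrableI_nonneg) (auto simp: less_top[symmetric] top_unique)
    have gp1: "(LINT x|M. g x powr p x) \<le> 1"
      using nn nn_integral_eq_integral[OF gp] by simp
    have gi: "integrable M g"
    proof (rule Bochner_Integration.integrable_bound[of M "\<lambda>x. 1 + g x powr p x"])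
      show "AE x in M. norm (g x) \<le> norm (1 + g x powr p x)"
        using powr_le_one_plus[OF g0, of 1] p(6) g0 by (auto simp: less_imp_le)
    qed (use gp in auto)
    then have fi: "integrable M f" using f by (subst integrable_abs_iff[symmetric]) (auto simp: g_def[symmetric])
    define l where "l k = (2::real) ^ k" for k :: nat
    have l1: "1 \<le> l k" for k by (simp add: l_def)
    define U where "U k = \<Union>{I\<in>F. 2 * C * l k * measure M I < (LINT y:I|M. g y)}" for k
    have Us[measurable]: "U k \<in> sets M" for k unfolding U_def by (intro F_Union_sets) auto
    define h where "h k x = (if C * l k < g x then g x else 0)" for k x
    have hm[measurable]: "h k \<in> borel_measurable M" for k unfolding h_def by measurable
    have pe: "0 < p x - e" for x using p(3)[of x] e by auto
    have hi: "integrable M (\<lambda>x. h k x powr (p x - e))" for k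
    proof (rule Bochner_Integration.integrable_bound[of M "\<lambda>x. 1 + g x powr p x"])
      have "h k x powr (p x - e) \<le> 1 + g x powr p x" for x
      proof -
        have "h k x powr (p x - e) \<le> g x powr (p x - e)"
          using pe[of x] g0 by (intro powr_mono2) (auto simp: h_def)
        also have "\<dots> \<le> 1 + g x powr p x" using pe[of x] e g0 by (intro powr_le_one_plus) auto
        finally show ?thesis .
      qed
      then show "AE x in M. norm (h k x powr (p x - e)) \<le> norm (1 + g x powr p x)" by auto
    qed (use gp in auto)
    have sum_le: "(\<Sum>k<n. (LINT x:U k|M. l k powr p x)) \<le> 2 * b" for n
    proof -
      have "(\<Sum>k<n. (LINT x:U k|M. l k powr p x)) \<le> (\<Sum>k<n. 2 * l k powr e * (LINT x|M. h k x powr (p x - e)))"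
        unfolding U_def h_def using l1 g0 gp gp1 by (intro sum_mono lev) auto
      also have "\<dots> = (LINT x|M. (\<Sum>k<n. 2 * l k powr e * h k x powr (p x - e)))"
        using hi by (subst Bochner_Integration.integral_sum) auto
      also have "\<dots> \<le> (LINT x|M. 2 * b * g x powr p x)"
      proof (rule integral_mono)
        fix x
        show "(\<Sum>k<n. 2 * l k powr e * h k x powr (p x - e)) \<le> 2 * b * g x powr p x"
        proof (cases "g x = 0")
          case True
          then have "h k x = 0" for k using C l1 by (auto simp: h_def)
          then show ?thesis using True by simp
        next
          case False
          then have gx: "0 < g x" using g0[of x] by simp
          have "2 * l k powr e * h k x powr (p x - e) \<le> 2 * g x powr (p x - e) * (if 2^k < g x then (2^k) powr e else 0)" for k
          proof (cases "C * l k < g x")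
            case True
            have "l k \<le> C * l k" using C l1[of k] by simp
            then have "2^k < g x" using True unfolding l_def by linarith
            then show ?thesis using True by (simp add: h_def l_def)
          qed (simp add: h_def)
          then have "(\<Sum>k<n. 2 * l k powr e * h k x powr (p x - e))
              \<le> 2 * g x powr (p x - e) * (\<Sum>k<n. if 2^k < g x then (2^k) powr e else 0)"
            unfolding sum_distrib_left by (intro sum_mono)
          also have "\<dots> \<le> 2 * g x powr (p x - e) * (b * g x powr e)"
            unfolding b_def using e gx by (intro mult_left_mono sum_pow2_below_le) auto
          also have "\<dots> = 2 * b * (g x powr (p x - e) * g x powr e)" by simp
          also have "g x powr (p x - e) * g x powr e = g x powr p x" by (simp flip: powr_add)
          finally show ?thesis .
        qed
      qed (use hi gp in auto)
      also have "\<dots> \<le> 2 * b * 1" unfolding integral_mult_right_zero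
        using b0 gp1 by (intro mult_left_mono) auto
      finally show ?thesis by simp
    qed
    have li: "integrable M (\<lambda>x. indicator (U k) x * l k powr p x)" for k
      using integrable_imp_set_integrable[OF integrable_powr_exponent[OF cw, of "l k"] Us[of k]] l1[of k]
      by (simp add: set_integrable_def)
    define T where "T x = (\<Sum>k. ennreal (indicator (U k) x * l k powr p x))" for x
    have T_int: "(\<integral>\<^sup>+x. T x \<partial>M) \<le> ennreal (2 * b)"
    proof -
      have "(\<integral>\<^sup>+x. T x \<partial>M) = (\<Sum>k. \<integral>\<^sup>+x. ennreal (indicator (U k) x * l k powr p x) \<partial>M)"
        unfolding T_def by (intro nn_integral_suminf) measurable
      also have "\<dots> = (\<Sum>k. ennreal (LINT x:U k|M. l k powr p x))"
        using nn_integral_eq_integral[OF li] by (simp add: set_lebesgue_integral_def)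
      also have "\<dots> \<le> ennreal (2 * b)"
      proof (rule suminf_le_const)
        fix n
        have "(\<Sum>k<n. ennreal (LINT x:U k|M. l k powr p x)) = ennreal (\<Sum>k<n. LINT x:U k|M. l k powr p x)"
          by (intro sum_ennreal set_integral_nonneg_real) simp
        then show "(\<Sum>k<n. ennreal (LINT x:U k|M. l k powr p x)) \<le> ennreal (2 * b)"
          using sum_le[of n] by (simp add: ennreal_leI)
      qed simp
      finally show ?thesis .
    qed
    have Uk: "x \<in> U k" if "ennreal (2 * C * l k) < maximal_op f x" for x k
      using maximal_op_gtD[OF that fi] C l1[of k] unfolding U_def g_def by auto
    have term_le: "ennreal (indicator (U k) x * l k powr p x) \<le> T x" for k x
      unfolding T_def by (rule sum_le_suminf[of _ "{k}", simplified]) auto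
    have pt: "ennreal_power (maximal_op f x) (p x) \<le> ennreal ((4 * C) powr B) * (1 + T x)" for x
    proof (cases "maximal_op f x")
      case top
      \<comment> \<open>A point with infinite maximal function lies in every \<open>U k\<close>, and
        each summand of \<open>T x\<close> is then at least 1.\<close>
      have "of_nat n \<le> T x" for n
      proof -
        have "of_nat n = (\<Sum>k<n. 1 :: ennreal)" by simp
        also have "\<dots> \<le> (\<Sum>k<n. ennreal (indicator (U k) x * l k powr p x))"
        proof (rule sum_mono)
          fix k
          have "x \<in> U k" by (rule Uk) (simp add: top)
          moreover have "1 \<le> l k powr p x" using l1[of k] p(6)[of x] by (intro ge_one_powr_ge_zero) auto
          ultimately show "1 \<le> ennreal (indicator (U k) x * l k powr p x)" by simp
        qed
        also have "\<dots> \<le> T x" unfolding T_def by (rule sum_le_suminf) auto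
        finally show ?thesis .
      qed
      then have "T x = \<infinity>" using ennreal_Ex_less_of_nat[of "T x"]
        by (metis infinity_ennreal_def less_top linorder_not_le)
      then show ?thesis using C by (simp add: ennreal_mult_top)
    next
      case (real r)
      show ?thesis
      proof (cases "r \<le> 2 * C")
        case True
        have "r powr p x \<le> (4 * C) powr p x" using True real C p(6)[of x] by (intro powr_mono2) auto
        also have "\<dots> \<le> (4 * C) powr B" using C p(4) by (intro powr_mono) auto
        finally have "ennreal_power (maximal_op f x) (p x) \<le> ennreal ((4 * C) powr B) * 1"
          using real by (simp add: ennreal_leI)
        also have "\<dots> \<le> ennreal ((4 * C) powr B) * (1 + T x)" by (intro mult_left_mono) auto
        finally show ?thesis .
      next
        case False
        \<comment> \<open>For the least such \<open>n\<close> the predecessor \<open>k\<close>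
          satisfies \<open>2 * C * l k < r \<le> 4 * C * l k\<close>; it exists because
          \<open>r > 2 * C\<close>.\<close>
        define n where "n = (LEAST n. r \<le> 2 * C * l n)"
        obtain n0 where "r / (2 * C) < 2 ^ n0" using real_arch_pow[of 2 "r / (2 * C)"] by auto
        then have "r \<le> 2 * C * l n0" using C by (simp add: l_def field_simps)
        then have n: "r \<le> 2 * C * l n" unfolding n_def by (rule LeastI)
        have "n \<noteq> 0"
        proof
          assume "n = 0"
          then show False using n False by (simp add: l_def)
        qed
        then obtain k where k: "n = Suc k" using not0_implies_Suc by blast
        have "2 * C * l k < r" using not_less_Least[of k "\<lambda>n. r \<le> 2 * C * l n"] k n_def by auto
        then have xU: "x \<in> U k" using real C l1[of k] by (intro Uk) (auto simp: ennreal_less_iff)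
        have "r \<le> 4 * C * l k" using n by (simp add: k l_def)
        then have "r powr p x \<le> (4 * C * l k) powr p x" using real p(6)[of x] by (intro powr_mono2) auto
        also have "\<dots> = (4 * C) powr p x * l k powr p x" using C l1[of k] by (intro powr_mult)
        also have "\<dots> \<le> (4 * C) powr B * l k powr p x"
          using C p(4) by (intro mult_right_mono powr_mono) auto
        finally have "ennreal_power (maximal_op f x) (p x) \<le> ennreal ((4 * C) powr B) * ennreal (l k powr p x)"
          using real by (simp add: ennreal_leI ennreal_mult'[symmetric])
        also have "\<dots> \<le> ennreal ((4 * C) powr B) * (1 + T x)"
          using term_le[of k x] xU by (intro mult_left_mono) (auto intro: add_increasing)
        finally show ?thesis .
      qed
    qed
    have "modular M p (maximal_op f) \<le> (\<integral>\<^sup>+x. ennreal ((4 * C) powr B) * (1 + T x) \<partial>M)"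
      unfolding modular_def by (intro nn_integral_mono pt)
    also have "\<dots> = ennreal ((4 * C) powr B) * (1 + (\<integral>\<^sup>+x. T x \<partial>M))"
      unfolding T_def by (simp add: nn_integral_cmult nn_integral_add emeasure_space_1)
    also have "\<dots> \<le> ennreal ((4 * C) powr B) * (1 + ennreal (2 * b))"
      using T_int by (intro mult_left_mono add_left_mono) auto
    also have "\<dots> = ennreal D"
    proof -
      have "1 + ennreal (2 * b) = ennreal (1 + 2 * b)" using b0 by (subst ennreal_plus) auto
      then show ?thesis using b0 by (simp add: D_def ennreal_mult')
    qed
    finally show ?thesis .
  qed
  then show ?thesis using D1 by blast
qed

text \<open>Exponents are at least 1, so dividing a function by \<open>C \<ge> 1\<close> divides its
  modular by at least \<open>C\<close>. Thus a modular bound \<open>C\<close> on the unit ball is a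
  norm bound with the same \<open>C\<close>.\<close>

lemma muckenhoupt_imp_maximal_op_bounded:
  assumes cw: "conjugate_within c B p q" and A: "muckenhoupt K p q"
  shows "maximal_op_bounded p"
proof -
  note p = conjugate_withinD[OF cw]
  note [measurable] = p(2)
  obtain C where C: "1 \<le> C" and le: "\<And>f. f \<in> borel_measurable M \<Longrightarrow> modular M p (\<lambda>x. ennreal \<bar>f x\<bar>) \<le> 1 \<Longrightarrow>
    modular M p (maximal_op f) \<le> ennreal C"
    using muckenhoupt_imp_modular_le[OF cw muckenhoupt_mono[OF A, of "max 1 K"]] by auto
  show ?thesis unfolding maximal_op_bounded_def
  proof (intro exI conjI ballI)
    show "0 \<le> C" using C by simp
    fix f assume "f \<in> variable_Lebesgue M p"
    then have f[measurable]: "f \<in> borel_measurable M" by (simp add: variable_Lebesgue_def)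
    have "luxemburg_norm M p (maximal_op f) \<le> ennreal C * ennreal l"
      if l: "0 < l" and m: "modular M p (\<lambda>x. ennreal \<bar>f x\<bar> / ennreal l) \<le> 1" for l
    proof -
      have "modular M p (\<lambda>x. ennreal \<bar>f x / l\<bar>) \<le> 1"
        using m l by (simp add: abs_divide divide_ennreal)
      then have m': "modular M p (maximal_op (\<lambda>x. f x / l)) \<le> ennreal C" by (intro le) auto
      have "modular M p (\<lambda>x. maximal_op f x / ennreal (C * l)) \<le> modular M p (\<lambda>x. maximal_op (\<lambda>x. f x / l) x / ennreal C)"
      proof (rule modular_mono)
        fix x
        have "maximal_op f x / ennreal (C * l) = maximal_op f x / ennreal l / ennreal C"
          using C l by (cases "maximal_op f x") (auto simp: divide_ennreal ennreal_top_divide mult.commute)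
        also have "\<dots> \<le> maximal_op (\<lambda>x. f x / l) x / ennreal C"
          by (intro divide_right_mono_ennreal maximal_op_divide l f)
        finally show "maximal_op f x / ennreal (C * l) \<le> maximal_op (\<lambda>x. f x / l) x / ennreal C" .
        show "0 \<le> p x" using p(6)[of x] by simp
      qed
      also have "\<dots> \<le> (\<integral>\<^sup>+x. ennreal_power (maximal_op (\<lambda>x. f x / l) x) (p x) * ennreal (1 / C) \<partial>M)"
        unfolding modular_def
      proof (rule nn_integral_mono)
        fix x
        have "ennreal_power (maximal_op (\<lambda>x. f x / l) x / ennreal C) (p x) \<le> ennreal_power (maximal_op (\<lambda>x. f x / l) x) (p x) / ennreal C"
          using C p(6)[of x] by (intro ennreal_power_divide_le) auto
        also have "\<dots> = ennreal_power (maximal_op (\<lambda>x. f x / l) x) (p x) * ennreal (1 / C)"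
          using C by (simp add: divide_ennreal_def inverse_ennreal divide_inverse)
        finally show "ennreal_power (maximal_op (\<lambda>x. f x / l) x / ennreal C) (p x) \<le> \<dots>" .
      qed
      also have "\<dots> = modular M p (maximal_op (\<lambda>x. f x / l)) * ennreal (1 / C)"
        unfolding modular_def ennreal_power_def by (intro nn_integral_multc) measurable
      also have "\<dots> \<le> ennreal C * ennreal (1 / C)"
        by (intro mult_right_mono m') auto
      also have "\<dots> = 1" using C by (simp add: ennreal_mult'[symmetric])
      finally show ?thesis
        using C l luxemburg_norm_le[of "C * l" M p "maximal_op f"] by (simp add: ennreal_mult)
    qed
    then have "luxemburg_norm M p (maximal_op f) / ennreal C \<le> luxemburg_norm M p (\<lambda>x. ennreal \<bar>f x\<bar>)"
      unfolding luxemburg_norm_def[of M p "\<lambda>x. ennreal \<bar>f x\<bar>"]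
      using C by (intro Inf_greatest) (auto intro!: divide_le_posI_ennreal)
    then have "ennreal C * (luxemburg_norm M p (maximal_op f) / ennreal C) \<le> ennreal C * luxemburg_norm M p (\<lambda>x. ennreal \<bar>f x\<bar>)"
      by (intro mult_left_mono) auto
    also have "ennreal C * (luxemburg_norm M p (maximal_op f) / ennreal C) = luxemburg_norm M p (maximal_op f)"
      using C by (simp add: ennreal_times_divide mult.commute[of "ennreal C"] mult_divide_eq_ennreal)
    finally show "luxemburg_norm M p (maximal_op f) \<le> ennreal C * luxemburg_norm M p (\<lambda>x. ennreal \<bar>f x\<bar>)" .
  qed
qed

text \<open>
  The test function is \<open>r\<^bsup>q(x) - 1\<^esup>\<close> on \<open>Q\<close>, with \<open>r\<close> the largest power of 2 for which
  \<open>\<integral>\<^sub>Q r\<^bsup>q(x)\<^esup> \<le> 1\<close>.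
\<close>

lemma maximal_op_bounded_imp_muckenhoupt:
  assumes cw: "conjugate_within c B p q" and bd: "maximal_op_bounded p"
  shows "\<exists>K. muckenhoupt K p q"
proof -
  note p = conjugate_withinD[OF cw] and q = conjugate_withinD[OF conjugate_within_sym[OF cw]]
  note wc = conjugate_within_sym[OF cw]
  note [measurable] = p(2) q(2)
  have B1: "1 < B" using p(4,6) by (meson less_le_trans)
  obtain C where C: "0 \<le> C" and bdd: "\<And>f. f \<in> variable_Lebesgue M p \<Longrightarrow>
        luxemburg_norm M p (maximal_op f) \<le> ennreal C * luxemburg_norm M p (\<lambda>x. ennreal \<bar>f x\<bar>)"
    using bd unfolding maximal_op_bounded_def by blast
  \<comment> \<open>\<open>C + 1\<close> bounds the admissible \<open>l\<close> below, and
    \<open>2 powr B\<close> is the loss from taking \<open>r\<close> among the powers of 2.\<close>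
  define L where "L = (C + 1) * 2 powr B"
  have L1: "1 \<le> L"
  proof -
    have "1 * 1 \<le> L" unfolding L_def using C B1 by (intro mult_mono) (auto intro!: ge_one_powr_ge_zero)
    then show ?thesis by simp
  qed
  have "muckenhoupt (L powr B) p q" unfolding muckenhoupt_def
  proof
    fix Q assume Q: "Q \<in> F"
    have Qs[measurable]: "Q \<in> sets M" using Q F_sets by simp
    define m where "m = measure M Q"
    have m: "0 < m" "m \<le> 1" using F_pos Q by (auto simp: m_def)
    have iq: "set_integrable M Q (\<lambda>x. u powr q x)" if "0 \<le> u" for u
      using that by (intro integrable_imp_set_integrable integrable_powr_exponent[OF wc]) auto
    \<comment> \<open>Powers of 2 avoid solving \<open>\<integral> r powr q x = 1\<close> exactly;
      maximality places the integral \<open>V\<close> between \<open>2 powr (- B)\<close> and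
      1.\<close>
    define P where "P k \<longleftrightarrow> (LINT x:Q|M. (2^k) powr q x) \<le> 1" for k :: nat
    have "P 0" using m by (simp add: P_def set_integral_const_real m_def)
    obtain k0 where k0: "1 / m < 2 ^ k0" using real_arch_pow[of 2 "1 / m"] by auto
    have "\<not> P k" if "k0 < k" for k
    proof -
      have "1 / m < 2 ^ k" using k0 that power_increasing[of k0 k "2::real"] by linarith
      then have "1 < 2 ^ k * m" using m by (simp add: field_simps)
      also have "\<dots> \<le> (LINT x:Q|M. (2^k) powr q x)"
        unfolding m_def by (intro measure_le_set_integral_powr[OF wc Q]) simp
      finally show ?thesis by (simp add: P_def)
    qed
    then have bound: "\<forall>k. P k \<longrightarrow> k \<le> k0" by (meson linorder_not_less)
    define k where "k = (GREATEST k. P k)"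
    have k: "P k" unfolding k_def using bound by (intro GreatestI_nat[where P = P and k = 0 and b = k0] \<open>P 0\<close>) auto
    have k': "\<not> P (Suc k)" using Greatest_le_nat[of P "Suc k" k0] bound by (auto simp: k_def)
    define r where "r = (2::real) ^ k"
    have r: "1 \<le> r" by (simp add: r_def)
    define V where "V = (LINT x:Q|M. r powr q x)"
    have V1: "V \<le> 1" using k by (simp add: V_def r_def P_def)
    have V2: "1 < 2 powr B * V"
    proof -
      have "1 < (LINT x:Q|M. (2 * r) powr q x)" using k' by (simp add: P_def r_def)
      also have "\<dots> \<le> (LINT x:Q|M. 2 powr B * r powr q x)"
      proof (intro set_integral_mono iq set_integrable_mult_right)
        fix x
        have "(2 * r) powr q x = 2 powr q x * r powr q x" using r by (simp add: powr_mult)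
        also have "\<dots> \<le> 2 powr B * r powr q x" using q(4)[of x] by (intro mult_right_mono powr_mono) auto
        finally show "(2 * r) powr q x \<le> 2 powr B * r powr q x" .
      qed (use r in auto)
      finally show ?thesis by (simp add: V_def)
    qed
    have V0: "0 < V"
      using V2 by (intro zero_less_mult_pos[of "2 powr B" V]) auto
    define f where "f x = indicator Q x * r powr (q x - 1)" for x
    have f[measurable]: "f \<in> borel_measurable M" unfolding f_def by measurable
    have f0: "0 \<le> f x" for x by (simp add: f_def)
    have modf: "modular M p (\<lambda>x. ennreal \<bar>f x\<bar> / ennreal 1) \<le> 1"
    proof -
      have "ennreal a / ennreal 1 = ennreal a" if "0 \<le> a" for a
        using that divide_ennreal[of a 1] by simp
      then have "modular M p (\<lambda>x. ennreal \<bar>f x\<bar> / ennreal 1) = (\<integral>\<^sup>+x. ennreal (f x powr p x) \<partial>M)"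
        using f0 by (simp add: modular_def del: ennreal_1)
      also have "\<dots> = (\<integral>\<^sup>+x. ennreal (indicator Q x * r powr q x) \<partial>M)"
        using p(7) by (intro nn_integral_cong) (auto simp: f_def indicator_def powr_powr mult.commute)
      also have "\<dots> = ennreal V"
        using iq[of r] r unfolding V_def set_lebesgue_integral_def set_integrable_def
        by (subst nn_integral_eq_integral) auto
      finally show ?thesis using V1 by simp
    qed
    have fL: "f \<in> variable_Lebesgue M p"
      unfolding variable_Lebesgue_def using modf f
      by (auto intro!: exI[of _ 1] simp: less_top[symmetric] top_unique)
    have "luxemburg_norm M p (maximal_op f) \<le> ennreal C * luxemburg_norm M p (\<lambda>x. ennreal \<bar>f x\<bar>)"
      by (rule bdd[OF fL])
    also have "\<dots> \<le> ennreal C * ennreal 1" by (intro mult_left_mono luxemburg_norm_le modf) auto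
    \<comment> \<open>A strict inequality is needed to extract an admissible \<open>l\<close> from
      the infimum.\<close>
    also have "\<dots> < ennreal (C + 1)" using C by (simp add: ennreal_less_iff)
    finally obtain l where l: "0 < l" "ennreal l < ennreal (C + 1)" and ml: "modular M p (\<lambda>x. maximal_op f x / ennreal l) \<le> 1"
      unfolding luxemburg_norm_def Inf_less_iff by auto
    have lC: "l < C + 1" using l by (simp add: ennreal_less_iff)
    \<comment> \<open>\<open>v\<close> is the average of \<open>f\<close> on \<open>Q\<close>, a
      lower bound for the maximal function there. So the modular of the constant
      \<open>s = v / l\<close> on \<open>Q\<close> is at most that of the maximal function divided
      by \<open>l\<close>.\<close>
    define v where "v = V / (r * m)"
    define s where "s = v / l"
    have s0: "0 < s" "0 < v" using V0 r m l by (auto simp: s_def v_def)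
    have fQ: "(LINT x:Q|M. f x) = V / r"
    proof -
      have "(LINT x:Q|M. f x) = (LINT x:Q|M. r powr q x * (1 / r))"
        unfolding set_lebesgue_integral_def using r
        by (intro Bochner_Integration.integral_cong) (auto simp: f_def indicator_def powr_diff)
      then show ?thesis by (simp add: V_def)
    qed
    have fi: "set_integrable M Q f"
    proof (intro integrable_imp_set_integrable integrable_bounded[of _ "r powr B"])
      show "f x \<le> r powr B" for x using r q(4)[of x] by (auto simp: f_def indicator_def intro!: powr_mono)
    qed (use f0 in auto)
    have "ennreal (LINT x:Q|M. s powr p x) = (\<integral>\<^sup>+x. ennreal (indicator Q x * s powr p x) \<partial>M)"
      using integrable_imp_set_integrable[OF integrable_powr_exponent[OF cw, of s] Qs] s0
      unfolding set_lebesgue_integral_def set_integrable_def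
      by (subst nn_integral_eq_integral) auto
    also have "\<dots> \<le> modular M p (\<lambda>x. maximal_op f x / ennreal l)"
      unfolding modular_def
    proof (rule nn_integral_mono)
      fix x
      show "ennreal (indicator Q x * s powr p x) \<le> ennreal_power (maximal_op f x / ennreal l) (p x)"
      proof (cases "x \<in> Q")
        case True
        have "ennreal v \<le> maximal_op f x"
          using maximal_op_ge[OF Q True fi f0] by (simp add: fQ v_def m_def)
        then have "ennreal v / ennreal l \<le> maximal_op f x / ennreal l" by (rule divide_right_mono_ennreal)
        then have "ennreal s \<le> maximal_op f x / ennreal l" using s0 l by (simp add: s_def divide_ennreal)
        then have "ennreal_power (ennreal s) (p x) \<le> ennreal_power (maximal_op f x / ennreal l) (p x)"
          using p(6)[of x] by (intro ennreal_power_mono) auto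
        then show ?thesis using True s0 by simp
      qed simp
    qed
    also have "\<dots> \<le> 1" by (rule ml)
    finally have s1: "(LINT x:Q|M. s powr p x) \<le> 1" by simp
    have "(LINT x:Q|M. (1 / (s * m)) powr q x) \<le> (LINT x:Q|M. L powr B * r powr q x)"
    proof (intro set_integral_mono iq set_integrable_mult_right)
      fix x
      have "1 / (s * m) = l * r / V" using m by (simp add: s_def v_def)
      also have "\<dots> \<le> l * r * 2 powr B" using V2 V0 l r by (simp add: field_simps)
      also have "\<dots> \<le> L * r" unfolding L_def using lC r by (simp add: mult_right_mono)
      finally have "(1 / (s * m)) powr q x \<le> (L * r) powr q x" using s0 m q(6)[of x] by (intro powr_mono2) auto
      also have "\<dots> = L powr q x * r powr q x" using L1 r by (simp add: powr_mult)
      also have "\<dots> \<le> L powr B * r powr q x" using L1 q(4) by (intro mult_right_mono powr_mono) auto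
      finally show "(1 / (s * m)) powr q x \<le> L powr B * r powr q x" .
    qed (use s0 m r in auto)
    also have "\<dots> = L powr B * V" by (simp add: V_def)
    also have "\<dots> \<le> L powr B * 1" using V1 by (intro mult_left_mono) auto
    finally have s2: "(LINT x:Q|M. (1 / (s * m)) powr q x) \<le> L powr B" by simp
    have "1 \<le> L powr B" using L1 B1 by (intro ge_one_powr_ge_zero) auto
    then show "\<exists>s>0. (LINT x:Q|M. s powr p x) \<le> L powr B \<and> (LINT x:Q|M. (1 / (s * measure M Q)) powr q x) \<le> L powr B"
      using s0 s1 s2 by (intro exI[of _ s]) (auto simp: m_def)
  qed
  then show ?thesis by blast
qed

theorem maximal_op_bounded_dual:
  assumes "conjugate_within c B p q"
  shows "maximal_op_bounded p \<longleftrightarrow> maximal_op_bounded q"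
proof -
  have "maximal_op_bounded q" if cw: "conjugate_within c B p q" and bd: "maximal_op_bounded p" for p q
  proof -
    obtain K where "muckenhoupt K p q"
      using maximal_op_bounded_imp_muckenhoupt[OF cw bd] by blast
    then show ?thesis
      by (rule muckenhoupt_imp_maximal_op_bounded[OF conjugate_within_sym[OF cw] muckenhoupt_sym])
  qed
  then show ?thesis using assms conjugate_within_sym[OF assms] by blast
qed

end

subsection \<open>Generalized intervals\<close>

text \<open>The metric makes \<^typ>\<open>nat \<Rightarrow> int\<close> polish, as required by the library theorem on outer regularity.\<close>

instantiation int :: metric_space
begin

definition dist_int :: "int \<Rightarrow> int \<Rightarrow> real" where
  "dist_int x y = \<bar>real_of_int x - real_of_int y\<bar>"

definition uniformity_int :: "(int \<times> int) filter" where
  "uniformity_int = (INF e\<in>{0<..}. principal {(x, y). dist x y < e})"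

instance
proof
  show "uniformity = (INF e\<in>{0<..}. principal {(x :: int, y). dist x y < e})"
    by (rule uniformity_int_def)
  show "open U \<longleftrightarrow> (\<forall>x\<in>U. \<forall>\<^sub>F (x', y) in uniformity. x' = x \<longrightarrow> y \<in> U)" for U :: "int set"
  proof -
    have "\<forall>\<^sub>F (x', y) in uniformity. x' = x \<longrightarrow> y \<in> U" if "x \<in> U" for x :: int
    proof -
      have "x = y" if "dist x y < 1" for y using that by (force simp: dist_int_def)
      then have "\<forall>\<^sub>F (x', y) in principal {(x, y). dist x y < (1::real)}. x' = x \<longrightarrow> y \<in> U"
        unfolding eventually_principal using that by auto
      then show ?thesis
        unfolding uniformity_int_def by (rule eventually_INF1[rotated]) simp
    qed
    then show ?thesis by (simp add: Topological_Spaces.open_discrete)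
  qed
  show "dist x y = 0 \<longleftrightarrow> x = y" for x y :: int by (simp add: dist_int_def)
  show "dist x y \<le> dist x z + dist y z" for x y z :: int
    unfolding dist_int_def by linarith
qed

end

instance int :: complete_space
proof
  fix X :: "nat \<Rightarrow> int" assume "Cauchy X"
  then obtain N where N: "\<And>n. n \<ge> N \<Longrightarrow> dist (X n) (X N) < 1"
    unfolding Cauchy_altdef2 by (meson zero_less_one)
  then have "X n = X N" if "n \<ge> N" for n
    using that by (force simp: dist_int_def)
  then have "\<forall>\<^sub>F n in sequentially. X n = X N" unfolding eventually_sequentially by blast
  then show "convergent X" unfolding convergent_def by (blast intro: tendsto_eventually)
qed

instance int :: polish_space ..

lemma carrier_cyclic_product:
  assumes "\<And>i. m i \<ge> 2"
  shows "x \<in> carrier (cyclic_product m) \<longleftrightarrow> (\<forall>i. 0 \<le> x i \<and> x i < int (m i))"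
proof -
  have "m i \<noteq> 0" for i using assms[of i] by simp
  then show ?thesis by (auto simp: cyclic_product_def PiE_iff carrier_integer_mod_group)
qed

text \<open>The coset in closed form: coordinate \<open>k\<close> runs through the cyclic arc of
  \<open>j\<close> residues starting at \<open>x k\<close>, and the remainder takes care of wrapping
  around.\<close>

definition gen_interval :: "(nat \<Rightarrow> nat) \<Rightarrow> (nat \<Rightarrow> int) \<Rightarrow> nat \<Rightarrow> nat \<Rightarrow> (nat \<Rightarrow> int) set" where
  "gen_interval m x k j = {z \<in> carrier (cyclic_product m). (\<forall>i<k. z i = x i) \<and> (z k - x k) mod int (m k) < int j}"

text \<open>An interval seen from one of its points \<open>z\<close>: it extends \<open>L\<close> steps to the left and \<open>R - 1\<close> to the right.\<close>

definition two_sided_interval :: "(nat \<Rightarrow> nat) \<Rightarrow> (nat \<Rightarrow> int) \<Rightarrow> nat \<Rightarrow> int \<Rightarrow> int \<Rightarrow> (nat \<Rightarrow> int) set" where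
  "two_sided_interval m z k L R = {y \<in> carrier (cyclic_product m). (\<forall>i<k. y i = z i) \<and>
     ((y k - z k) mod int (m k) < R \<or> int (m k) - L \<le> (y k - z k) mod int (m k))}"

lemma gen_intervals_eq:
  assumes m: "\<And>i. m i \<ge> 2"
  shows "gen_intervals m = {gen_interval m x k j | x k j. x \<in> carrier (cyclic_product m) \<and> 1 \<le> j \<and> j \<le> m k}"
proof -
  let ?G = "cyclic_product m"
  have mult: "x \<otimes>\<^bsub>?G\<^esub> y = (\<lambda>i. (x i + y i) mod int (m i))" for x y
    by (auto simp: cyclic_product_def product_group_def fun_eq_iff)
  have pos: "0 < int (m i)" for i using m[of i] by simp
  have "x <#\<^bsub>?G\<^esub> {y \<in> carrier ?G. (\<forall>i<k. y i = 0) \<and> 0 \<le> y k \<and> y k < int j} = gen_interval m x k j"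
    if x: "x \<in> carrier ?G" and j: "j \<le> m k" for x k j
  proof (intro equalityI subsetI)
    fix z assume "z \<in> x <#\<^bsub>?G\<^esub> {y \<in> carrier ?G. (\<forall>i<k. y i = 0) \<and> 0 \<le> y k \<and> y k < int j}"
    then obtain y where y: "y \<in> carrier ?G" "\<forall>i<k. y i = 0" "0 \<le> y k" "y k < int j"
      and z: "z = (\<lambda>i. (x i + y i) mod int (m i))" by (auto simp: l_coset_def mult)
    have "z \<in> carrier ?G" unfolding z carrier_cyclic_product[OF m] using pos by simp
    moreover have "\<forall>i<k. z i = x i" using x y z by (auto simp: carrier_cyclic_product[OF m])
    moreover have "(z k - x k) mod int (m k) = y k"
      using y(1) unfolding z carrier_cyclic_product[OF m] by (simp add: mod_simps)
    ultimately show "z \<in> gen_interval m x k j" using y by (simp add: gen_interval_def)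
  next
    fix z assume z: "z \<in> gen_interval m x k j"
    define y where "y i = (z i - x i) mod int (m i)" for i
    have "y \<in> carrier ?G" unfolding y_def carrier_cyclic_product[OF m] using pos by simp
    moreover have "\<forall>i<k. y i = 0" "0 \<le> y k" "y k < int j" using z pos by (auto simp: y_def gen_interval_def)
    moreover have "z = x \<otimes>\<^bsub>?G\<^esub> y"
      using z unfolding mult y_def gen_interval_def carrier_cyclic_product[OF m] by (auto simp: mod_simps fun_eq_iff)
    ultimately show "z \<in> x <#\<^bsub>?G\<^esub> {y \<in> carrier ?G. (\<forall>i<k. y i = 0) \<and> 0 \<le> y k \<and> y k < int j}"
      unfolding l_coset_def by blast
  qed
  then show ?thesis unfolding gen_intervals_def by (intro Collect_cong iff_exI) auto
qed

section \<open>Intervals as cyclic arcs: covering, measure and enlargement\<close>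

context
  fixes m :: "nat \<Rightarrow> nat"
  assumes m: "\<And>i. m i \<ge> 2"
begin

lemma m_pos: "0 < int (m i)"
  using m[of i] by simp

lemma gen_intervalsE:
  assumes "I \<in> gen_intervals m"
  obtains x k j where "I = gen_interval m x k j" "x \<in> carrier (cyclic_product m)" "1 \<le> j" "j \<le> m k"
  using assms unfolding gen_intervals_eq[OF m] by blast

lemma gen_interval_mem:
  "x \<in> carrier (cyclic_product m) \<Longrightarrow> 1 \<le> j \<Longrightarrow> j \<le> m k \<Longrightarrow> gen_interval m x k j \<in> gen_intervals m"
  unfolding gen_intervals_eq[OF m] by blast

lemma gen_interval_center: "x \<in> carrier (cyclic_product m) \<Longrightarrow> 1 \<le> j \<Longrightarrow> x \<in> gen_interval m x k j"
  by (simp add: gen_interval_def)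

lemma gen_interval_cong: "(\<And>i. i \<le> k \<Longrightarrow> x i = y i) \<Longrightarrow> gen_interval m x k j = gen_interval m y k j"
  by (auto simp: gen_interval_def)

lemma gen_interval_full: "gen_interval m x k (m k) = {z \<in> carrier (cyclic_product m). \<forall>i<k. z i = x i}"
  using m_pos[of k] by (auto simp: gen_interval_def)

lemma shift_mod:
  fixes a b c M :: int
  shows "(a - c) mod M = ((a - b) mod M + (b - c) mod M) mod M"
  by (simp add: mod_simps)

text \<open>The left extent is the offset \<open>e\<close> of \<open>z\<close> in its arc, the right
  one what remains of \<open>j\<close>. Adding \<open>e\<close> to an offset from \<open>z\<close>
  wraps around at most once, which gives the two alternatives.\<close>

lemma gen_interval_two_sided:
  assumes I: "I \<in> gen_intervals m" and z: "z \<in> I"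
  shows "\<exists>k L R. I = two_sided_interval m z k L R \<and> 0 \<le> L \<and> 1 \<le> R \<and> L + R \<le> int (m k)"
proof -
  from I obtain x k j where Ix: "I = gen_interval m x k j" "x \<in> carrier (cyclic_product m)" "1 \<le> j" "j \<le> m k"
    by (rule gen_intervalsE)
  define e where "e = (z k - x k) mod int (m k)"
  have zk: "\<forall>i<k. z i = x i" and e: "0 \<le> e" "e < int j"
    using z m_pos[of k] by (auto simp: Ix gen_interval_def e_def)
  have "(y k - x k) mod int (m k) < int j \<longleftrightarrow>
      (y k - z k) mod int (m k) < int j - e \<or> int (m k) - e \<le> (y k - z k) mod int (m k)" for y
  proof -
    define u where "u = (y k - z k) mod int (m k)"
    have u: "0 \<le> u" "u < int (m k)" using m_pos[of k] by (auto simp: u_def)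
    have s: "(y k - x k) mod int (m k) = (u + e) mod int (m k)"
      unfolding u_def e_def by (rule shift_mod)
    show ?thesis
    proof (cases "u + e < int (m k)")
      case True
      then show ?thesis unfolding s u_def[symmetric] using u e by auto
    next
      case False
      have "(u + e) mod int (m k) = (u + e - int (m k)) mod int (m k)" by simp
      also have "\<dots> = u + e - int (m k)" using False u e Ix(4) by (intro mod_pos_pos_trivial) auto
      finally show ?thesis unfolding s u_def[symmetric] using False u e Ix(4) by auto
    qed
  qed
  then have "I = two_sided_interval m z k e (int j - e)"
    using zk unfolding Ix gen_interval_def two_sided_interval_def by auto
  moreover have "0 \<le> e" "1 \<le> int j - e" "e + (int j - e) \<le> int (m k)" using e Ix(4) by auto
  ultimately show ?thesis by blast
qed

lemma two_sided_interval_nested: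
  assumes "k < l" "1 \<le> R"
  shows "two_sided_interval m z l L' R' \<subseteq> two_sided_interval m z k L R"
  using assms by (auto simp: two_sided_interval_def)

text \<open>Seen from the common point at one level, an interval reaching farthest to the left and
  one reaching farthest to the right cover any third. Two intervals of different levels through a
  point are nested.\<close>

lemma gen_intervals_triple:
  assumes "I1 \<in> gen_intervals m" "I2 \<in> gen_intervals m" "I3 \<in> gen_intervals m" "z \<in> I1" "z \<in> I2" "z \<in> I3"
  shows "I1 \<subseteq> I2 \<union> I3 \<or> I2 \<subseteq> I1 \<union> I3 \<or> I3 \<subseteq> I1 \<union> I2"
proof -
  obtain k1 L1 R1 where 1: "I1 = two_sided_interval m z k1 L1 R1" "1 \<le> R1"
    using gen_interval_two_sided[OF assms(1,4)] by blast
  obtain k2 L2 R2 where 2: "I2 = two_sided_interval m z k2 L2 R2" "1 \<le> R2"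
    using gen_interval_two_sided[OF assms(2,5)] by blast
  obtain k3 L3 R3 where 3: "I3 = two_sided_interval m z k3 L3 R3" "1 \<le> R3"
    using gen_interval_two_sided[OF assms(3,6)] by blast
  show ?thesis
  proof (cases "k1 = k2 \<and> k2 = k3")
    case True
    have un: "two_sided_interval m z k L R \<subseteq> two_sided_interval m z k L' R' \<union> two_sided_interval m z k L'' R''"
      if "L \<le> max L' L''" "R \<le> max R' R''" for k L R L' R' L'' R''
      using that unfolding two_sided_interval_def by auto
    have "L1 \<le> max L2 L3 \<and> R1 \<le> max R2 R3 \<or> L2 \<le> max L1 L3 \<and> R2 \<le> max R1 R3 \<or> L3 \<le> max L1 L2 \<and> R3 \<le> max R1 R2"
      by linarith
    then show ?thesis using un unfolding 1 2 3 using True by metis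
  next
    case False
    then consider "k1 < k2" | "k2 < k1" | "k2 < k3" | "k3 < k2" by linarith
    then show ?thesis
      using two_sided_interval_nested 1 2 3 by cases blast+
  qed
qed

lemma gen_intervals_nested:
  assumes "gen_interval m x k i \<in> gen_intervals m" "gen_interval m y l j \<in> gen_intervals m" "k < l"
    "z \<in> gen_interval m x k i" "z \<in> gen_interval m y l j"
  shows "gen_interval m y l j \<subseteq> gen_interval m x k i"
  using assms by (auto simp: gen_interval_def)

text \<open>All supersets contain a fixed point of \<open>I\<close>. One of finer level than
  \<open>I\<close> would be contained in \<open>I\<close>, hence equal to it; at each of the
  remaining levels there are finitely many extents.\<close>

lemma gen_intervals_finite_above:
  assumes I: "I \<in> gen_intervals m"
  shows "finite {J \<in> gen_intervals m. I \<subseteq> J}"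
proof -
  obtain x l j where Ix: "I = gen_interval m x l j" "x \<in> carrier (cyclic_product m)" "1 \<le> j"
    using gen_intervalsE[OF I] by blast
  have xI: "x \<in> I" using gen_interval_center Ix by simp
  obtain l' L' R' where I': "I = two_sided_interval m x l' L' R'" "1 \<le> R'"
    using gen_interval_two_sided[OF I xI] by blast
  define S where "S = (SIGMA k:{..l'}. {0..int (m k)} \<times> {0..int (m k)})"
  have "{J \<in> gen_intervals m. I \<subseteq> J} \<subseteq> insert I ((\<lambda>(k, L, R). two_sided_interval m x k L R) ` S)"
  proof
    fix J assume J: "J \<in> {J \<in> gen_intervals m. I \<subseteq> J}"
    then obtain k L R where kLR: "J = two_sided_interval m x k L R" "0 \<le> L" "1 \<le> R" "L + R \<le> int (m k)"
      using gen_interval_two_sided[of J x] xI by blast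
    show "J \<in> insert I ((\<lambda>(k, L, R). two_sided_interval m x k L R) ` S)"
    proof (cases "k \<le> l'")
      case True
      then have "(k, L, R) \<in> S" using kLR by (auto simp: S_def)
      then show ?thesis using kLR(1) by (auto intro!: image_eqI[of _ _ "(k, L, R)"])
    next
      case False
      then have "J \<subseteq> I" unfolding kLR(1) I'(1) using I'(2) by (intro two_sided_interval_nested) auto
      then show ?thesis using J by auto
    qed
  qed
  moreover have "finite S" unfolding S_def by auto
  ultimately show ?thesis by (meson finite.insertI finite_imageI finite_subset)
qed

lemma gen_intervals_countable: "countable (gen_intervals m)"
proof -
  \<comment> \<open>Only the coordinates up to \<open>k\<close> matter, so a finite list can encode
    \<open>x\<close>.\<close>
  define h where "h = (\<lambda>(xs, k, j). gen_interval m (\<lambda>i. if i < length xs then xs ! i else 0) k j)"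
  have "gen_intervals m \<subseteq> range h"
  proof
    fix I assume "I \<in> gen_intervals m"
    then obtain x k j where I: "I = gen_interval m x k j" using gen_intervalsE by blast
    have "I = h (map x [0..<Suc k], k, j)"
      unfolding I h_def prod.case by (intro gen_interval_cong) (auto simp: nth_append simp del: upt_Suc)
    then show "I \<in> range h" by blast
  qed
  then show ?thesis by (rule countable_subset) simp
qed

lemma card_residues:
  assumes "0 \<le> a" "j \<le> m k"
  shows "card {w \<in> {0..<int (m k)}. (w - a) mod int (m k) < int j} = j"
proof -
  define M where "M = int (m k)"
  have M: "0 < M" using m_pos[of k] by (simp add: M_def)
  have "bij_betw (\<lambda>i. (a + i) mod M) {0..<int j} {w \<in> {0..<M}. (w - a) mod M < int j}"
  proof (rule bij_betw_byWitness[where f' = "\<lambda>w. (w - a) mod M"])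
    show "\<forall>i\<in>{0..<int j}. ((a + i) mod M - a) mod M = i"
      using assms by (auto simp: mod_simps M_def)
    show "\<forall>w\<in>{w \<in> {0..<M}. (w - a) mod M < int j}. (a + (w - a) mod M) mod M = w"
      by (auto simp: mod_simps)
    show "(\<lambda>i. (a + i) mod M) ` {0..<int j} \<subseteq> {w \<in> {0..<M}. (w - a) mod M < int j}"
      using M assms by (auto simp: mod_simps M_def)
    show "(\<lambda>w. (w - a) mod M) ` {w \<in> {0..<M}. (w - a) mod M < int j} \<subseteq> {0..<int j}"
      using M by auto
  qed
  then have "card {w \<in> {0..<M}. (w - a) mod M < int j} = card {0..<int j}"
    by (rule bij_betw_same_card[symmetric])
  then show ?thesis by (simp add: M_def)
qed

lemma gen_interval_sets_measure:
  assumes x: "x \<in> carrier (cyclic_product m)" and j: "j \<le> m k"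
  shows "gen_interval m x k j \<in> sets (haar m)"
    and "measure (haar m) (gen_interval m x k j) = real j / (\<Prod>i\<le>k. real (m i))"
proof -
  define C where "C i = carrier (integer_mod_group (m i))" for i
  have C: "C i = {0..<int (m i)}" for i using m[of i] by (auto simp: C_def carrier_integer_mod_group)
  interpret product_prob_space "\<lambda>i. uniform_count_measure (C i)" UNIV
    by (auto simp: product_prob_space_def product_prob_space_axioms_def product_sigma_finite_def
        C_def intro!: prob_space_factor m prob_space_imp_sigma_finite)
  have haar: "haar m = PiM UNIV (\<lambda>i. uniform_count_measure (C i))"
    by (simp add: haar_def C_def)
  define X where "X i = (if i < k then {x i} else {w \<in> C i. (w - x i) mod int (m i) < int j})" for i
  have xC: "x i \<in> C i" for i using x by (auto simp: C carrier_cyclic_product[OF m])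
  have XC: "X i \<subseteq> C i" for i using xC by (auto simp: X_def)
  have eq: "gen_interval m x k j = prod_emb UNIV (\<lambda>i. uniform_count_measure (C i)) {..k} (Pi\<^sub>E {..k} X)"
  proof -
    have 1: "z \<in> carrier (cyclic_product m) \<longleftrightarrow> (\<forall>i. z i \<in> C i)" for z
      by (auto simp: C carrier_cyclic_product[OF m])
    have 2: "(\<forall>i\<le>k. z i \<in> X i) \<longleftrightarrow> (\<forall>i<k. z i = x i) \<and> (z k - x k) mod int (m k) < int j"
      if "\<forall>i. z i \<in> C i" for z
      using that by (auto simp: X_def le_less)
    have 3: "z \<in> prod_emb UNIV (\<lambda>i. uniform_count_measure (C i)) {..k} (Pi\<^sub>E {..k} X) \<longleftrightarrow>
        (\<forall>i. z i \<in> C i) \<and> (\<forall>i\<le>k. z i \<in> X i)" for z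
      by (auto simp: prod_emb_def PiE_iff space_uniform_count_measure)
    show ?thesis
      by (rule Set.set_eqI) (unfold gen_interval_def mem_Collect_eq 1 3, use 2 in blast)
  qed
  show "gen_interval m x k j \<in> sets (haar m)"
    unfolding haar eq using XC by (intro sets_PiM_I) (auto simp: sets_uniform_count_measure)
  have "measure (haar m) (gen_interval m x k j) = (\<Prod>i\<le>k. measure (uniform_count_measure (C i)) (X i))"
    unfolding haar eq using XC by (intro measure_PiM_emb) (auto simp: sets_uniform_count_measure)
  also have "\<dots> = (\<Prod>i\<le>k. real (card (X i)) / real (m i))"
    using XC by (intro prod.cong) (auto simp: measure_uniform_count_measure C)
  also have "\<dots> = (\<Prod>i\<le>k. real (card (X i))) / (\<Prod>i\<le>k. real (m i))" by (rule prod_dividef)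
  also have "(\<Prod>i\<le>k. real (card (X i))) = real (card (X k))"
  proof -
    have "(\<Prod>i\<le>k. real (card (X i))) = (\<Prod>i<k. real (card (X i))) * real (card (X k))"
      by (simp add: lessThan_Suc_atMost[symmetric])
    also have "(\<Prod>i<k. real (card (X i))) = 1" by (intro prod.neutral) (simp add: X_def)
    finally show ?thesis by simp
  qed
  also have "card (X k) = j"
    using card_residues[of "x k" j k] x j by (simp add: X_def C carrier_cyclic_product[OF m])
  finally show "measure (haar m) (gen_interval m x k j) = real j / (\<Prod>i\<le>k. real (m i))" .
qed

text \<open>The ratio is \<open>(j + 1) / j \<le> 2\<close>, uniformly in the possibly unbounded
  \<open>m\<close>.\<close>

lemma measure_gen_interval_Suc_le:
  assumes "x \<in> carrier (cyclic_product m)" "x' \<in> carrier (cyclic_product m)" "1 \<le> j" "j < m k"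
  shows "measure (haar m) (gen_interval m x' k (Suc j)) \<le> 2 * measure (haar m) (gen_interval m x k j)"
proof -
  have "0 < (\<Prod>i\<le>k. real (m i))" using m_pos by (intro prod_pos) auto
  then show ?thesis using assms by (simp add: gen_interval_sets_measure divide_simps)
qed

text \<open>A complete arc at level \<open>k > 0\<close> is a cylinder, and thus an arc of length 1
  at level \<open>k - 1\<close>, which is incomplete because \<open>m \<ge> 2\<close>. In this form
  an interval has room for one more residue.\<close>

lemma gen_interval_normal_form:
  assumes "I \<in> gen_intervals m" "I \<noteq> carrier (cyclic_product m)"
  obtains x k j where "I = gen_interval m x k j" "x \<in> carrier (cyclic_product m)" "1 \<le> j" "j < m k"
proof -
  from assms(1) obtain x k j where I: "I = gen_interval m x k j" "x \<in> carrier (cyclic_product m)" "1 \<le> j" "j \<le> m k"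
    by (rule gen_intervalsE)
  show thesis
  proof (cases "j < m k")
    case True
    then show thesis using I that by blast
  next
    case False
    then have j: "j = m k" using I by simp
    show thesis
    proof (cases k)
      case 0
      then show thesis using assms(2) I(1) unfolding j gen_interval_full by simp
    next
      case (Suc l)
      have "I = gen_interval m x l 1"
      proof -
        have "z l = x l \<longleftrightarrow> (z l - x l) mod int (m l) < 1" if "z \<in> carrier (cyclic_product m)" for z
        proof
          assume "(z l - x l) mod int (m l) < 1"
          then have "(z l - x l) mod int (m l) = 0" using m_pos[of l] by (smt (verit) pos_mod_sign)
          then have "z l mod int (m l) = x l mod int (m l)" by (simp add: mod_eq_dvd_iff mod_0_imp_dvd)
          then show "z l = x l" using that I(2) by (simp add: carrier_cyclic_product[OF m])
        qed simp
        then show ?thesis unfolding I j gen_interval_full Suc by (auto simp: gen_interval_def less_Suc_eq)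
      qed
      moreover have "1 < m l" using m[of l] by simp
      ultimately show thesis using that[of x l 1] I(2) by simp
    qed
  qed
qed

text \<open>One residue is added to the arc of \<open>I\<close>. If \<open>Q\<close> has a coarser
  level or a complete arc, the right side always works. Otherwise both are arcs of the same level:
  if \<open>I\<close> starts strictly after \<open>Q\<close> there is room on the left, and if they
  start together there is room on the right.\<close>

lemma gen_intervals_extend:
  assumes I: "I \<in> gen_intervals m" and Q: "Q \<in> gen_intervals m" and IQ: "I \<subset> Q"
  shows "\<exists>J\<in>gen_intervals m. I \<subset> J \<and> J \<subseteq> Q \<and> measure (haar m) J \<le> 2 * measure (haar m) I"
proof -
  have carr: "J \<subseteq> carrier (cyclic_product m)" if "J \<in> gen_intervals m" for J
    using that by (auto elim!: gen_intervalsE simp: gen_interval_def)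
  have "I \<noteq> carrier (cyclic_product m)" using IQ carr[OF Q] by auto
  with I obtain x l j where Ix: "I = gen_interval m x l j" and x: "x \<in> carrier (cyclic_product m)"
     and j: "1 \<le> j" "j < m l"
    by (rule gen_interval_normal_form)
  from Q obtain y k n where Qy: "Q = gen_interval m y k n" and y: "y \<in> carrier (cyclic_product m)"
     and n: "1 \<le> n" "n \<le> m k"
    by (rule gen_intervalsE)
  define M where "M = int (m l)"
  have M: "0 < M" "int j < M" using j by (auto simp: M_def)
  have xI: "x \<in> I" using gen_interval_center x j by (simp add: Ix)
  then have xQ: "x \<in> Q" using IQ by auto
  have kl: "k \<le> l"
  proof (rule ccontr)
    assume "\<not> k \<le> l"
    then have "Q \<subseteq> I" using gen_intervals_nested[of x l j y k n x] I Q xI xQ Ix Qy by auto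
    then show False using IQ by auto
  qed
  \<comment> \<open>Moving only coordinate \<open>l\<close> yields the points that witness strict
    inclusions, and with \<open>- 1\<close> the new left end.\<close>
  define move where "move i = x(l := (x l + i) mod M)" for i
  have move: "move i \<in> carrier (cyclic_product m)" for i
    using x M by (auto simp: move_def M_def carrier_cyclic_product[OF m])
  have ext: ?thesis
    if "x' \<in> carrier (cyclic_product m)" "gen_interval m x l j \<subset> gen_interval m x' l (Suc j)" "gen_interval m x' l (Suc j) \<subseteq> Q" for x'
  proof -
    have "gen_interval m x' l (Suc j) \<in> gen_intervals m" using that j by (intro gen_interval_mem) auto
    then show ?thesis using that measure_gen_interval_Suc_le[OF x that(1) j] unfolding Ix by blast
  qed
  have right: "gen_interval m x l j \<subset> gen_interval m x l (Suc j)"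
  proof -
    have "move (int j) \<in> gen_interval m x l (Suc j)" "move (int j) \<notin> gen_interval m x l j"
      using M move[of "int j"] by (auto simp: gen_interval_def move_def M_def mod_simps)
    moreover have "gen_interval m x l j \<subseteq> gen_interval m x l (Suc j)" by (auto simp: gen_interval_def)
    ultimately show ?thesis by blast
  qed
  show ?thesis
  proof (cases "k = l \<and> n < m k")
    case False
    have "gen_interval m x l (Suc j) \<subseteq> Q"
    proof (cases "k = l")
      case True
      then have nk: "n = m k" using False n by simp
      have "Q = {z \<in> carrier (cyclic_product m). \<forall>i<k. z i = y i}"
        unfolding Qy nk by (rule gen_interval_full)
      then show ?thesis using xQ True by (auto simp: gen_interval_def)
    next
      case False
      then show ?thesis using kl xQ unfolding Qy by (auto simp: gen_interval_def)
    qed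
    then show ?thesis using ext[OF x right] by blast
  next
    case True
    define e where "e = (x l - y l) mod M"
    have e: "0 \<le> e" "e < int n" using xQ True M(1) by (auto simp: Qy gen_interval_def e_def M_def)
    have nM: "int n < M" using True by (auto simp: M_def)
    have agree: "\<forall>i<l. x i = y i" using xQ True by (auto simp: Qy gen_interval_def)
    have off: "(z - y l) mod M = ((z - x l) mod M + e) mod M" for z
      unfolding e_def by (rule shift_mod)
    \<comment> \<open>Otherwise the point of \<open>I\<close> at offset \<open>int n - e\<close>
      from its left end would have offset \<open>n\<close> in \<open>Q\<close>, just beyond the end
      of the arc; as \<open>n < m k\<close>, this offset does not wrap around.\<close>
    have ejn: "e + int j \<le> int n"
    proof (rule ccontr)
      assume "\<not> ?thesis"
      then have "int n - e < int j" by simp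
      then have "move (int n - e) \<in> I"
        using move M e by (auto simp: Ix gen_interval_def move_def M_def[symmetric] mod_simps)
      then have "(move (int n - e) l - y l) mod M < int n" using IQ True by (auto simp: Qy gen_interval_def M_def)
      moreover have "(move (int n - e) l - y l) mod M = int n"
      proof -
        have "(move (int n - e) l - x l) mod M = int n - e"
          using e nM by (simp add: move_def mod_simps)
        then show ?thesis using off[of "move (int n - e) l"] nM by simp
      qed
      ultimately show False by simp
    qed
    have inQ: "z \<in> Q" if "z \<in> carrier (cyclic_product m)" "\<forall>i<l. z i = x i" "(z l - y l) mod M < int n" for z
      using that agree True by (auto simp: Qy gen_interval_def M_def)
    show ?thesis
    proof (cases "e = 0")
      case True
      have xy: "x l = y l"
      proof -
        have "x l mod M = y l mod M" using True by (simp add: e_def mod_eq_dvd_iff mod_0_imp_dvd)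
        then show ?thesis using x y by (simp add: M_def carrier_cyclic_product[OF m])
      qed
      have "j \<noteq> n"
      proof
        assume "j = n"
        then have "I = Q" unfolding Ix Qy using \<open>k = l \<and> n < m k\<close> agree xy
          by (auto intro!: gen_interval_cong simp: le_less)
        then show False using IQ by auto
      qed
      then have "j < n" using ejn True by simp
      then have "gen_interval m x l (Suc j) \<subseteq> Q"
        using xy by (auto intro!: inQ simp: gen_interval_def M_def)
      then show ?thesis using ext[OF x right] by blast
    next
      case False
      define x' where "x' = move (- 1)"
      have x'l: "(z - x' l) mod M = ((z - x l) mod M + 1) mod M" for z
        by (simp add: x'_def move_def mod_simps algebra_simps)
      have x'i: "i \<noteq> l \<Longrightarrow> x' i = x i" for i by (simp add: x'_def move_def)
      have bnd: "0 \<le> (z - x l) mod M" "(z - x l) mod M < M" for z using M by auto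
      have "gen_interval m x l j \<subseteq> gen_interval m x' l (Suc j)"
      proof
        fix z assume z: "z \<in> gen_interval m x l j"
        then have "(z l - x l) mod M < int j" by (simp add: gen_interval_def M_def)
        then have "(z l - x' l) mod M = (z l - x l) mod M + 1"
          unfolding x'l using M bnd[of "z l"] by (intro mod_pos_pos_trivial) auto
        then show "z \<in> gen_interval m x' l (Suc j)" using z x'i by (auto simp: gen_interval_def M_def)
      qed
      moreover have "x' \<in> gen_interval m x' l (Suc j)" using move by (intro gen_interval_center) (auto simp: x'_def)
      moreover have "x' \<notin> gen_interval m x l j"
      proof -
        have "(x' l - x l) mod M = (- 1) mod M" by (simp add: x'_def move_def mod_simps)
        also have "\<dots> = M - 1" using M by (simp add: zmod_minus1)
        finally show ?thesis using M by (auto simp: gen_interval_def M_def)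
      qed
      moreover have "gen_interval m x' l (Suc j) \<subseteq> Q"
      proof
        fix z assume z: "z \<in> gen_interval m x' l (Suc j)"
        have "(x' l - y l) mod M = (e - 1) mod M"
          unfolding e_def by (simp add: x'_def move_def mod_simps algebra_simps)
        also have "\<dots> = e - 1" using e False nM by (intro mod_pos_pos_trivial) auto
        finally have "(z l - y l) mod M = ((z l - x' l) mod M + (e - 1)) mod M"
          using shift_mod[of "z l" "y l" M "x' l"] by simp
        also have "\<dots> \<le> (z l - x' l) mod M + (e - 1)"
          using M e False by (intro zmod_le_nonneg_dividend add_nonneg_nonneg) auto
        also have "\<dots> < int n" using z ejn by (simp add: gen_interval_def M_def)
        finally show "z \<in> Q" using z x'i by (intro inQ) (auto simp: gen_interval_def)
      qed
      ultimately show ?thesis using ext[of x'] move by (auto simp: x'_def)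
    qed
  qed
qed

lemma open_contains_cylinder:
  fixes U :: "(nat \<Rightarrow> int) set"
  assumes "open U" "z \<in> U"
  obtains K where "{w. \<forall>i<K. w i = z i} \<subseteq> U"
proof -
  from product_topology_open_contains_basis[of "\<lambda>_. euclidean" UNIV U z] assms
  obtain X where X: "z \<in> (\<Pi>\<^sub>E i\<in>UNIV. X i)" "finite {i. X i \<noteq> UNIV}" "(\<Pi>\<^sub>E i\<in>UNIV. X i) \<subseteq> U"
    unfolding open_fun_def by auto
  obtain K where K: "\<And>i. X i \<noteq> UNIV \<Longrightarrow> i < K"
    using X(2) unfolding finite_nat_iff_bounded by auto
  have "{w. \<forall>i<K. w i = z i} \<subseteq> (\<Pi>\<^sub>E i\<in>UNIV. X i)"
  proof
    fix w assume w: "w \<in> {w. \<forall>i<K. w i = z i}"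
    have "w i \<in> X i" for i
    proof (cases "i < K")
      case True
      then show ?thesis using w X(1) by (auto simp: PiE_iff)
    next
      case False
      then show ?thesis using K[of i] by auto
    qed
    then show "w \<in> (\<Pi>\<^sub>E i\<in>UNIV. X i)" by auto
  qed
  then show thesis using that X(3) by blast
qed

text \<open>Outer regularity gives an open \<open>U\<close> of almost the same measure. Cylinders
  form a base of the topology, so the intervals contained in both \<open>U\<close> and
  \<open>Q\<close> already cover \<open>A\<close>.\<close>

lemma gen_intervals_outer:
  assumes A: "A \<in> sets (haar m)" and Q: "Q \<in> gen_intervals m" and AQ: "A \<subseteq> Q" and e: "0 < e"
  shows "\<exists>C\<subseteq>gen_intervals m. A \<subseteq> \<Union>C \<and> (\<forall>I\<in>C. I \<subseteq> Q) \<and> measure (haar m) (\<Union>C) \<le> measure (haar m) A + e"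
proof -
  let ?G = "carrier (cyclic_product m)"
  interpret prob_space "haar m" by (rule prob_space_haar[OF m])
  have idm: "(\<lambda>x. x) \<in> measurable (haar m) borel"
  proof (rule measurableI)
    fix B :: "(nat \<Rightarrow> int) set" assume "B \<in> sets borel"
    then show "(\<lambda>x. x) -` B \<inter> space (haar m) \<in> sets (haar m)"
      unfolding sets_haar space_haar sets_restrict_space by auto
  qed simp
  \<comment> \<open>The group is a subspace of the Polish space of all integer sequences; pushing
    the measure forward there makes outer regularity applicable.\<close>
  define N where "N = distr (haar m) borel (\<lambda>x. x)"
  have N: "emeasure N B = emeasure (haar m) (B \<inter> ?G)" if "B \<in> sets borel" for B
    using that idm unfolding N_def by (simp add: emeasure_distr space_haar)
  obtain B where B: "B \<in> sets borel" "A = ?G \<inter> B"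
    using A unfolding sets_haar sets_restrict_space by auto
  have NA: "emeasure N B = emeasure (haar m) A" using N B by (simp add: Int_commute)
  have "emeasure N B = (INF U\<in>{U. B \<subseteq> U \<and> open U}. emeasure N U)"
  proof (rule outer_regular)
    show "emeasure N (space N) \<noteq> \<infinity>" using N[of UNIV] by (simp add: N_def)
  qed (use B in \<open>auto simp: N_def\<close>)
  moreover have "emeasure N B < emeasure N B + ennreal e"
    using e unfolding NA by (simp add: emeasure_eq_measure ennreal_plus[symmetric] ennreal_less_iff del: ennreal_plus)
  ultimately obtain U where U: "B \<subseteq> U" "open U" "emeasure N U < emeasure N B + ennreal e"
    by (auto simp: INF_less_iff)
  have Us: "U \<inter> ?G \<in> sets (haar m)"
    using measurable_sets[OF idm, of U] U by (simp add: space_haar)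
  have "ennreal (measure (haar m) (U \<inter> ?G)) < ennreal (measure (haar m) A + e)"
    using U(3) N[of U] U(2) e unfolding NA by (simp add: emeasure_eq_measure)
  then have Um: "measure (haar m) (U \<inter> ?G) \<le> measure (haar m) A + e"
    by (meson ennreal_leI linorder_not_less order_less_imp_le)
  define C where "C = {I \<in> gen_intervals m. I \<subseteq> U \<inter> Q}"
  have "A \<subseteq> \<Union>C"
  proof
    fix z assume z: "z \<in> A"
    then have zG: "z \<in> ?G" and zU: "z \<in> U" and zQ: "z \<in> Q" using B U AQ by auto
    obtain y k n where Qy: "Q = gen_interval m y k n" using gen_intervalsE[OF Q] by blast
    obtain K where K: "{w. \<forall>i<K. w i = z i} \<subseteq> U" using open_contains_cylinder[OF U(2) zU] .
    \<comment> \<open>The level is at least \<open>K\<close> to stay inside \<open>U\<close>, and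
      greater than the level \<open>k\<close> of \<open>Q\<close> to stay inside
      \<open>Q\<close>.\<close>
    define I where "I = gen_interval m z (max K (Suc k)) 1"
    have "I \<in> gen_intervals m"
      unfolding I_def using zG m[of "max K (Suc k)"] by (intro gen_interval_mem) auto
    moreover have "I \<subseteq> U" using K by (auto simp: I_def gen_interval_def)
    moreover have "I \<subseteq> Q" using zQ by (auto simp: I_def gen_interval_def Qy)
    moreover have "z \<in> I" using zG by (simp add: I_def gen_interval_center)
    ultimately show "z \<in> \<Union>C" unfolding C_def by blast
  qed
  moreover have "measure (haar m) (\<Union>C) \<le> measure (haar m) (U \<inter> ?G)"
    using Us by (intro finite_measure_mono) (auto simp: C_def elim!: gen_intervalsE simp: gen_interval_def)
  ultimately show ?thesis using Um by (intro exI[of _ C]) (auto simp: C_def)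
qed

end

section \<open>From essential bounds on the exponents to bounds at every point\<close>

lemma modular_cong_AE:
  assumes "AE x in M. p x = p' x"
  shows "modular M p u = modular M p' u"
  unfolding modular_def using assms by (intro nn_integral_cong_AE) auto

lemma AE_ereal_less_essinf:
  assumes "ereal a < essinf M (\<lambda>x. ereal (p x))" "a < b"
  obtains c where "a < c" "c \<le> b" "AE x in M. c \<le> p x"
proof -
  obtain r where r: "ereal a < r" "AE x in M. r \<le> ereal (p x)"
    using assms(1) unfolding essinf_def less_Sup_iff by auto
  \<comment> \<open>The lower bound \<open>r\<close> may be infinite as an extended real, hence the
    cap at \<open>b\<close>.\<close>
  define c where "c = (if r \<le> ereal b then real_of_ereal r else b)"
  have c: "a < c" "c \<le> b" "ereal c \<le> r"
    using r(1) assms(2) by (cases r; auto simp: c_def)+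
  have "AE x in M. c \<le> p x"
    using r(2) by eventually_elim (use c(3) ereal_less_eq(3) order_trans in blast)
  with c(1,2) show thesis by (rule that)
qed

lemma AE_le_real_if_esssup_finite:
  assumes "p \<in> borel_measurable M" "esssup M (\<lambda>x. ereal (p x)) < \<infinity>"
  obtains B :: real where "b \<le> B" "AE x in M. p x \<le> B"
proof -
  obtain r where r: "esssup M (\<lambda>x. ereal (p x)) \<le> ereal r"
    using assms(2) by (metis less_ereal.simps(4) linorder_not_less ereal_dense2 less_imp_le)
  have "AE x in M. ereal (p x) \<le> esssup M (\<lambda>x. ereal (p x))"
    using assms(1) by (intro esssup_AE)
  then have "AE x in M. p x \<le> max b r"
    by eventually_elim (use r in \<open>auto simp: max_def intro: order_trans dest: order_trans\<close>)
  then show thesis using that[of "max b r"] by simp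
qed

lemma interval_basis_haar:
  assumes m: "\<And>i. m i \<ge> 2"
  shows "interval_basis (haar m) (gen_intervals m)"
proof -
  interpret prob_space "haar m" by (rule prob_space_haar[OF m])
  show ?thesis
  proof
    fix I assume "I \<in> gen_intervals m"
    then obtain x k j where I: "I = gen_interval m x k j" "x \<in> carrier (cyclic_product m)" "1 \<le> j" "j \<le> m k"
      by (rule gen_intervalsE[OF m])
    show "I \<in> sets (haar m)" using I gen_interval_sets_measure[OF m] by simp
    have "0 < (\<Prod>i\<le>k. real (m i))" using m_pos[OF m] by (intro prod_pos) auto
    then show "0 < measure (haar m) I" using I gen_interval_sets_measure[OF m] by simp
  qed (rule gen_intervals_countable[OF m] gen_intervals_triple[OF m] gen_intervals_extend[OF m]
        gen_intervals_finite_above[OF m] gen_intervals_outer[OF m]; assumption)+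
qed

theorem corollary1p7:
  fixes m :: "nat \<Rightarrow> nat" and p p' :: "(nat \<Rightarrow> int) \<Rightarrow> real"
  assumes "\<And>i. m i \<ge> 2"
    and "exponent_fun (haar m) p"
    and "1 < essinf (haar m) (\<lambda>x. ereal (p x))"
    and "essinf (haar m) (\<lambda>x. ereal (p x)) \<le> esssup (haar m) (\<lambda>x. ereal (p x))"
    and "esssup (haar m) (\<lambda>x. ereal (p x)) < \<infinity>"
    and "exponent_fun (haar m) p'"
    and "conjugate_exponents (haar m) p p'"
  shows "maximal_bounded m p \<longleftrightarrow> maximal_bounded m p'"
proof -
  interpret interval_basis "haar m" "gen_intervals m" by (rule interval_basis_haar[OF assms(1)])
  have pm[measurable]: "p \<in> borel_measurable (haar m)" "p' \<in> borel_measurable (haar m)"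
    using assms(2,6) by (auto simp: exponent_fun_def)
  obtain c where c: "1 < c" "c \<le> 2" "AE x in haar m. c \<le> p x"
    by (rule AE_ereal_less_essinf[of 1 "haar m" p 2]) (use assms(3) in \<open>auto simp: one_ereal_def\<close>)
  obtain B where B: "2 \<le> B" "AE x in haar m. p x \<le> B"
    using AE_le_real_if_esssup_finite[OF pm(1) assms(5)] by blast
  \<comment> \<open>As \<open>p' x = 1 + 1 / (p x - 1)\<close> almost everywhere, the bounds
    \<open>c\<close> and \<open>B\<close> for \<open>p\<close> become \<open>1 + 1 / (B - 1)\<close>
    and \<open>1 + 1 / (c - 1)\<close> for \<open>p'\<close>.\<close>
  define c' where "c' = min c (1 + 1 / (B - 1))"
  define B' where "B' = max B (1 + 1 / (c - 1))"
  have bounds: "1 < c'" "c' \<le> 2" "2 \<le> B'" using c B by (auto simp: c'_def B'_def)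
  define good where "good x \<longleftrightarrow> (c' \<le> p x \<and> p x \<le> B' \<and> c' \<le> p' x \<and> p' x \<le> B') \<and> 1 / p x + 1 / p' x = 1" for x
  \<comment> \<open>The default 2 is its own conjugate. The bounds \<open>c \<le> 2 \<le> B\<close>
    were arranged so that it also lies between \<open>c'\<close> and \<open>B'\<close>.\<close>
  define q where "q x = (if good x then p x else 2)" for x
  define q' where "q' x = (if good x then p' x else 2)" for x
  have conj: "AE x in haar m. 1 / p x + 1 / p' x = 1" using assms(7) by (simp add: conjugate_exponents_def)
  have AE_good: "AE x in haar m. good x"
    using c(3) B(2) conj
  proof eventually_elim
    case (elim x)
    have p1: "1 < p x" using elim c by simp
    have "p' x \<noteq> 0" using elim p1 by auto
    then have "p' x * (p x - 1) = p x" using elim p1 by (simp add: field_simps)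
    then have p': "p' x = 1 + 1 / (p x - 1)" using p1 by (simp add: field_simps)
    have "1 / (B - 1) \<le> 1 / (p x - 1)" "1 / (p x - 1) \<le> 1 / (c - 1)"
      using elim c B p1 by (auto intro!: divide_left_mono)
    then show ?case using elim p' by (auto simp: good_def c'_def B'_def min_le_iff_disj le_max_iff_disj)
  qed
  have [measurable]: "Measurable.pred (haar m) good" unfolding good_def by measurable
  have cw: "conjugate_within c' B' q q'"
    unfolding conjugate_within_def
  proof (intro conjI allI)
    show "q \<in> borel_measurable (haar m)" "q' \<in> borel_measurable (haar m)"
      unfolding q_def q'_def by measurable
  qed (use bounds in \<open>auto simp: q_def q'_def good_def\<close>)
  \<comment> \<open>The exponent enters only through the modular, which depends on it only up to
    null sets.\<close>
  have eq: "maximal_bounded m r \<longleftrightarrow> maximal_op_bounded r'" if "AE x in haar m. r x = r' x" for r r'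
  proof -
    have "maximal_fun m f = maximal_op f" for f by (simp add: fun_eq_iff maximal_fun_def maximal_op_def)
    then show ?thesis
      unfolding maximal_bounded_def maximal_op_bounded_def luxemburg_norm_def variable_Lebesgue_def
        modular_cong_AE[OF that] by simp
  qed
  have "AE x in haar m. p x = q x" using AE_good by eventually_elim (simp add: q_def)
  moreover have "AE x in haar m. p' x = q' x" using AE_good by eventually_elim (simp add: q'_def)
  ultimately show ?thesis using maximal_op_bounded_dual[OF cw] eq by blast
qed

end
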